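(* Fix $\delta\in(0,1)$. There exist a compact, connected, smooth Riemannian manifold $(M,g)$ of dimension $n\ge2$, a number $s\in(0,n)$, and an $s$-Ahlfors--David regular finite Borel measure $\mu$ on $M$ admitting an averaged $s$-density constant $A_\mu\in(0,\infty)$ such that the asymptotic $$N_\mu(\lambda)=C_{n,s}\,A_\mu\,\lambda^{n-s}+O(\lambda^{n-s-\delta})\qquad(\lambda\to\infty)$$ fails to hold, where $C_{n,s}=(2\pi)^{-(n-s)}\operatorname{vol}(B^{n-s})$.
   Context: Let $\{e_j\}_{j\ge 0}$ be a complete orthonormal basis of $L^2(M)$ consisting of real Laplace eigenfunctions, $-\Delta_g e_j=\lambda_j^2 e_j$, with $0=\lambda_0<\lambda_1\le\lambda_2\le\cdots$. For a finite Borel measure $\mu$ on $M$ the Kuznecov sum is $$N_\mu(\lambda):=\sum_{\lambda_j\le\lambda}\Bigl|\int_M e_j\,d\mu\Bigr|^2,\qquad \lambda\ge1.$$ For real $s>0$, $\operatorname{vol}(B^s):=\pi^{s/2}/\Gamma(\tfrac s2+1)$. Let $d_g$ be the Riemannian distance, and let $F(r):=(\mu\times\mu)(\{(x,y)\in M\times M: d_g(x,y)\le r\})$, $r\ge0$. The measure $\mu$ admits an averaged $s$-density constant $A_\mu\in(0,\infty)$ if $F(r)=\operatorname{vol}(B^s)\,A_\mu\,r^s+o(r^s)$ as $r\to0^+$. A finite Borel measure $\mu$ on $M$ is $s$-Ahlfors--David regular if there exist constants $c,C>0$ and $r_0>0$ such that $c\,r^s\le\mu(B(x,r))\le C\,r^s$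 for all $x\in\operatorname{supp}\mu$ and $0<r\le r_0$, where $B(x,r)$ is the geodesic ball of radius $r$ centered at $x$ with respect to $d_g$. *)

theory Defs
  imports
    "HOL-Analysis.Analysis"
    "HOL-Library.Landau_Symbols"
    "Jordan_Normal_Form.Determinant"
begin

section \<open>Calculus in coordinates\<close>

text \<open>
  The dimension of a manifold is a number, not a type, so the model space $R^n$ is
  the topspace of \<^term>\<open>Euclidean_space n\<close>: the functions \<^typ>\<open>nat \<Rightarrow> real\<close> vanishing at all
  indices \<open>\<ge> n\<close>.
\<close>

definition partial :: "nat \<Rightarrow> ((nat \<Rightarrow> real) \<Rightarrow> real) \<Rightarrow> (nat \<Rightarrow> real) \<Rightarrow> real" where
  "partial i f x = deriv (\<lambda>t. f (x(i := t))) (x i)"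

text \<open>
  On an open subset \<open>V\<close> of $R^n$: all iterated partial derivatives, of every order and in
  every sequence of directions, exist and are continuous.
\<close>

definition smooth_on_coords :: "nat \<Rightarrow> (nat \<Rightarrow> real) set \<Rightarrow> ((nat \<Rightarrow> real) \<Rightarrow> real) \<Rightarrow> bool" where
  "smooth_on_coords n V f \<longleftrightarrow>
     (\<forall>is \<in> lists {..<n}.
        continuous_on V (foldr partial is f) \<and>
        (\<forall>i<n. \<forall>x\<in>V. (\<lambda>t. foldr partial is f (x(i := t))) differentiable at (x i)))"

definition lebesgue_coords :: "nat \<Rightarrow> (nat \<Rightarrow> real) measure" where
  "lebesgue_coords n =
     distr (Pi\<^sub>M {..<n} (\<lambda>_. lborel)) borel (\<lambda>x i. if i < n then x i else 0)"


section \<open>Riemannian manifolds\<close>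

text \<open>A chart is a domain together with a coordinate map.\<close>

type_synonym 'a chart = "'a set \<times> ('a \<Rightarrow> nat \<Rightarrow> real)"

text \<open>
  The component \<open>metric_of R c x\<close> is the coefficient matrix of the metric in the chart \<open>c\<close> at
  the point with coordinates \<open>x\<close>.
\<close>

record 'a riemannian =
  top_of    :: "'a topology"
  dim_of    :: nat
  atlas_of  :: "'a chart set"
  metric_of :: "'a chart \<Rightarrow> (nat \<Rightarrow> real) \<Rightarrow> real mat"

abbreviation points :: "'a riemannian \<Rightarrow> 'a set" where
  "points R \<equiv> topspace (top_of R)"

definition chart_image :: "'a chart \<Rightarrow> (nat \<Rightarrow> real) set" where
  "chart_image c = snd c ` fst c"

definition chart_inv :: "'a chart \<Rightarrow> (nat \<Rightarrow> real) \<Rightarrow> 'a" where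
  "chart_inv c = inv_into (fst c) (snd c)"

definition is_chart :: "'a topology \<Rightarrow> nat \<Rightarrow> 'a chart \<Rightarrow> bool" where
  "is_chart T n c \<longleftrightarrow>
     openin T (fst c) \<and>
     openin (Euclidean_space n) (chart_image c) \<and>
     homeomorphic_map (subtopology T (fst c))
       (subtopology (Euclidean_space n) (chart_image c)) (snd c)"

definition transition :: "'a chart \<Rightarrow> 'a chart \<Rightarrow> (nat \<Rightarrow> real) \<Rightarrow> nat \<Rightarrow> real" where
  "transition c c' x = snd c' (chart_inv c x)"

definition smooth_atlas :: "'a topology \<Rightarrow> nat \<Rightarrow> 'a chart set \<Rightarrow> bool" where
  "smooth_atlas T n \<A> \<longleftrightarrow>
     (\<forall>c\<in>\<A>. is_chart T n c) \<and>
     (\<Union>c\<in>\<A>. fst c) = topspace T \<and>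
     (\<forall>c\<in>\<A>. \<forall>c'\<in>\<A>. \<forall>k<n.
        smooth_on_coords n (snd c ` (fst c \<inter> fst c')) (\<lambda>x. transition c c' x k))"

definition smooth_metric ::
  "nat \<Rightarrow> 'a chart set \<Rightarrow> ('a chart \<Rightarrow> (nat \<Rightarrow> real) \<Rightarrow> real mat) \<Rightarrow> bool" where
  "smooth_metric n \<A> g \<longleftrightarrow>
     (\<forall>c\<in>\<A>.
        (\<forall>x\<in>chart_image c. g c x \<in> carrier_mat n n) \<and>
        (\<forall>i<n. \<forall>j<n. smooth_on_coords n (chart_image c) (\<lambda>x. g c x $$ (i, j))) \<and>
        (\<forall>x\<in>chart_image c. \<forall>i<n. \<forall>j<n. g c x $$ (i, j) = g c x $$ (j, i)) \<and>
        (\<forall>x\<in>chart_image c. \<forall>v. (\<exists>i<n. v i \<noteq> 0) \<longrightarrow>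
           (\<Sum>i<n. \<Sum>j<n. g c x $$ (i, j) * v i * v j) > 0)) \<and>
     (\<forall>c\<in>\<A>. \<forall>c'\<in>\<A>. \<forall>x \<in> snd c ` (fst c \<inter> fst c'). \<forall>i<n. \<forall>j<n.
        g c x $$ (i, j) =
          (\<Sum>k<n. \<Sum>l<n.
             partial i (\<lambda>y. transition c c' y k) x * partial j (\<lambda>y. transition c c' y l) x *
             g c' (transition c c' x) $$ (k, l)))"

definition compact_connected_riemannian_manifold :: "'a riemannian \<Rightarrow> bool" where
  "compact_connected_riemannian_manifold R \<longleftrightarrow>
     points R \<noteq> {} \<and>
     Hausdorff_space (top_of R) \<and> second_countable (top_of R) \<and>
     compact_space (top_of R) \<and> connected_space (top_of R) \<and>
     smooth_atlas (top_of R) (dim_of R) (atlas_of R) \<and>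
     smooth_metric (dim_of R) (atlas_of R) (metric_of R)"

definition smooth_fun :: "'a riemannian \<Rightarrow> ('a \<Rightarrow> real) \<Rightarrow> bool" where
  "smooth_fun R f \<longleftrightarrow>
     (\<forall>c\<in>atlas_of R. smooth_on_coords (dim_of R) (chart_image c) (\<lambda>x. f (chart_inv c x)))"


subsection \<open>Distance\<close>

text \<open>
  A $C^1$ arc inside a single chart, parametrised by \<open>[0,1]\<close> (one-sided derivatives at the
  end points), given by its coordinate expression.
\<close>

definition C1_arc :: "nat \<Rightarrow> 'a chart \<Rightarrow> (real \<Rightarrow> nat \<Rightarrow> real) \<Rightarrow> bool" where
  "C1_arc n c \<eta> \<longleftrightarrow>
     (\<forall>t\<in>{0..1}. \<eta> t \<in> chart_image c) \<and>
     (\<forall>i<n. (\<lambda>t. \<eta> t i) differentiable_on {0..1} \<and>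
        continuous_on {0..1} (\<lambda>t. vector_derivative (\<lambda>u. \<eta> u i) (at t within {0..1})))"

definition arc_length :: "nat \<Rightarrow> ((nat \<Rightarrow> real) \<Rightarrow> real mat) \<Rightarrow> (real \<Rightarrow> nat \<Rightarrow> real) \<Rightarrow> real" where
  "arc_length n G \<eta> =
     integral {0..1} (\<lambda>t. sqrt (\<Sum>i<n. \<Sum>j<n. G (\<eta> t) $$ (i, j) *
        vector_derivative (\<lambda>u. \<eta> u i) (at t within {0..1}) *
        vector_derivative (\<lambda>u. \<eta> u j) (at t within {0..1})))"

text \<open>
  \<open>joined R p q L\<close>: some piecewise $C^1$ curve from \<open>p\<close> to \<open>q\<close> has length \<open>L\<close>. By compactness
  of the parameter interval, every such curve can be subdivided into finitely many $C^1$ arcs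
  that each lie in a single chart.
\<close>

inductive joined :: "'a riemannian \<Rightarrow> 'a \<Rightarrow> 'a \<Rightarrow> real \<Rightarrow> bool" for R p where
  const: "p \<in> points R \<Longrightarrow> joined R p p 0"
| arc: "joined R p (chart_inv c (\<eta> 0)) L \<Longrightarrow> c \<in> atlas_of R \<Longrightarrow> C1_arc (dim_of R) c \<eta> \<Longrightarrow>
    joined R p (chart_inv c (\<eta> 1)) (L + arc_length (dim_of R) (metric_of R c) \<eta>)"

definition riem_dist :: "'a riemannian \<Rightarrow> 'a \<Rightarrow> 'a \<Rightarrow> real" where
  "riem_dist R p q = Inf {L. joined R p q L}"

definition geodesic_ball :: "'a riemannian \<Rightarrow> 'a \<Rightarrow> real \<Rightarrow> 'a set" where
  "geodesic_ball R p r = {q \<in> points R. riem_dist R p q < r}"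


subsection \<open>Volume measure and Laplace--Beltrami operator\<close>

abbreviation borel_sets :: "'a riemannian \<Rightarrow> 'a set set" where
  "borel_sets R \<equiv> sigma_sets (points R) {U. openin (top_of R) U}"

text \<open>The Riemannian volume is the unique Borel measure with density $\sqrt{\det g}$ in every chart.\<close>

definition is_riem_volume :: "'a riemannian \<Rightarrow> 'a measure \<Rightarrow> bool" where
  "is_riem_volume R \<nu> \<longleftrightarrow>
     space \<nu> = points R \<and> sets \<nu> = borel_sets R \<and>
     (\<forall>c\<in>atlas_of R. \<forall>B\<in>borel_sets R. B \<subseteq> fst c \<longrightarrow>
        emeasure \<nu> B =
          (\<integral>\<^sup>+ x. ennreal (sqrt (Determinant.det (metric_of R c x))) * indicator (snd c ` B) x
             \<partial>lebesgue_coords (dim_of R)))"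

definition riem_volume :: "'a riemannian \<Rightarrow> 'a measure" where
  "riem_volume R = (THE \<nu>. is_riem_volume R \<nu>)"

text \<open>
  $\Delta_g f = \frac{1}{\sqrt{\det g}} \sum_{i,j} \partial_i (\sqrt{\det g}\, g^{ij} \partial_j f)$
  in coordinates; the inverse matrix $g^{ij}$ is the adjugate divided by the determinant.
\<close>

definition laplace_coords ::
  "nat \<Rightarrow> ((nat \<Rightarrow> real) \<Rightarrow> real mat) \<Rightarrow> ((nat \<Rightarrow> real) \<Rightarrow> real) \<Rightarrow> (nat \<Rightarrow> real) \<Rightarrow> real" where
  "laplace_coords n G f x =
     (\<Sum>i<n. partial i
        (\<lambda>y. sqrt (Determinant.det (G y)) *
          (\<Sum>j<n. adj_mat (G y) $$ (i, j) / Determinant.det (G y) * partial j f y)) x)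
     / sqrt (Determinant.det (G x))"

text \<open>\<open>f\<close> is smooth and $-\Delta_g f = \lambda^2 f$.\<close>

definition laplace_eigenfunction :: "'a riemannian \<Rightarrow> real \<Rightarrow> ('a \<Rightarrow> real) \<Rightarrow> bool" where
  "laplace_eigenfunction R l f \<longleftrightarrow>
     smooth_fun R f \<and>
     (\<forall>c\<in>atlas_of R. \<forall>x\<in>chart_image c.
        - laplace_coords (dim_of R) (metric_of R c) (\<lambda>y. f (chart_inv c y)) x
          = l\<^sup>2 * f (chart_inv c x))"

text \<open>Completeness is convergence in $L^2(M)$ of the expansion of every real $L^2$ function.\<close>

definition laplace_eigenbasis :: "'a riemannian \<Rightarrow> (nat \<Rightarrow> 'a \<Rightarrow> real) \<Rightarrow> (nat \<Rightarrow> real) \<Rightarrow> bool" where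
  "laplace_eigenbasis R e lam \<longleftrightarrow>
     (\<forall>j. laplace_eigenfunction R (lam j) (e j)) \<and>
     lam 0 = 0 \<and> 0 < lam 1 \<and> (\<forall>j\<ge>1. lam j \<le> lam (Suc j)) \<and>
     (\<forall>j k. (\<integral>x. e j x * e k x \<partial>riem_volume R) = (if j = k then 1 else 0)) \<and>
     (\<forall>f \<in> borel_measurable (riem_volume R).
        integrable (riem_volume R) (\<lambda>x. (f x)\<^sup>2) \<longrightarrow>
        (\<lambda>N. \<integral>x. (f x - (\<Sum>j<N. (\<integral>y. f y * e j y \<partial>riem_volume R) * e j x))\<^sup>2 \<partial>riem_volume R)
          \<longlonglongrightarrow> 0)"


section \<open>Measures and Kuznecov sums\<close>

definition finite_borel_measure :: "'a riemannian \<Rightarrow> 'a measure \<Rightarrow> bool" where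
  "finite_borel_measure R \<mu> \<longleftrightarrow>
     space \<mu> = points R \<and> sets \<mu> = borel_sets R \<and> finite_measure \<mu>"

definition measure_supp :: "'a riemannian \<Rightarrow> 'a measure \<Rightarrow> 'a set" where
  "measure_supp R \<mu> = {x \<in> points R. \<forall>U. openin (top_of R) U \<and> x \<in> U \<longrightarrow> emeasure \<mu> U > 0}"

definition ahlfors_david_regular :: "'a riemannian \<Rightarrow> real \<Rightarrow> 'a measure \<Rightarrow> bool" where
  "ahlfors_david_regular R s \<mu> \<longleftrightarrow>
     (\<exists>c>0. \<exists>C>0. \<exists>r\<^sub>0>0. \<forall>x\<in>measure_supp R \<mu>. \<forall>r. 0 < r \<and> r \<le> r\<^sub>0 \<longrightarrow>
        c * r powr s \<le> measure \<mu> (geodesic_ball R x r) \<and>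
        measure \<mu> (geodesic_ball R x r) \<le> C * r powr s)"

definition pair_distribution :: "'a riemannian \<Rightarrow> 'a measure \<Rightarrow> real \<Rightarrow> real" where
  "pair_distribution R \<mu> r =
     measure (\<mu> \<Otimes>\<^sub>M \<mu>) {(x, y). x \<in> points R \<and> y \<in> points R \<and> riem_dist R x y \<le> r}"

definition averaged_density_constant :: "'a riemannian \<Rightarrow> real \<Rightarrow> 'a measure \<Rightarrow> real \<Rightarrow> bool" where
  "averaged_density_constant R s \<mu> A \<longleftrightarrow>
     0 < A \<and>
     (\<lambda>r. pair_distribution R \<mu> r - unit_ball_vol s * A * r powr s) \<in> o[at_right 0](\<lambda>r. r powr s)"

definition kuznecov_sum ::
  "(nat \<Rightarrow> 'a \<Rightarrow> real) \<Rightarrow> (nat \<Rightarrow> real) \<Rightarrow> 'a measure \<Rightarrow> real \<Rightarrow> real" where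
  "kuznecov_sum e lam \<mu> L = (\<Sum>j | lam j \<le> L. \<bar>\<integral>x. e j x \<partial>\<mu>\<bar>\<^sup>2)"

definition kuznecov_constant :: "nat \<Rightarrow> real \<Rightarrow> real" where
  "kuznecov_constant n s = (2 * pi) powr - (real n - s) * unit_ball_vol (real n - s)"

end

theory Submission
  imports Defs "HOL-Real_Asymp.Real_Asymp"
begin

text \<open>
  On the flat torus let \<open>\<mu> = f(x) dx\<close> on the closed geodesic \<open>y = 0\<close>, so that \<open>n = 2\<close>,
  \<open>s = 1\<close> and \<open>A = \<integral> f\<^sup>2\<close>. With \<open>a\<^sub>k\<close> the Fourier coefficients of \<open>f\<close>, the lattice points
  \<open>(k, l)\<close> of the disc of radius \<open>\<lambda>\<close> contribute at most
  \<open>(2\<lambda> + 1) / (2\<pi>) \<cdot> \<Sum> a\<^sub>k\<^sup>2\<close>, the sum ranging over \<open>|k| \<le> \<lambda>\<close>, whereas the main term is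
  \<open>(\<lambda> / \<pi>) \<Sum> a\<^sub>k\<^sup>2\<close> over all \<open>k\<close>. Hence the defect is at least a constant times
  \<open>\<lambda> \<Sum> a\<^sub>k\<^sup>2\<close> over \<open>|k| > \<lambda>\<close>, up to a bounded error. For a lacunary \<open>f\<close> with amplitude
  \<open>2^(-j-1)\<close> at frequency \<open>2^(j^2)\<close> this tail decays more slowly than every power of \<open>\<lambda>\<close>, while
  \<open>f\<close> is still continuous with values in \<open>[1, 3]\<close>. Every eigenbasis is covered because only an
  upper bound on the Kuznecov sum is needed, and that is Bessel's inequality for the basis applied
  to the trigonometric polynomial representing \<open>\<mu>\<close> on the low modes.
\<close>

section \<open>The flat torus in four-space\<close>

text \<open>For fixed k the modes (k, l) with |l| up to lambda contribute about lambda / pi times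
  the squared coefficient, and the predicted constant is this contribution summed over every k. A
  frequency above lambda is counted in the prediction but cannot occur in the Kuznecov sum, so to
  leading order the error has a sign, and an upper estimate of the sum exposes it. The exponent j^2
  reconciles two demands. Summable amplitudes make the density continuous, while just below the
  frequency 2^(j^2) the missing squared coefficient is still of order 4^(-j), that is
  lambda^(-o(1)). With frequencies 2^j the same amplitudes would produce a genuine power of lambda.
  The density does not depend on \<delta>. Completeness of the trigonometric modes enters twice: it
  supplies an eigenbasis, so that the claim about all eigenbases is not vacuous, and it makes every
  eigenfunction pointwise a finite combination of modes of its own eigenvalue. Pointwise matters
  because the measure lives on a set of volume zero. The torus sits in the functions
  \<open>nat \<Rightarrow> real\<close> so that its topology and Borel sets are inherited from the
  ambient space.\<close>

definition vec2 :: "real \<Rightarrow> real \<Rightarrow> nat \<Rightarrow> real" where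
  "vec2 x y i = (if i = 0 then x else if i = 1 then y else 0)"

definition emb :: "real \<Rightarrow> real \<Rightarrow> nat \<Rightarrow> real" where
  "emb x y i = (if i = 0 then cos x else if i = 1 then sin x
     else if i = 2 then cos y else if i = 3 then sin y else 0)"

definition torus :: "(nat \<Rightarrow> real) set" where
  "torus = {p. \<exists>x y. p = emb x y}"

text \<open>The angle in \<open>(a, a + 2\<pi>)\<close>: the branch cut of \<^const>\<open>Arg\<close> is rotated onto the ray of angle \<open>a\<close>.\<close>

definition arc_coord :: "real \<Rightarrow> complex \<Rightarrow> real" where
  "arc_coord a z = a + pi + Arg (z * cis (- a - pi))"

definition slit :: "real \<Rightarrow> complex set" where
  "slit a = {z. z * cis (- a - pi) \<notin> \<real>\<^sub>\<le>\<^sub>0}"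

definition pt1 :: "(nat \<Rightarrow> real) \<Rightarrow> complex" where "pt1 p = Complex (p 0) (p 1)"
definition pt2 :: "(nat \<Rightarrow> real) \<Rightarrow> complex" where "pt2 p = Complex (p 2) (p 3)"

text \<open>All base angles are allowed: every point is then the centre of some chart, and every
  straight segment with coordinate displacements below 2 pi fits in a single chart.\<close>

definition torus_chart :: "real \<Rightarrow> real \<Rightarrow> (nat \<Rightarrow> real) chart" where
  "torus_chart a b =
     ({p \<in> torus. pt1 p \<in> slit a \<and> pt2 p \<in> slit b},
      \<lambda>p. vec2 (arc_coord a (pt1 p)) (arc_coord b (pt2 p)))"

abbreviation torus_atlas :: "(nat \<Rightarrow> real) chart set" where
  "torus_atlas \<equiv> {c. \<exists>a b. c = torus_chart a b}"

definition flat_torus :: "(nat \<Rightarrow> real) riemannian" where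
  "flat_torus = \<lparr>top_of = top_of_set torus, dim_of = 2,
     atlas_of = torus_atlas, metric_of = (\<lambda>_ _. 1\<^sub>m 2)\<rparr>"

definition box2 :: "real \<Rightarrow> real \<Rightarrow> (nat \<Rightarrow> real) set" where
  "box2 a b = {v. \<exists>x y. v = vec2 x y \<and> a < x \<and> x < a + 2*pi \<and> b < y \<and> y < b + 2*pi}"

lemma vec2_simps [simp]: "vec2 x y 0 = x" "vec2 x y (Suc 0) = y" "2 \<le> i \<Longrightarrow> vec2 x y i = 0"
  by (auto simp: vec2_def)

lemma vec2_upd [simp]: "(vec2 x y)(0 := t) = vec2 t y" "(vec2 x y)(Suc 0 := t) = vec2 x t"
  by (auto simp: vec2_def)

lemma vec2_eq_iff [simp]: "vec2 x y = vec2 x' y' \<longleftrightarrow> x = x' \<and> y = y'"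
  by (metis vec2_simps(1,2))

lemma coords2_eq_vec2: "(\<And>i. 2 \<le> i \<Longrightarrow> v i = 0) \<Longrightarrow> v = vec2 (v 0) (v 1)"
  by (auto simp: vec2_def fun_eq_iff)

lemma emb_simps [simp]:
  "emb x y 0 = cos x" "emb x y (Suc 0) = sin x" "emb x y 2 = cos y" "emb x y 3 = sin y"
  by (auto simp: emb_def)

lemma pt_emb [simp]: "pt1 (emb x y) = cis x" "pt2 (emb x y) = cis y"
  by (auto simp: pt1_def pt2_def cis.code)

lemma emb_in_torus [simp]: "emb x y \<in> torus"
  by (auto simp: torus_def)

lemma emb_eq_iff: "emb x y = emb x' y' \<longleftrightarrow> cis x = cis x' \<and> cis y = cis y'"
proof
  assume "emb x y = emb x' y'" then show "cis x = cis x' \<and> cis y = cis y'" by (metis pt_emb)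
next
  assume "cis x = cis x' \<and> cis y = cis y'" then show "emb x y = emb x' y'"
    by (auto simp: emb_def fun_eq_iff complex_eq_iff)
qed

lemma cis_shift [simp]: "cis (x + 2*pi* of_int m) = cis x"
  by (simp add: cis_mult[symmetric] cis_multiple_2pi)

lemma emb_shift [simp]:
  "emb (x + 2*pi* of_int m) y = emb x y" "emb x (y + 2*pi* of_int m) = emb x y"
  by (simp_all add: emb_eq_iff)

lemma arc_coord_cis:
  assumes "a < x" "x < a + 2*pi" shows "cis x \<in> slit a" "arc_coord a (cis x) = x"
proof -
  have *: "cis x * cis (- a - pi) = cis (x - a - pi)"
    by (simp add: cis_mult algebra_simps)
  have arg: "Arg (cis (x - a - pi)) = x - a - pi"
    by (rule Arg_unique[of 1]) (use assms in \<open>auto simp: cis_conv_exp\<close>)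
  show "arc_coord a (cis x) = x" unfolding arc_coord_def * arg by simp
  \<comment> \<open>The removed ray consists of the origin and the points where \<open>Arg\<close>
    takes its maximal value pi; the angle here is x - a - pi, strictly below pi because x < a + 2
    pi.\<close>
  have "Arg z = pi \<or> z = 0" if "z \<in> \<real>\<^sub>\<le>\<^sub>0" for z
    using that by (auto simp: complex_nonpos_Reals_iff Arg_eq_pi complex_eq_iff)
  then have "cis (x - a - pi) \<notin> \<real>\<^sub>\<le>\<^sub>0"
    using arg assms by (metis add_diff_cancel_left' cis_neq_zero diff_less_eq less_irrefl mult_2 add.assoc diff_diff_eq add.commute)
  then show "cis x \<in> slit a" unfolding slit_def mem_Collect_eq * .
qed

lemma cis_notin_slit: "cis a \<notin> slit a"
  by (simp add: slit_def cis_mult complex_nonpos_Reals_iff)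

lemma obtain_shift:
  obtains m :: int where "a \<le> x + 2*pi*m" "x + 2*pi*m < a + 2*pi"
proof
  define k where "k = \<lfloor>(x - a) / (2*pi)\<rfloor>"
  have "of_int k \<le> (x - a) / (2*pi)" "(x - a) / (2*pi) < of_int k + 1"
    unfolding k_def by linarith+
  then have "of_int k * (2*pi) \<le> x - a" "x - a < (of_int k + 1) * (2*pi)"
    by (simp_all add: pos_le_divide_eq pos_divide_less_eq)
  then show "a \<le> x + 2*pi* of_int (- k)" "x + 2*pi* of_int (-k) < a + 2*pi"
    by (auto simp: algebra_simps)
qed

lemma cis_slit_iff: "cis x \<in> slit a \<longleftrightarrow> (\<exists>m::int. a < x + 2*pi* of_int m \<and> x + 2*pi* of_int m < a + 2*pi)"
proof
  assume *: "cis x \<in> slit a"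
  obtain m :: int where m: "a \<le> x + 2*pi* of_int m" "x + 2*pi* of_int m < a + 2*pi"
    by (rule obtain_shift)
  have "a \<noteq> x + 2*pi* of_int m"
    using * cis_notin_slit[of a] cis_shift[of x m] by metis
  with m show "\<exists>m::int. a < x + 2*pi* of_int m \<and> x + 2*pi* of_int m < a + 2*pi" by force
next
  assume "\<exists>m::int. a < x + 2*pi* of_int m \<and> x + 2*pi* of_int m < a + 2*pi"
  then show "cis x \<in> slit a" using arc_coord_cis(1) cis_shift by metis
qed

lemma open_slit: "open (slit a)"
proof -
  have "slit a = - ((\<lambda>z. z * cis (- a - pi)) -` \<real>\<^sub>\<le>\<^sub>0)" by (auto simp: slit_def)
  moreover have "closed ((\<lambda>z. z * cis (- a - pi)) -` \<real>\<^sub>\<le>\<^sub>0)"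
    by (intro closed_vimage continuous_intros) auto
  ultimately show ?thesis by (metis open_Compl)
qed

lemma continuous_on_arc_coord: "continuous_on (slit a) (arc_coord a)"
  unfolding arc_coord_def slit_def by (intro continuous_intros) auto

lemma continuous_coord: "continuous_on S (\<lambda>x. x (i::nat) :: real)"
  by (intro continuous_on_product_coordinates[THEN continuous_on_subset] subset_UNIV)

lemma continuous_pt: "continuous_on S pt1" "continuous_on S pt2"
  unfolding pt1_def pt2_def by (intro continuous_intros continuous_coord)+

lemma continuous_on_vec2 [continuous_intros]:
  assumes "continuous_on S f" "continuous_on S g"
  shows "continuous_on S (\<lambda>x. vec2 (f x) (g x))"
proof (rule continuous_on_coordinatewise_then_product)
  fix i :: nat show "continuous_on S (\<lambda>x. vec2 (f x) (g x) i)"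
    using assms by (cases "i = 0"; cases "i = 1") (simp_all add: vec2_def)
qed

lemma continuous_on_emb [continuous_intros]:
  fixes f g :: "'a::t2_space \<Rightarrow> real"
  assumes "continuous_on S f" "continuous_on S g"
  shows "continuous_on S (\<lambda>x. emb (f x) (g x))"
proof (rule continuous_on_coordinatewise_then_product)
  fix i :: nat
  have "continuous_on S (\<lambda>x. cos (f x))" "continuous_on S (\<lambda>x. sin (f x))"
    "continuous_on S (\<lambda>x. cos (g x))" "continuous_on S (\<lambda>x. sin (g x))"
    by (auto intro!: continuous_on_cos continuous_on_sin assms)
  then show "continuous_on S (\<lambda>x. emb (f x) (g x) i)"
    by (cases "i = 0"; cases "i = 1"; cases "i = 2"; cases "i = 3") (simp_all add: emb_def)
qed

text \<open>A continuous image of a closed rectangle, whence compactness and connectedness.\<close>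

lemma torus_eq_image:
  fixes a b :: real
  shows "torus = (\<lambda>(x, y). emb x y) ` ({a..a+2*pi} \<times> {b..b+2*pi})"
proof -
  { fix x y
    obtain m :: int where m: "a \<le> x + 2*pi* of_int m" "x + 2*pi* of_int m < a + 2*pi"
      by (rule obtain_shift)
    obtain n :: int where n: "b \<le> y + 2*pi* of_int n" "y + 2*pi* of_int n < b + 2*pi"
      by (rule obtain_shift)
    have "emb x y = (\<lambda>(x, y). emb x y) (x + 2*pi* of_int m, y + 2*pi* of_int n)" by simp
    then have "emb x y \<in> (\<lambda>(x, y). emb x y) ` ({a..a+2*pi} \<times> {b..b+2*pi})"
      using m n by (intro image_eqI[of _ _ "(x + 2*pi* of_int m, y + 2*pi* of_int n)"]) auto }
  then show ?thesis by (auto simp: torus_def)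
qed

lemma compact_torus: "compact torus"
  unfolding torus_eq_image[of 0 0] case_prod_unfold
  by (intro compact_continuous_image continuous_intros compact_Times compact_Icc)

lemma connected_torus: "connected torus"
  unfolding torus_eq_image[of 0 0] case_prod_unfold
  by (intro connected_continuous_image continuous_intros connected_Times connected_Icc)

lemma chart_domain_eq: "{p \<in> torus. pt1 p \<in> slit a \<and> pt2 p \<in> slit b} = (\<lambda>v. emb (v 0) (v 1)) ` box2 a b"
proof safe
  fix p assume "p \<in> torus" "pt1 p \<in> slit a" "pt2 p \<in> slit b"
  then obtain x y where p: "p = emb x y" by (auto simp: torus_def)
  with \<open>pt1 p \<in> slit a\<close> \<open>pt2 p \<in> slit b\<close> obtain m n :: int where
    "a < x + 2*pi* of_int m" "x + 2*pi* of_int m < a + 2*pi"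
    "b < y + 2*pi* of_int n" "y + 2*pi* of_int n < b + 2*pi"
    by (auto simp: cis_slit_iff)
  then show "p \<in> (\<lambda>v. emb (v 0) (v 1)) ` box2 a b"
    by (intro image_eqI[of _ _ "vec2 (x + 2*pi* of_int m) (y + 2*pi* of_int n)"]) (auto simp: p box2_def)
qed (auto simp: box2_def arc_coord_cis)

lemma fst_torus_chart: "fst (torus_chart a b) = (\<lambda>v. emb (v 0) (v 1)) ` box2 a b"
  by (simp add: torus_chart_def chart_domain_eq)

lemma snd_torus_chart:
  assumes "v \<in> box2 a b" shows "snd (torus_chart a b) (emb (v 0) (v 1)) = v"
  using assms by (auto simp: torus_chart_def box2_def arc_coord_cis)

lemma chart_image_torus: "chart_image (torus_chart a b) = box2 a b"
  unfolding chart_image_def fst_torus_chart image_image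
  using snd_torus_chart by simp

lemma chart_inv_torus:
  assumes "v \<in> box2 a b" shows "chart_inv (torus_chart a b) v = emb (v 0) (v 1)"
proof -
  have "inj_on (snd (torus_chart a b)) (fst (torus_chart a b))"
    unfolding fst_torus_chart by (rule inj_onI) (metis (no_types, lifting) imageE snd_torus_chart)
  then show ?thesis unfolding chart_inv_def using assms
    by (metis (no_types, lifting) fst_torus_chart image_eqI inv_into_f_f snd_torus_chart)
qed

lemma openin_box2: "openin (Euclidean_space 2) (box2 a b)"
proof -
  have "box2 a b = {v. \<forall>i\<ge>2. v i = 0} \<inter> ((\<lambda>v. v 0) -` {a<..<a+2*pi} \<inter> (\<lambda>v. v 1) -` {b<..<b+2*pi})"
    by (auto simp: box2_def) (metis coords2_eq_vec2 One_nat_def)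
  moreover have "open ((\<lambda>v::nat\<Rightarrow>real. v 0) -` {a<..<a+2*pi} \<inter> (\<lambda>v. v 1) -` {b<..<b+2*pi})"
    by (intro open_Int open_vimage open_greaterThanLessThan continuous_coord)
  ultimately show ?thesis
    by (auto simp: Euclidean_space_def euclidean_product_topology openin_open)
qed

lemma openin_chart_domain: "openin (top_of_set torus) (fst (torus_chart a b))"
proof -
  have "fst (torus_chart a b) = torus \<inter> (pt1 -` slit a \<inter> pt2 -` slit b)"
    by (auto simp: torus_chart_def)
  moreover have "open (pt1 -` slit a \<inter> pt2 -` slit b)"
    by (intro open_Int open_vimage open_slit continuous_pt)
  ultimately show ?thesis by (auto simp: openin_open)
qed

lemma is_chart_torus: "is_chart (top_of_set torus) 2 (torus_chart a b)"
proof -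
  let ?c = "torus_chart a b" and ?E = "\<lambda>v::nat\<Rightarrow>real. emb (v 0) (v 1)"
  have sub: "fst ?c \<subseteq> torus" by (auto simp: torus_chart_def)
  have T1: "subtopology (top_of_set torus) (fst ?c) = top_of_set (fst ?c)"
    using sub by (simp add: subtopology_subtopology Int_absorb1)
  have "box2 a b \<subseteq> {x. \<forall>i\<ge>2. x i = 0}" by (auto simp: box2_def)
  then have T2: "subtopology (Euclidean_space 2) (box2 a b) = top_of_set (box2 a b)"
    by (simp add: Euclidean_space_def euclidean_product_topology subtopology_subtopology Int_absorb1)
  have "homeomorphic_maps (top_of_set (fst ?c)) (top_of_set (box2 a b)) (snd ?c) ?E"
    unfolding homeomorphic_maps_def
  proof (intro conjI ballI)
    have "continuous_on (fst ?c) (snd ?c)"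
      unfolding torus_chart_def fst_conv snd_conv
      by (intro continuous_intros continuous_on_compose2[OF continuous_on_arc_coord] continuous_pt) auto
    then show "continuous_map (top_of_set (fst ?c)) (top_of_set (box2 a b)) (snd ?c)"
      by (auto simp: continuous_map_in_subtopology continuous_map_iff_continuous fst_torus_chart snd_torus_chart[unfolded One_nat_def])
    show "continuous_map (top_of_set (box2 a b)) (top_of_set (fst ?c)) ?E"
      unfolding continuous_map_in_subtopology continuous_map_iff_continuous fst_torus_chart
      by (intro conjI continuous_intros continuous_coord) auto
  qed (auto simp: fst_torus_chart snd_torus_chart[unfolded One_nat_def])
  then have "homeomorphic_map (top_of_set (fst ?c)) (top_of_set (box2 a b)) (snd ?c)"
    unfolding homeomorphic_map_maps by blast
  then show ?thesis
    unfolding is_chart_def chart_image_torus T1 T2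
    by (intro conjI openin_chart_domain openin_box2)
qed

section \<open>The flat torus as a Riemannian manifold\<close>

text \<open>\<open>V\<close> is only relatively open in the function space, since the coordinates
  from n on vanish on it. Varying a coordinate of index below n respects that constraint, so nearby
  variations stay in \<open>V\<close>.\<close>

lemma eventually_update_in_open:
  assumes V: "openin (Euclidean_space n) V" and W: "open W" and x: "x \<in> W \<inter> V" and i: "i < n"
  shows "\<forall>\<^sub>F t in nhds (x i). x(i := t) \<in> W \<inter> V"
proof -
  obtain U where U: "open U" "V = {x. \<forall>i\<ge>n. x i = 0} \<inter> U"
    using V by (auto simp: Euclidean_space_def euclidean_product_topology openin_open)
  have "continuous_on UNIV (\<lambda>t. x(i := t))"
  proof (rule continuous_on_coordinatewise_then_product)
    fix j show "continuous_on UNIV (\<lambda>t. (x(i := t)) j)"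
      by (cases "i = j") auto
  qed
  then have "open ((\<lambda>t. x(i := t)) -` (W \<inter> U))"
    using W U by (intro open_vimage open_Int) auto
  moreover have "x i \<in> (\<lambda>t. x(i := t)) -` (W \<inter> U)"
    using x U by auto
  ultimately have "\<forall>\<^sub>F t in nhds (x i). t \<in> (\<lambda>t. x(i := t)) -` (W \<inter> U)"
    by (rule eventually_nhds_in_open)
  then show ?thesis
  proof eventually_elim
    case (elim t)
    have "x(i := t) \<in> {x. \<forall>i\<ge>n. x i = 0}" using x i U(2) by auto
    then show ?case using elim U(2) by auto
  qed
qed

text \<open>A derivative depends only on the germ of a function, so local agreement with a member of
  \<open>F\<close> survives every partial derivative, and closure of \<open>F\<close> under
  \<open>partial\<close> handles all orders at once. \<open>F\<close> will be the affine functions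
  for transition maps and the metric, and products of cosines for the modes.\<close>

lemma smooth_on_coords_local:
  assumes V: "openin (Euclidean_space n) V"
  assumes cont: "\<And>g. g \<in> F \<Longrightarrow> continuous_on UNIV g"
  assumes diff: "\<And>g i x. g \<in> F \<Longrightarrow> i < n \<Longrightarrow> (\<lambda>t. g (x(i := t))) differentiable at (x i)"
  assumes part: "\<And>g i. g \<in> F \<Longrightarrow> i < n \<Longrightarrow> partial i g \<in> F"
  assumes loc: "\<And>x. x \<in> V \<Longrightarrow> \<exists>g\<in>F. \<exists>W. open W \<and> x \<in> W \<and> (\<forall>y\<in>W \<inter> V. f y = g y)"
  shows "smooth_on_coords n V f"
proof -
  note ev = eventually_update_in_open[OF V]
  have loc': "\<exists>g\<in>F. \<exists>W. open W \<and> x \<in> W \<and> (\<forall>y\<in>W \<inter> V. foldr partial is f y = g y)"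
    if "x \<in> V" "is \<in> lists {..<n}" for x "is"
    using that(2)
  proof (induction "is")
    case Nil
    then show ?case using loc that by simp
  next
    case (Cons i js)
    then obtain g W where gW: "g \<in> F" "open W" "x \<in> W" "\<And>y. y \<in> W \<inter> V \<Longrightarrow> foldr partial js f y = g y"
      and i: "i < n"
      by auto
    have "partial i (foldr partial js f) y = partial i g y" if "y \<in> W \<inter> V" for y
      unfolding partial_def[of i "foldr partial js f"] partial_def[of i g]
      by (rule deriv_cong_ev[OF _ refl]) (rule eventually_mono[OF ev[OF gW(2) that i]], rule gW(4))
    then show ?case
      using part[OF gW(1) i] gW(2,3) by (intro bexI[of _ "partial i g"] exI[of _ W]) auto
  qed
  show ?thesis
    unfolding smooth_on_coords_def
  proof (intro ballI conjI allI impI)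
    fix "is" assume "is": "is \<in> lists {..<n}"
    show "continuous_on V (foldr partial is f)"
      unfolding continuous_on_eq_continuous_within
    proof
      fix x assume x: "x \<in> V"
      from loc'[OF x "is"] obtain g W where gW: "g \<in> F" "open W" "x \<in> W" "\<And>y. y \<in> W \<inter> V \<Longrightarrow> foldr partial is f y = g y"
        by blast
      have "continuous (at x within V) g"
        using cont[OF gW(1)] by (simp add: continuous_on_eq_continuous_at continuous_at_imp_continuous_within)
      moreover have "\<forall>\<^sub>F y in at x within V. g y = foldr partial is f y"
        unfolding eventually_at_topological using gW(2-4) by (intro exI[of _ W]) auto
      ultimately show "continuous (at x within V) (foldr partial is f)"
        unfolding continuous_within gW(4)[OF IntI[OF gW(3) x]] by (rule Lim_transform_eventually)
    qed
    fix i x assume i: "i < n" and x: "x \<in> V"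
    from loc'[OF x "is"] obtain g W where gW: "g \<in> F" "open W" "x \<in> W" "\<And>y. y \<in> W \<inter> V \<Longrightarrow> foldr partial is f y = g y"
      by blast
    obtain D where D: "((\<lambda>t. g (x(i := t))) has_real_derivative D) (at (x i))"
      using diff[OF gW(1) i] by (auto simp: real_differentiable_def)
    have "\<forall>\<^sub>F t in nhds (x i). foldr partial is f (x(i := t)) = g (x(i := t))"
      by (rule eventually_mono[OF ev[of W x i]]) (use gW x i in auto)
    then have "((\<lambda>t. foldr partial is f (x(i := t))) has_real_derivative D) (at (x i))"
      using D by (subst DERIV_cong_ev[OF refl _ refl])
    then show "(\<lambda>t. foldr partial is f (x(i := t))) differentiable at (x i)"
      by (auto simp: real_differentiable_def)
  qed
qed

definition affine_coords :: "((nat \<Rightarrow> real) \<Rightarrow> real) set" where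
  "affine_coords = {g. \<exists>a b c. g = (\<lambda>x. a * x 0 + b * x 1 + c)}"

lemma partial_affine_coords:
  "partial i (\<lambda>x. a * x 0 + b * x 1 + c) = (\<lambda>x. if i = 0 then a else if i = 1 then b else 0)"
proof
  fix x :: "nat \<Rightarrow> real"
  consider "i = 0" | "i = 1" | "i > 1" by linarith
  then have "((\<lambda>t. a * (x(i := t)) 0 + b * (x(i := t)) 1 + c) has_real_derivative
     (if i = 0 then a else if i = 1 then b else 0)) (at (x i))"
    by cases (auto intro!: derivative_eq_intros)
  then show "partial i (\<lambda>x. a * x 0 + b * x 1 + c) x = (if i = 0 then a else if i = 1 then b else 0)"
    unfolding partial_def by (rule DERIV_imp_deriv)
qed

lemma smooth_affine:
  assumes V: "openin (Euclidean_space 2) V"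
  assumes loc: "\<And>x. x \<in> V \<Longrightarrow> \<exists>g\<in>affine_coords. \<exists>W. open W \<and> x \<in> W \<and> (\<forall>y\<in>W \<inter> V. f y = g y)"
  shows "smooth_on_coords 2 V f"
proof (rule smooth_on_coords_local[OF V _ _ _ loc])
  fix g assume "g \<in> affine_coords"
  then obtain a b c where g: "g = (\<lambda>x. a * x 0 + b * x 1 + c)" by (auto simp: affine_coords_def)
  show "continuous_on UNIV g" unfolding g by (intro continuous_intros continuous_coord)
  fix i :: nat
  have "partial i g = (\<lambda>x. 0 * x 0 + 0 * x 1 + (if i = 0 then a else if i = 1 then b else 0))"
    unfolding g partial_affine_coords by simp
  then show "partial i g \<in> affine_coords" unfolding affine_coords_def by blast
  fix x :: "nat \<Rightarrow> real"
  show "(\<lambda>t. g (x(i := t))) differentiable at (x i)"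
    by (cases "i = 0"; cases "i = 1") (simp_all add: g)
qed

lemma overlap_eq:
  "snd (torus_chart a b) ` (fst (torus_chart a b) \<inter> fst (torus_chart a' b')) =
    {v \<in> box2 a b. cis (v 0) \<in> slit a' \<and> cis (v 1) \<in> slit b'}"
proof -
  have "snd (torus_chart a b) ` (fst (torus_chart a b) \<inter> D) = {v \<in> box2 a b. emb (v 0) (v 1) \<in> D}" for D
    unfolding fst_torus_chart using snd_torus_chart[of _ a b] by force
  then show ?thesis by (auto simp: torus_chart_def)
qed

text \<open>The integers m and n are constant only near x: the cuts of the second chart in general
  split the overlap into several rectangles, and the translation differs from one to
  another.\<close>

lemma transition_local:
  fixes a b a' b' :: real
  defines "V \<equiv> {v \<in> box2 a b. cis (v 0) \<in> slit a' \<and> cis (v 1) \<in> slit b'}"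
  assumes x: "x \<in> V"
  shows "\<exists>W c d. open W \<and> x \<in> W \<and>
    (\<forall>y\<in>W \<inter> V. transition (torus_chart a b) (torus_chart a' b') y = vec2 (y 0 + c) (y 1 + d))"
proof -
  from x obtain m n :: int where mn: "a' < x 0 + 2*pi* of_int m" "x 0 + 2*pi* of_int m < a' + 2*pi"
    "b' < x 1 + 2*pi* of_int n" "x 1 + 2*pi* of_int n < b' + 2*pi"
    by (auto simp: V_def cis_slit_iff)
  let ?W = "((\<lambda>v. v 0 + 2*pi* of_int m) -` {a'<..<a'+2*pi} \<inter> (\<lambda>v. v 1 + 2*pi* of_int n) -` {b'<..<b'+2*pi}) :: (nat \<Rightarrow> real) set"
  have "open ?W"
    by (intro open_Int open_vimage open_greaterThanLessThan continuous_intros continuous_coord)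
  moreover have "x \<in> ?W" using mn by simp
  moreover have "transition (torus_chart a b) (torus_chart a' b') y = vec2 (y 0 + 2*pi* of_int m) (y 1 + 2*pi* of_int n)"
    if "y \<in> ?W \<inter> V" for y
  proof -
    let ?z = "vec2 (y 0 + 2*pi* of_int m) (y 1 + 2*pi* of_int n)"
    have "chart_inv (torus_chart a b) y = emb (y 0) (y 1)"
      using that by (intro chart_inv_torus) (auto simp: V_def)
    moreover have "?z \<in> box2 a' b'" using that by (auto simp: box2_def)
    from snd_torus_chart[OF this] have "snd (torus_chart a' b') (emb (y 0) (y 1)) = ?z" by simp
    ultimately show ?thesis by (simp add: transition_def)
  qed
  ultimately show ?thesis by blast
qed

lemma openin_overlap:
  "openin (Euclidean_space 2) {v \<in> box2 a b. cis (v 0) \<in> slit a' \<and> cis (v 1) \<in> slit b'}"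
proof -
  have "{v \<in> box2 a b. cis (v 0) \<in> slit a' \<and> cis (v 1) \<in> slit b'} =
    box2 a b \<inter> ((\<lambda>v. cis (v 0)) -` slit a' \<inter> (\<lambda>v. cis (v 1)) -` slit b')" by auto
  moreover have "openin (Euclidean_space 2) (box2 a b \<inter> ((\<lambda>v. cis (v 0)) -` slit a' \<inter> (\<lambda>v. cis (v 1)) -` slit b'))"
    (is "openin _ (_ \<inter> ?W)")
  proof -
    have "open ?W"
      by (intro open_Int open_vimage open_slit continuous_intros continuous_coord)
    moreover obtain U where "open U" "box2 a b = {x. \<forall>i\<ge>2. x i = 0} \<inter> U"
      using openin_box2[of a b] by (auto simp: Euclidean_space_def euclidean_product_topology openin_open)
    ultimately have "open (U \<inter> ?W)" "box2 a b \<inter> ?W = {x. \<forall>i\<ge>2. x i = 0} \<inter> (U \<inter> ?W)"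
      by auto
    then show ?thesis
      unfolding Euclidean_space_def euclidean_product_topology openin_open by blast
  qed
  ultimately show ?thesis by simp
qed

lemma smooth_atlas_torus: "smooth_atlas (top_of_set torus) 2 torus_atlas"
  unfolding smooth_atlas_def
proof (intro conjI ballI allI impI)
  fix c assume "c \<in> torus_atlas"
  then obtain a b where c: "c = torus_chart a b" by auto
  then show "is_chart (top_of_set torus) 2 c" by (simp add: is_chart_torus)
  fix c' and k :: nat assume "c' \<in> torus_atlas" and k: "k < 2"
  then obtain a' b' where c': "c' = torus_chart a' b'" by auto
  show "smooth_on_coords 2 (snd c ` (fst c \<inter> fst c')) (\<lambda>x. transition c c' x k)"
    unfolding c c' overlap_eq
  proof (rule smooth_affine[OF openin_overlap])
    fix x assume "x \<in> {v \<in> box2 a b. cis (v 0) \<in> slit a' \<and> cis (v 1) \<in> slit b'}" (is "x \<in> ?V")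
    from transition_local[OF this] obtain W c d where W: "open W" "x \<in> W"
      "\<And>y. y \<in> W \<inter> ?V \<Longrightarrow> transition (torus_chart a b) (torus_chart a' b') y = vec2 (y 0 + c) (y 1 + d)"
      by blast
    show "\<exists>g\<in>affine_coords. \<exists>W. open W \<and> x \<in> W \<and> (\<forall>y\<in>W \<inter> ?V. transition (torus_chart a b) (torus_chart a' b') y k = g y)"
    proof (cases "k = 0")
      case True
      then show ?thesis using W
        by (intro bexI[of _ "\<lambda>x. 1 * x 0 + 0 * x 1 + c"] exI[of _ W]) (auto simp: affine_coords_def, metis mult_1 mult_zero_left add.right_neutral)
    next
      case False
      then have "k = 1" using k by simp
      then show ?thesis using W
        by (intro bexI[of _ "\<lambda>x. 0 * x 0 + 1 * x 1 + d"] exI[of _ W]) (auto simp: affine_coords_def, metis mult_1 mult_zero_left add_0)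
    qed
  qed
next
  have "\<exists>a b. p \<in> fst (torus_chart a b)" if "p \<in> torus" for p
  proof -
    obtain x y where "p = emb x y" using \<open>p \<in> torus\<close> by (auto simp: torus_def)
    then have "p \<in> fst (torus_chart (x - pi) (y - pi))"
      unfolding fst_torus_chart by (intro image_eqI[of _ _ "vec2 x y"]) (auto simp: box2_def)
    then show ?thesis by blast
  qed
  moreover have "fst (torus_chart a b) \<subseteq> torus" for a b by (auto simp: torus_chart_def)
  ultimately show "(\<Union>c\<in>torus_atlas. fst c) = topspace (top_of_set torus)"
    by fastforce
qed

text \<open>Transition maps are local translations, so their Jacobians are the identity and the
  constant identity matrix obeys the transformation law.\<close>

lemma smooth_metric_torus:
  "smooth_metric 2 torus_atlas (\<lambda>_ _. 1\<^sub>m 2)"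
  unfolding smooth_metric_def
proof (intro conjI ballI allI impI)
  fix c assume "c \<in> torus_atlas"
  then obtain a b where c: "c = torus_chart a b" by auto
  fix i j :: nat assume ij: "i < 2" "j < 2"
  show "smooth_on_coords 2 (chart_image c) (\<lambda>x. 1\<^sub>m 2 $$ (i, j))"
    unfolding c chart_image_torus
  proof (rule smooth_affine[OF openin_box2])
    have "(\<lambda>x. 0 * x 0 + 0 * x 1 + 1\<^sub>m 2 $$ (i, j)) \<in> affine_coords" unfolding affine_coords_def by blast
    then show "\<exists>g\<in>affine_coords. \<exists>W. open W \<and> x \<in> W \<and> (\<forall>y\<in>W \<inter> box2 a b. 1\<^sub>m 2 $$ (i, j) = g y)" for x
      by (intro bexI[of _ "(\<lambda>x. 0 * x 0 + 0 * x 1 + 1\<^sub>m 2 $$ (i, j))"] exI[of _ UNIV]) auto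
  qed
next
  fix v :: "nat \<Rightarrow> real" assume "\<exists>i<2. v i \<noteq> 0"
  then have "v 0 \<noteq> 0 \<or> v 1 \<noteq> 0" by (auto simp: less_2_cases_iff)
  then have "v 0 * v 0 + v 1 * v 1 > 0"
    using sum_squares_gt_zero_iff by blast
  moreover have "(\<Sum>i<2. \<Sum>j<2. 1\<^sub>m 2 $$ (i, j) * v i * v j) = v 0 * v 0 + v 1 * v 1"
    by (simp add: numeral_2_eq_2)
  ultimately show "(\<Sum>i<2. \<Sum>j<2. 1\<^sub>m 2 $$ (i, j) * v i * v j) > 0" by simp
next
  fix c c' assume "c \<in> torus_atlas" "c' \<in> torus_atlas"
  then obtain a b a' b' where c: "c = torus_chart a b" "c' = torus_chart a' b'" by auto
  fix x and i j :: nat assume x: "x \<in> snd c ` (fst c \<inter> fst c')" and ij: "i < 2" "j < 2"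
  have part: "partial i (\<lambda>y. transition c c' y k) x = (if i = k then 1 else 0)" if "i < 2" "k < 2" for i k
  proof -
    let ?V = "{v \<in> box2 a b. cis (v 0) \<in> slit a' \<and> cis (v 1) \<in> slit b'}"
    from x have xV: "x \<in> ?V" by (simp add: c overlap_eq)
    from transition_local[OF this] obtain W d e where W: "open W" "x \<in> W"
      "\<And>y. y \<in> W \<inter> ?V \<Longrightarrow> transition (torus_chart a b) (torus_chart a' b') y = vec2 (y 0 + d) (y 1 + e)"
      by blast
    have "\<forall>\<^sub>F t in nhds (x i). transition c c' (x(i := t)) k = vec2 ((x(i := t)) 0 + d) ((x(i := t)) 1 + e) k"
      by (rule eventually_mono[OF eventually_update_in_open[OF openin_overlap W(1)]]) (use W xV c that in auto)
    moreover have "((\<lambda>t. vec2 ((x(i := t)) 0 + d) ((x(i := t)) 1 + e) k) has_real_derivative (if i = k then 1 else 0)) (at (x i))"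
      using that by (auto simp: vec2_def less_2_cases_iff intro!: derivative_eq_intros)
    ultimately have "((\<lambda>t. transition c c' (x(i := t)) k) has_real_derivative (if i = k then 1 else 0)) (at (x i))"
      by (subst DERIV_cong_ev[OF refl _ refl]) auto
    then show ?thesis unfolding partial_def by (rule DERIV_imp_deriv)
  qed
  show "1\<^sub>m 2 $$ (i, j) = (\<Sum>k<2. \<Sum>l<2. partial i (\<lambda>y. transition c c' y k) x * partial j (\<lambda>y. transition c c' y l) x *
             1\<^sub>m 2 $$ (k, l))"
    using ij by (auto simp: part numeral_2_eq_2 less_Suc_eq)
qed auto

lemma compact_connected_torus: "compact_connected_riemannian_manifold flat_torus"
proof -
  have "second_countable (euclidean :: (nat \<Rightarrow> real) topology)"
  proof -
    obtain B :: "(nat \<Rightarrow> real) set set" where B: "countable B" "topological_basis B"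
      using ex_countable_basis by blast
    then show ?thesis
      unfolding second_countable_def
      by (intro exI[of _ B]) (auto simp: topological_basis_open elim: topological_basisE)
  qed
  then have "second_countable (top_of_set torus)"
    by (rule second_countable_subtopology)
  moreover have "Hausdorff_space (top_of_set torus)"
    by (intro Hausdorff_space_subtopology) auto
  moreover have "torus \<noteq> {}" using emb_in_torus by blast
  moreover have "compact_space (top_of_set torus)" "connected_space (top_of_set torus)"
    using compact_torus connected_torus by (simp_all add: compact_space_subtopology connected_space_subtopology)
  ultimately show ?thesis
    unfolding compact_connected_riemannian_manifold_def flat_torus_def riemannian.simps topspace_euclidean_subtopology
    by (intro conjI smooth_atlas_torus smooth_metric_torus)
qed

section \<open>Geodesic distance\<close>

text \<open>On the torus the argument is the cosine of an angle difference; clamping it makes the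
  function continuous everywhere.\<close>

definition arc_dist :: "real \<Rightarrow> real" where
  "arc_dist s = arccos (max (- 1) (min 1 s))"

lemma arc_dist_cos [simp]: "arc_dist (cos t) = arccos (cos t)"
  by (simp add: arc_dist_def)

lemma continuous_arc_dist: "continuous_on UNIV arc_dist"
  unfolding arc_dist_def[abs_def] by (intro continuous_intros) auto

text \<open>The two inner expressions are the cosines of the angle differences on the two circle
  factors. As polynomials in the ambient coordinates they make the distance visibly continuous, with
  no choice of angles.\<close>

definition torus_dist :: "(nat \<Rightarrow> real) \<Rightarrow> (nat \<Rightarrow> real) \<Rightarrow> real" where
  "torus_dist p q = cmod (Complex (arc_dist (p 0 * q 0 + p 1 * q 1)) (arc_dist (p 2 * q 2 + p 3 * q 3)))"

lemma cos_shift [simp]: "cos (x + 2*pi* of_int m) = cos x" and sin_shift [simp]: "sin (x + 2*pi* of_int m) = sin x"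
  using cis_shift[of x m] by (simp_all only: complex_eq_iff cis.simps)

lemma torus_dist_emb: "torus_dist (emb x y) (emb x' y') = cmod (Complex (arccos (cos (x' - x))) (arccos (cos (y' - y))))"
  unfolding arc_dist_cos[symmetric] by (simp add: torus_dist_def cos_diff mult.commute)

lemma arccos_cos_abs: "\<bar>t\<bar> \<le> pi \<Longrightarrow> arccos (cos t) = \<bar>t\<bar>"
  using arccos_cos[of t] arccos_cos2[of t] by (cases "t \<ge> 0") auto

lemma arccos_cos_le: "arccos (cos t) \<le> \<bar>t\<bar>"
  using arccos_cos_abs[of t] arccos_ubound[of "cos t"] by (cases "\<bar>t\<bar> \<le> pi") auto

lemma arccos_cos_nonneg: "0 \<le> arccos (cos t)"
  by (simp add: arccos_lbound)

lemma arccos_cos_attained: "\<exists>m::int. arccos (cos t) = \<bar>t + 2*pi* of_int m\<bar> \<and> \<bar>t + 2*pi* of_int m\<bar> \<le> pi"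
proof -
  obtain m :: int where m: "-pi \<le> t + 2*pi* of_int m" "t + 2*pi* of_int m < -pi + 2*pi"
    by (rule obtain_shift)
  then have "\<bar>t + 2*pi* of_int m\<bar> \<le> pi" by simp
  with arccos_cos_abs[OF this] show ?thesis by auto
qed

lemma flat_torus_simps [simp]:
  "top_of flat_torus = top_of_set torus" "dim_of flat_torus = 2"
  "atlas_of flat_torus = torus_atlas" "metric_of flat_torus = (\<lambda>_ _. 1\<^sub>m 2)"
  by (simp_all add: flat_torus_def)

lemma arc_length_flat:
  "arc_length 2 (\<lambda>_. 1\<^sub>m 2) \<eta> = integral {0..1} (\<lambda>t. cmod (Complex
     (vector_derivative (\<lambda>u. \<eta> u 0) (at t within {0..1})) (vector_derivative (\<lambda>u. \<eta> u 1) (at t within {0..1}))))"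
  by (simp add: arc_length_def lessThan_Suc numeral_2_eq_2 cmod_def power2_eq_square[unfolded numeral_2_eq_2] add.commute)

text \<open>With the velocity packed into a complex number, this is the inequality between the norm
  of an integral and the integral of the norm.\<close>

lemma arc_displacement:
  assumes "C1_arc 2 c \<eta>"
  shows "cmod (Complex (\<eta> 1 0 - \<eta> 0 0) (\<eta> 1 1 - \<eta> 0 1)) \<le> arc_length 2 (\<lambda>_. 1\<^sub>m 2) \<eta>"
proof -
  define d where "d i t = vector_derivative (\<lambda>u. \<eta> u i) (at t within {0..1})" for i :: nat and t :: real
  have d: "((\<lambda>u. \<eta> u i) has_vector_derivative d i t) (at t within {0..1})" if "i < 2" "t \<in> {0..1}" for i t
    using assms that unfolding C1_arc_def d_def differentiable_on_def
    by (metis vector_derivative_works)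
  have cd: "continuous_on {0..1} (d i)" if "i < 2" for i
    using assms that unfolding C1_arc_def d_def by blast
  have vd: "((\<lambda>u. Complex (\<eta> u 0) (\<eta> u 1)) has_vector_derivative Complex (d 0 t) (d 1 t)) (at t within {0..1})"
    if "t \<in> {0..1}" for t
    unfolding has_vector_derivative_complex_iff using d[of 0 t] d[of 1 t] that
    by (simp add: has_real_derivative_iff_has_vector_derivative)
  have "((\<lambda>t. Complex (d 0 t) (d 1 t)) has_integral Complex (\<eta> 1 0) (\<eta> 1 1) - Complex (\<eta> 0 0) (\<eta> 0 1)) {0..1}"
    by (rule fundamental_theorem_of_calculus) (use vd in auto)
  then have int: "(\<lambda>t. Complex (d 0 t) (d 1 t)) integrable_on {0..1}"
    and eq: "integral {0..1} (\<lambda>t. Complex (d 0 t) (d 1 t)) = Complex (\<eta> 1 0 - \<eta> 0 0) (\<eta> 1 1 - \<eta> 0 1)"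
    by (auto simp: integral_unique complex_diff)
  have "continuous_on {0..1} (\<lambda>t. cmod (Complex (d 0 t) (d 1 t)))"
    by (intro continuous_intros cd) auto
  then have "(\<lambda>t. cmod (Complex (d 0 t) (d 1 t))) integrable_on {0..1}"
    by (rule integrable_continuous_interval)
  then have "cmod (integral {0..1} (\<lambda>t. Complex (d 0 t) (d 1 t))) \<le> integral {0..1} (\<lambda>t. cmod (Complex (d 0 t) (d 1 t)))"
    by (intro integral_norm_bound_integral[OF int]) auto
  then show ?thesis
    unfolding arc_length_flat eq unfolding d_def .
qed

text \<open>Lifts the curve to the plane: each chart arc is translated by multiples of 2 pi so that
  it starts where the lift so far ends, and the displacements add up by the triangle inequality.
  This is the lower bound for the distance.\<close>

lemma joined_lift:
  assumes "joined flat_torus p q L"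
  shows "p = emb x y \<Longrightarrow> \<exists>x' y'. q = emb x' y' \<and> cmod (Complex (x' - x) (y' - y)) \<le> L"
  using assms
proof (induction rule: joined.induct)
  case const
  then show ?case by (intro exI[of _ x] exI[of _ y]) (auto simp: Complex_eq_0)
next
  case (arc c \<eta> L)
  from arc obtain x' y' where xy: "chart_inv c (\<eta> 0) = emb x' y'" "cmod (Complex (x' - x) (y' - y)) \<le> L"
    by blast
  from arc obtain a b where c: "c = torus_chart a b" by auto
  have C1: "C1_arc 2 c \<eta>" using arc by simp
  then have \<eta>: "\<eta> 0 \<in> box2 a b" "\<eta> 1 \<in> box2 a b"
    by (auto simp: C1_arc_def c chart_image_torus)
  have e0: "emb (\<eta> 0 0) (\<eta> 0 1) = emb x' y'" and e1: "chart_inv c (\<eta> 1) = emb (\<eta> 1 0) (\<eta> 1 1)"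
    using xy(1) \<eta> by (simp_all add: c chart_inv_torus)
  have "\<exists>m::int. s = t + 2*pi* of_int m" if "cis s = cis t" for s t
    using that sin_cos_eq_iff[of s t] by (auto simp: complex_eq_iff algebra_simps)
  then obtain m n :: int where mn: "x' = \<eta> 0 0 + 2*pi* of_int m" "y' = \<eta> 0 1 + 2*pi* of_int n"
    using e0 by (metis emb_eq_iff)
  let ?x = "\<eta> 1 0 + 2*pi* of_int m" and ?y = "\<eta> 1 1 + 2*pi* of_int n"
  have "cmod (Complex (?x - x) (?y - y)) = cmod (Complex (x' - x) (y' - y) + Complex (\<eta> 1 0 - \<eta> 0 0) (\<eta> 1 1 - \<eta> 0 1))"
    by (simp add: mn complex_add algebra_simps)
  also have "\<dots> \<le> cmod (Complex (x' - x) (y' - y)) + cmod (Complex (\<eta> 1 0 - \<eta> 0 0) (\<eta> 1 1 - \<eta> 0 1))"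
    by (rule norm_triangle_ineq)
  also have "\<dots> \<le> L + arc_length 2 (\<lambda>_. 1\<^sub>m 2) \<eta>"
    using xy(2) arc_displacement[OF C1] by simp
  finally show ?case
    by (intro exI[of _ ?x] exI[of _ ?y]) (simp add: e1)
qed

lemma joined_segment:
  assumes "\<bar>x' - x\<bar> < 2*pi" "\<bar>y' - y\<bar> < 2*pi"
  shows "joined flat_torus (emb x y) (emb x' y') (cmod (Complex (x' - x) (y' - y)))"
proof -
  let ?\<eta> = "\<lambda>t. vec2 (x + t * (x' - x)) (y + t * (y' - y))"
  \<comment> \<open>The chart is centred at the midpoint of the segment; each coordinate stays
    within half its displacement, hence less than pi, of the centre.\<close>
  let ?a = "(x + x') / 2 - pi" and ?b = "(y + y') / 2 - pi"
  let ?c = "torus_chart ?a ?b"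
  have mid: "(u + u') / 2 - pi < u + t * (u' - u) \<and> u + t * (u' - u) < (u + u') / 2 - pi + 2 * pi"
    if "\<bar>u' - u\<bar> < 2*pi" "0 \<le> t" "t \<le> 1" for u u' t :: real
  proof -
    have "\<bar>t - 1/2\<bar> \<le> 1/2" unfolding abs_le_iff using that by linarith
    then have "\<bar>(t - 1/2) * (u' - u)\<bar> \<le> 1/2 * \<bar>u' - u\<bar>"
      unfolding abs_mult by (rule mult_right_mono) auto
    then have "\<bar>(t - 1/2) * (u' - u)\<bar> < pi" by (rule le_less_trans) (use that(1) in simp)
    moreover have "u + t * (u' - u) = (u + u') / 2 + (t - 1/2) * (u' - u)"
      by (simp add: field_simps)
    ultimately show ?thesis unfolding abs_less_iff by linarith
  qed
  have box: "?\<eta> t \<in> box2 ?a ?b" if "t \<in> {0..1}" for t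
    unfolding box2_def using that mid[OF assms(1)] mid[OF assms(2)] by fastforce
  have vd: "vector_derivative (\<lambda>u. ?\<eta> u 0) (at t within {0..1}) = x' - x"
     "vector_derivative (\<lambda>u. ?\<eta> u 1) (at t within {0..1}) = y' - y" if "t \<in> {0..1}" for t
    using that by (auto simp: vec2_def
      intro!: vector_derivative_within_cbox[of 0 1, unfolded cbox_interval]
        has_real_derivative_iff_has_vector_derivative[THEN iffD1] derivative_eq_intros)
  have C1: "C1_arc 2 ?c ?\<eta>"
    unfolding C1_arc_def chart_image_torus
  proof (intro conjI ballI allI impI box)
    fix i :: nat assume "i < 2"
    then consider "i = 0" | "i = 1" by linarith
    then show "(\<lambda>t. ?\<eta> t i) differentiable_on {0..1}"
      by cases (auto intro!: derivative_intros)
    have "vector_derivative (\<lambda>u. ?\<eta> u i) (at t within {0..1}) = (if i = 0 then x' - x else y' - y)"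
      if "t \<in> {0..1}" for t
      using \<open>i < 2\<close> vd[OF that] less_2_cases_iff[of i] by (metis One_nat_def zero_neq_one)
    then show "continuous_on {0..1} (\<lambda>t. vector_derivative (\<lambda>u. ?\<eta> u i) (at t within {0..1}))"
      by (intro continuous_on_eq[OF continuous_on_const[of _ "if i = 0 then x' - x else y' - y"]]) simp
  qed auto
  have len: "arc_length 2 (\<lambda>_. 1\<^sub>m 2) ?\<eta> = cmod (Complex (x' - x) (y' - y))"
    unfolding arc_length_flat by (subst integral_cong[where g = "\<lambda>_. cmod (Complex (x' - x) (y' - y))"]) (simp_all only: vd integral_const_real, simp)
  have e: "chart_inv ?c (?\<eta> 0) = emb x y" "chart_inv ?c (?\<eta> 1) = emb x' y'"
    using box[of 0] box[of 1] by (simp_all add: chart_inv_torus)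
  have "joined flat_torus (emb x y) (chart_inv ?c (?\<eta> 0)) 0"
    unfolding e by (rule joined.const) simp
  then have "joined flat_torus (emb x y) (chart_inv ?c (?\<eta> 1)) (0 + arc_length (dim_of flat_torus) (metric_of flat_torus ?c) ?\<eta>)"
    by (rule joined.arc[where \<eta> = ?\<eta>]) (use C1 in auto)
  then show ?thesis unfolding e flat_torus_simps len by simp
qed

lemma cmod_Complex_mono:
  assumes "\<bar>a\<bar> \<le> \<bar>c\<bar>" "\<bar>b\<bar> \<le> \<bar>d\<bar>" shows "cmod (Complex a b) \<le> cmod (Complex c d)"
  using assms by (simp add: cmod_def add_mono abs_le_square_iff)

text \<open>The infimum is attained: the segment to the nearest lift of q has length
  \<open>torus_dist p q\<close>, and the lift of an arbitrary curve ends no nearer.\<close>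

lemma riem_dist_torus:
  assumes "p \<in> torus" "q \<in> torus"
  shows "riem_dist flat_torus p q = torus_dist p q"
proof -
  obtain x y where p: "p = emb x y" using assms by (auto simp: torus_def)
  obtain x1 y1 where q: "q = emb x1 y1" using assms by (auto simp: torus_def)
  obtain m :: int where m: "arccos (cos (x1 - x)) = \<bar>x1 - x + 2*pi* of_int m\<bar>" "\<bar>x1 - x + 2*pi* of_int m\<bar> \<le> pi"
    using arccos_cos_attained by blast
  obtain n :: int where n: "arccos (cos (y1 - y)) = \<bar>y1 - y + 2*pi* of_int n\<bar>" "\<bar>y1 - y + 2*pi* of_int n\<bar> \<le> pi"
    using arccos_cos_attained by blast
  let ?x = "x1 + 2*pi* of_int m" and ?y = "y1 + 2*pi* of_int n"
  have "joined flat_torus (emb x y) (emb ?x ?y) (cmod (Complex (?x - x) (?y - y)))"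
  proof (rule joined_segment)
    show "\<bar>?x - x\<bar> < 2*pi" "\<bar>?y - y\<bar> < 2*pi"
      using m(2) n(2) pi_gt_zero by (simp_all add: algebra_simps del: pi_gt_zero)
  qed
  moreover have "cmod (Complex (?x - x) (?y - y)) = torus_dist p q"
    unfolding p q torus_dist_emb m n by (simp add: cmod_def algebra_simps)
  ultimately have "joined flat_torus p q (torus_dist p q)"
    by (simp add: p q)
  moreover have "torus_dist p q \<le> L" if "joined flat_torus p q L" for L
  proof -
    from joined_lift[OF that p] obtain x' y' where xy: "q = emb x' y'" "cmod (Complex (x' - x) (y' - y)) \<le> L"
      by blast
    have "torus_dist p q \<le> cmod (Complex (x' - x) (y' - y))"
      unfolding p xy(1) torus_dist_emb
      by (rule cmod_Complex_mono) (simp_all add: arccos_cos_le arccos_cos_nonneg)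
    with xy(2) show ?thesis by simp
  qed
  ultimately show ?thesis unfolding riem_dist_def by (intro cInf_eq_minimum) auto
qed

lemma continuous_on_torus_dist:
  assumes "continuous_on S f" "continuous_on S g"
  shows "continuous_on S (\<lambda>x. torus_dist (f x) (g x))"
proof -
  have c: "continuous_on S (\<lambda>x. f x i)" "continuous_on S (\<lambda>x. g x i)" for i
    using continuous_on_compose2[OF continuous_coord[of UNIV i] assms(1)]
      continuous_on_compose2[OF continuous_coord[of UNIV i] assms(2)] by auto
  show ?thesis unfolding torus_dist_def
    by (intro continuous_intros continuous_on_compose2[OF continuous_arc_dist] c subset_UNIV)
qed

section \<open>Riemannian volume\<close>

text \<open>Half-open, so that each angle is represented exactly once.\<close>

definition period :: "real measure" where
  "period = restrict_space lborel {0..<2*pi}"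

definition borel_torus :: "(nat \<Rightarrow> real) measure" where
  "borel_torus = restrict_space borel torus"

definition torus_volume :: "(nat \<Rightarrow> real) measure" where
  "torus_volume = distr (period \<Otimes>\<^sub>M period) borel_torus (\<lambda>(x, y). emb x y)"

lemma space_period: "space period = {0..<2*pi}"
  by (simp add: period_def space_restrict_space)

lemma measurable_period: "f \<in> borel_measurable borel \<Longrightarrow> f \<in> borel_measurable period"
  unfolding period_def by (intro measurable_restrict_space1) simp

lemma measurable_period_id: "(\<lambda>x. x) \<in> period \<rightarrow>\<^sub>M borel"
  by (rule measurable_period) simp

lemma emeasure_period: "emeasure period {0..<2*pi} = ennreal (2*pi)"
  unfolding period_def by (subst emeasure_restrict_space) auto

lemma finite_measure_period: "finite_measure period"
  by (rule finite_measureI) (simp add: space_period emeasure_period)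

interpretation period: finite_measure period
  by (rule finite_measure_period)

interpretation period2: pair_sigma_finite period period ..

lemma finite_measure_period2: "finite_measure (period \<Otimes>\<^sub>M period)"
  by (rule finite_measure_pair_measure[OF finite_measure_period finite_measure_period])

interpretation period2: finite_measure "period \<Otimes>\<^sub>M period"
  by (rule finite_measure_period2)

lemma nn_integral_period: "(\<integral>\<^sup>+x. f x \<partial>period) = (\<integral>\<^sup>+x. f x * indicator {0..<2*pi} x \<partial>lborel)"
  unfolding period_def by (rule nn_integral_restrict_space) simp

lemma closed_torus: "closed torus"
  by (simp add: compact_torus compact_imp_closed)

lemma torus_borel [measurable]: "torus \<in> sets borel"
  by (rule borel_closed[OF closed_torus])

lemma space_borel_torus [simp]: "space borel_torus = torus"
  by (simp add: borel_torus_def space_restrict_space)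

lemma sets_borel_torus_iff: "A \<in> sets borel_torus \<longleftrightarrow> A \<subseteq> torus \<and> A \<in> sets borel"
  unfolding borel_torus_def by (subst sets_restrict_space_iff) auto

lemma sets_borel_torus: "sets borel_torus = borel_sets flat_torus"
proof -
  have "(\<inter>) torus ` sigma_sets UNIV {S. open S} = sigma_sets torus ((\<inter>) torus ` {S. open S})"
    by (rule sigma_sets_Int) (use torus_borel in \<open>auto simp: borel_def\<close>)
  moreover have "(\<inter>) torus ` {S. open S} = {U. openin (top_of_set torus) U}"
    by (auto simp: openin_open)
  ultimately show ?thesis
    by (simp add: borel_torus_def sets_restrict_space borel_def)
qed

lemma measurable_emb_pair [measurable]: "(\<lambda>p. emb (fst p) (snd p)) \<in> borel_measurable (borel \<Otimes>\<^sub>M borel)"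
  unfolding borel_prod by (intro borel_measurable_continuous_onI continuous_intros)

lemma measurable_emb [measurable (raw)]:
  assumes "f \<in> borel_measurable M" "g \<in> borel_measurable M"
  shows "(\<lambda>x. emb (f x) (g x)) \<in> borel_measurable M"
proof -
  have "(\<lambda>x. (f x, g x)) \<in> M \<rightarrow>\<^sub>M borel \<Otimes>\<^sub>M borel" by (rule measurable_Pair[OF assms])
  from measurable_compose[OF this measurable_emb_pair] show ?thesis by (simp only: fst_conv snd_conv)
qed

lemma measurable_emb_torus [measurable (raw)]:
  assumes "f \<in> borel_measurable M" "g \<in> borel_measurable M"
  shows "(\<lambda>x. emb (f x) (g x)) \<in> M \<rightarrow>\<^sub>M borel_torus"
  unfolding borel_torus_def by (rule measurable_restrict_space2[OF _ measurable_emb[OF assms]]) simp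

lemma measurable_fst_period: "fst \<in> period \<Otimes>\<^sub>M period \<rightarrow>\<^sub>M borel" "snd \<in> period \<Otimes>\<^sub>M period \<rightarrow>\<^sub>M borel"
  using measurable_compose[OF measurable_fst measurable_period_id]
    measurable_compose[OF measurable_snd measurable_period_id] by auto

lemma measurable_emb_period [measurable]: "(\<lambda>(x, y). emb x y) \<in> period \<Otimes>\<^sub>M period \<rightarrow>\<^sub>M borel_torus"
  unfolding case_prod_unfold by (intro measurable_emb_torus measurable_fst_period)

text \<open>The window is moved by a multiple of 2 pi to start in [0, 2 pi); the part beyond 2 pi
  goes back by one period and fills the gap at 0. This converts integrals over chart boxes, or over
  a window around a point, into integrals over \<open>period\<close>.\<close>

lemma nn_integral_period_shift:
  fixes g :: "real \<Rightarrow> ennreal"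
  assumes [measurable]: "g \<in> borel_measurable borel" and per: "\<And>x m::int. g (x + 2*pi* of_int m) = g x"
  shows "(\<integral>\<^sup>+x. g x * indicator {a..<a+2*pi} x \<partial>lborel) = (\<integral>\<^sup>+x. g x \<partial>period)"
proof -
  define I where "I u v = (\<integral>\<^sup>+x. g x * indicator {u..<v} x \<partial>lborel)" for u v
  have sh: "I (u + 2*pi* of_int m) (v + 2*pi* of_int m) = I u v" for u v and m :: int
  proof -
    have "I (u + 2*pi* of_int m) (v + 2*pi* of_int m) =
      (\<integral>\<^sup>+x. g (2*pi* of_int m + 1 * x) * indicator {u + 2*pi* of_int m..<v + 2*pi* of_int m} (2*pi* of_int m + 1 * x) \<partial>lborel)"
      unfolding I_def by (subst nn_integral_real_affine[of _ 1 "2*pi* of_int m"]) auto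
    also have "\<dots> = I u v"
      unfolding I_def
    proof (intro nn_integral_cong)
      fix x
      have "g (2*pi* of_int m + 1 * x) = g x" using per[of x m] by (metis add.commute mult_1)
      then show "g (2*pi* of_int m + 1 * x) * indicator {u + 2*pi* of_int m..<v + 2*pi* of_int m} (2*pi* of_int m + 1 * x)
        = g x * indicator {u..<v} x"
        by (simp add: indicator_def)
    qed
    finally show ?thesis .
  qed
  have add: "I u w = I u v + I v w" if "u \<le> v" "v \<le> w" for u v w
  proof -
    have "g x * indicator {u..<w} x = g x * indicator {u..<v} x + g x * indicator {v..<w} x" for x
      using that by (cases "x < v") (simp_all add: indicator_def)
    then show ?thesis unfolding I_def by (simp add: nn_integral_add)
  qed
  obtain m :: int where m: "0 \<le> a + 2*pi* of_int m" "a + 2*pi* of_int m < 0 + 2*pi"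
    by (rule obtain_shift)
  let ?b = "a + 2*pi* of_int m"
  have "I a (a + 2*pi) = I ?b (?b + 2*pi)"
    using sh[of a m "a + 2*pi"] by (simp add: algebra_simps)
  also have "\<dots> = I ?b (2*pi) + I (2*pi) (?b + 2*pi)"
    by (rule add) (use m in auto)
  also have "I (2*pi) (?b + 2*pi) = I 0 ?b"
    using sh[of 0 1 ?b] by simp
  also have "I ?b (2*pi) + I 0 ?b = I 0 (2*pi)"
    using add[of 0 ?b "2*pi"] m by (simp add: add.commute)
  finally show ?thesis by (simp add: I_def nn_integral_period)
qed

lemma emeasure_torus_volume:
  assumes "B \<in> sets borel_torus"
  shows "emeasure torus_volume B = (\<integral>\<^sup>+x. \<integral>\<^sup>+y. indicator B (emb x y) \<partial>period \<partial>period)"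
proof -
  have "emeasure torus_volume B = (\<integral>\<^sup>+p. indicator B p \<partial>torus_volume)"
    using assms by (simp add: torus_volume_def)
  also have "\<dots> = (\<integral>\<^sup>+z. indicator B (case z of (x, y) \<Rightarrow> emb x y) \<partial>(period \<Otimes>\<^sub>M period))"
    unfolding torus_volume_def by (rule nn_integral_distr) (use assms in auto)
  also have "\<dots> = (\<integral>\<^sup>+x. \<integral>\<^sup>+y. indicator B (emb x y) \<partial>period \<partial>period)"
  proof -
    have "(\<lambda>z. indicator B (case z of (x, y) \<Rightarrow> emb x y) :: ennreal) \<in> borel_measurable (period \<Otimes>\<^sub>M period)"
      by (rule measurable_compose[OF measurable_emb_period]) (use assms in simp)
    from period.nn_integral_fst[OF this] show ?thesis by simp
  qed
  finally show ?thesis .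
qed

lemma measurable_vec2_pair [measurable]: "(\<lambda>p. vec2 (fst p) (snd p)) \<in> borel_measurable (borel \<Otimes>\<^sub>M borel)"
  unfolding borel_prod by (intro borel_measurable_continuous_onI continuous_intros)

lemma nn_integral_lebesgue_coords2:
  assumes [measurable]: "g \<in> borel_measurable borel"
  shows "(\<integral>\<^sup>+v. g v \<partial>lebesgue_coords 2) = (\<integral>\<^sup>+x. \<integral>\<^sup>+y. g (vec2 x y) \<partial>lborel \<partial>lborel)"
proof -
  interpret product_sigma_finite "\<lambda>_::nat. lborel :: real measure"
    by standard
  let ?pad = "\<lambda>x i. if i < (2::nat) then x i else (0::real)"
  have set: "{..<2::nat} = insert 1 {0}" by auto
  have pad [measurable]: "?pad \<in> borel_measurable (Pi\<^sub>M {..<2} (\<lambda>_. lborel))"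
  proof (rule measurable_coordinatewise_then_product)
    fix i show "(\<lambda>x. ?pad x i) \<in> borel_measurable (Pi\<^sub>M {..<2} (\<lambda>_. lborel))"
      by (cases "i < 2") (auto intro: measurable_component_singleton[of i "{..<2}" "\<lambda>_. lborel", simplified])
  qed
  have "(\<integral>\<^sup>+v. g v \<partial>lebesgue_coords 2) = (\<integral>\<^sup>+x. g (?pad x) \<partial>Pi\<^sub>M {..<2} (\<lambda>_. lborel))"
    unfolding lebesgue_coords_def by (rule nn_integral_distr) (use pad in auto)
  also have "\<dots> = (\<integral>\<^sup>+x. \<integral>\<^sup>+y. g (?pad (x(1 := y))) \<partial>lborel \<partial>Pi\<^sub>M {0::nat} (\<lambda>_. lborel))"
    using pad unfolding set by (intro product_nn_integral_insert) auto
  also have "\<dots> = (\<integral>\<^sup>+x. \<integral>\<^sup>+y. g (vec2 (x 0) y) \<partial>lborel \<partial>Pi\<^sub>M {0::nat} (\<lambda>_. lborel))"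
    by (intro nn_integral_cong arg_cong[of _ _ g]) (auto simp: vec2_def fun_eq_iff)
  also have "\<dots> = (\<integral>\<^sup>+x. \<integral>\<^sup>+y. g (vec2 x y) \<partial>lborel \<partial>lborel)"
  proof -
    have "(\<lambda>p. g (vec2 (fst p) (snd p))) \<in> borel_measurable (lborel \<Otimes>\<^sub>M lborel)"
      using measurable_compose[OF measurable_vec2_pair assms] by (simp cong: measurable_cong_sets)
    then have "(\<lambda>x. \<integral>\<^sup>+y. g (vec2 x y) \<partial>lborel) \<in> borel_measurable lborel"
      by (intro lborel.borel_measurable_nn_integral) (simp add: case_prod_unfold)
    then show ?thesis
      by (intro product_nn_integral_singleton)
  qed
  finally show ?thesis .
qed

lemma is_riem_volume_torus: "is_riem_volume flat_torus torus_volume"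
  unfolding is_riem_volume_def
proof (intro conjI ballI impI)
  show "space torus_volume = points flat_torus" "sets torus_volume = borel_sets flat_torus"
    by (simp_all add: torus_volume_def sets_borel_torus)
  fix c B assume "c \<in> atlas_of flat_torus" and "B \<in> borel_sets flat_torus" and Bc: "B \<subseteq> fst c"
  then obtain a b where c: "c = torus_chart a b" and B: "B \<in> sets borel_torus"
    by (auto simp: sets_borel_torus)
  have B' [measurable]: "B \<in> sets borel" and BT: "B \<subseteq> torus" using B by (auto simp: sets_borel_torus_iff)
  have img: "snd c ` B = {v \<in> box2 a b. emb (v 0) (v 1) \<in> B}"
    using Bc unfolding c fst_torus_chart using snd_torus_chart[of _ a b] by force
  have box: "box2 a b \<in> sets borel"
  proof -
    obtain U where U: "open U" "box2 a b = topspace (Euclidean_space 2) \<inter> U"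
      using openin_box2[of a b] by (auto simp: Euclidean_space_def euclidean_product_topology openin_open)
    have "closed (topspace (Euclidean_space 2))"
      using closedin_Euclidean_imp_closed closedin_topspace by blast
    then show ?thesis unfolding U(2) using U(1) by auto
  qed
  have cE: "continuous_on UNIV (\<lambda>v::nat \<Rightarrow> real. emb (v 0) (v 1))"
    by (rule continuous_on_emb; rule continuous_coord)
  have [measurable]: "snd c ` B \<in> sets borel"
  proof -
    have "snd c ` B = box2 a b \<inter> (\<lambda>v. emb (v 0) (v 1)) -` B" by (auto simp: img)
    moreover have "(\<lambda>v::nat \<Rightarrow> real. emb (v 0) (v 1)) -` B \<in> sets borel"
      using measurable_sets[OF borel_measurable_continuous_onI[OF cE] B'] by simp
    ultimately show ?thesis using box by auto
  qed
  \<comment> \<open>The chart box is open while the integration windows are half-open. They select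
    the same points because a base angle lies on the cut and \<open>B\<close> is inside the chart
    domain.\<close>
  have ind: "indicator (snd c ` B) (vec2 x y) = (indicator B (emb x y) * indicator {b..<b+2*pi} y * indicator {a..<a+2*pi} x :: ennreal)" for x y
  proof -
    have "vec2 x y \<in> snd c ` B \<longleftrightarrow> emb x y \<in> B \<and> y \<in> {b..<b+2*pi} \<and> x \<in> {a..<a+2*pi}"
    proof
      assume R: "emb x y \<in> B \<and> y \<in> {b..<b+2*pi} \<and> x \<in> {a..<a+2*pi}"
      then have "emb x y \<in> fst c" using Bc by auto
      then have "cis x \<in> slit a" "cis y \<in> slit b" by (auto simp: c torus_chart_def)
      then have "x \<noteq> a" "y \<noteq> b" using cis_notin_slit by auto
      with R show "vec2 x y \<in> snd c ` B" by (auto simp: img box2_def)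
    qed (auto simp: img box2_def)
    then show ?thesis by (auto simp: indicator_def)
  qed
  have [measurable]: "(\<lambda>x. indicator B (emb (f x) (g x))) \<in> borel_measurable M"
    if [measurable]: "f \<in> borel_measurable M" "g \<in> borel_measurable M" for f g and M :: "'z measure"
    using measurable_compose[OF measurable_emb[OF that], of "indicator B" borel] by auto
  have "(\<integral>\<^sup>+ v. ennreal (sqrt (Determinant.det (metric_of flat_torus c v))) * indicator (snd c ` B) v \<partial>lebesgue_coords (dim_of flat_torus))
     = (\<integral>\<^sup>+ v. indicator (snd c ` B) v \<partial>lebesgue_coords 2)"
    by simp
  also have "\<dots> = (\<integral>\<^sup>+x. \<integral>\<^sup>+y. indicator B (emb x y) * indicator {b..<b+2*pi} y * indicator {a..<a+2*pi} x \<partial>lborel \<partial>lborel)"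
    unfolding ind[symmetric] by (rule nn_integral_lebesgue_coords2) simp
  also have "\<dots> = (\<integral>\<^sup>+x. (\<integral>\<^sup>+y. indicator B (emb x y) * indicator {b..<b+2*pi} y \<partial>lborel) * indicator {a..<a+2*pi} x \<partial>lborel)"
    by (intro nn_integral_cong nn_integral_multc) simp
  also have "\<dots> = (\<integral>\<^sup>+x. (\<integral>\<^sup>+y. indicator B (emb x y) \<partial>period) * indicator {a..<a+2*pi} x \<partial>lborel)"
    by (subst nn_integral_period_shift) auto
  also have "\<dots> = (\<integral>\<^sup>+x. (\<integral>\<^sup>+y. indicator B (emb x y) \<partial>period) \<partial>period)"
  proof (rule nn_integral_period_shift)
    have "(\<lambda>p. indicator B (emb (fst p) (snd p)) :: ennreal) \<in> borel_measurable (borel \<Otimes>\<^sub>M period)"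
      using measurable_compose[OF measurable_snd measurable_period_id] by measurable
    then show "(\<lambda>x. \<integral>\<^sup>+y. indicator B (emb x y) \<partial>period) \<in> borel_measurable borel"
      by (intro period.borel_measurable_nn_integral) (simp add: case_prod_unfold)
  qed simp
  finally show "emeasure torus_volume B = (\<integral>\<^sup>+ v. ennreal (sqrt (Determinant.det (metric_of flat_torus c v))) * indicator (snd c ` B) v \<partial>lebesgue_coords (dim_of flat_torus))"
    using emeasure_torus_volume[OF B] by simp
qed

text \<open>The definite description requires uniqueness. Two candidates agree on Borel subsets of a
  single chart, and cutting a Borel set along finitely many charts extends the agreement to the
  whole torus.\<close>

lemma riem_volume_torus: "riem_volume flat_torus = torus_volume"
  unfolding riem_volume_def
proof (rule the_equality)
  show "is_riem_volume flat_torus torus_volume" by (rule is_riem_volume_torus)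
  fix \<nu> assume \<nu>: "is_riem_volume flat_torus \<nu>"
  have s\<nu>: "sets \<nu> = sets borel_torus" and sv: "sets torus_volume = sets borel_torus"
    using \<nu> is_riem_volume_torus by (auto simp: is_riem_volume_def sets_borel_torus)
  define agree where "agree D \<longleftrightarrow> D \<in> sets borel_torus \<and>
     (\<forall>B\<in>sets borel_torus. B \<subseteq> D \<longrightarrow> emeasure \<nu> B = emeasure torus_volume B)" for D
  have chart: "agree (fst (torus_chart a b))" for a b
    unfolding agree_def
  proof (intro conjI ballI impI)
    show "fst (torus_chart a b) \<in> sets borel_torus"
      unfolding sets_borel_torus using openin_chart_domain by (intro sigma_sets.Basic) simp
    fix B assume "B \<in> sets borel_torus" "B \<subseteq> fst (torus_chart a b)"
    then have "emeasure M B = (\<integral>\<^sup>+ x. ennreal (sqrt (Determinant.det (metric_of flat_torus (torus_chart a b) x))) *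
        indicator (snd (torus_chart a b) ` B) x \<partial>lebesgue_coords (dim_of flat_torus))"
      if "is_riem_volume flat_torus M" for M
      using that unfolding is_riem_volume_def sets_borel_torus flat_torus_simps by blast
    from this[OF \<nu>] this[OF is_riem_volume_torus] show "emeasure \<nu> B = emeasure torus_volume B"
      by (rule trans[OF _ sym])
  qed
  have union: "agree (D \<union> D')" if "agree D" "agree D'" for D D'
    unfolding agree_def
  proof (intro conjI ballI impI)
    show "D \<union> D' \<in> sets borel_torus" using that by (auto simp: agree_def)
    fix B assume B: "B \<in> sets borel_torus" "B \<subseteq> D \<union> D'"
    have *: "B \<inter> D \<in> sets borel_torus" "B - D \<in> sets borel_torus" "B - D \<subseteq> D'"
      using B that by (auto simp: agree_def)
    have "emeasure M B = emeasure M (B \<inter> D) + emeasure M (B - D)" if "sets M = sets borel_torus" for M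
      using * that by (subst plus_emeasure) (auto intro: arg_cong[of _ _ "emeasure M"])
    then show "emeasure \<nu> B = emeasure torus_volume B"
      using * that s\<nu> sv by (auto simp: agree_def)
  qed
  \<comment> \<open>An angle on the cut at 0 is off the cut at pi, so the four charts with base
    angles 0 and pi cover the torus.\<close>
  have half: "\<exists>a\<in>{0, pi}. cis x \<in> slit a" for x
  proof (rule ccontr)
    assume *: "\<not> ?thesis"
    obtain m :: int where m: "0 \<le> x + 2*pi* of_int m" "x + 2*pi* of_int m < 0 + 2*pi" by (rule obtain_shift)
    have "x + 2*pi* of_int m = 0" using * m unfolding cis_slit_iff by force
    then have "pi < x + 2*pi* of_int (m + 1) \<and> x + 2*pi* of_int (m + 1) < pi + 2*pi"
      by (simp add: algebra_simps)
    with * show False unfolding cis_slit_iff by blast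
  qed
  have "torus \<subseteq> (fst (torus_chart 0 0) \<union> fst (torus_chart 0 pi)) \<union> (fst (torus_chart pi 0) \<union> fst (torus_chart pi pi))"
  proof
    fix p assume "p \<in> torus"
    then obtain x y where p: "p = emb x y" by (auto simp: torus_def)
    show "p \<in> (fst (torus_chart 0 0) \<union> fst (torus_chart 0 pi)) \<union> (fst (torus_chart pi 0) \<union> fst (torus_chart pi pi))"
      using half[of x] half[of y] unfolding p torus_chart_def by auto
  qed
  then show "\<nu> = torus_volume"
    using union[OF union[OF chart[of 0 0] chart[of 0 pi]] union[OF chart[of pi 0] chart[of pi pi]]]
    by (intro measure_eqI) (auto simp: s\<nu> sv agree_def sets_borel_torus_iff)
qed

section \<open>Orthonormal systems\<close>

definition sq_integrable :: "'a measure \<Rightarrow> ('a \<Rightarrow> real) \<Rightarrow> bool" where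
  "sq_integrable M f \<longleftrightarrow> f \<in> borel_measurable M \<and> integrable M (\<lambda>x. (f x)\<^sup>2)"

lemma sq_integrable_mult:
  assumes "sq_integrable M f" "sq_integrable M g"
  shows "integrable M (\<lambda>x. f x * g x)"
proof (rule Bochner_Integration.integrable_bound)
  show "integrable M (\<lambda>x. (f x)\<^sup>2 + (g x)\<^sup>2)" using assms by (auto simp: sq_integrable_def)
  show "(\<lambda>x. f x * g x) \<in> borel_measurable M" using assms by (auto simp: sq_integrable_def)
  have "\<bar>a * b\<bar> \<le> a\<^sup>2 + b\<^sup>2" for a b :: real
    using sum_squares_bound[of "\<bar>a\<bar>" "\<bar>b\<bar>"] mult_nonneg_nonneg[OF abs_ge_zero[of a] abs_ge_zero[of b]]
    unfolding abs_mult power2_abs by linarith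
  then show "AE x in M. norm (f x * g x) \<le> norm ((f x)\<^sup>2 + (g x)\<^sup>2)"
    by simp
qed

lemma sq_integrable_add:
  assumes "sq_integrable M f" "sq_integrable M g"
  shows "sq_integrable M (\<lambda>x. f x + g x)"
  using assms sq_integrable_mult[OF assms]
  by (auto simp: sq_integrable_def power2_sum mult.assoc)

lemma sq_integrable_cmult:
  assumes "sq_integrable M f" shows "sq_integrable M (\<lambda>x. c * f x)"
  using assms by (auto simp: sq_integrable_def power_mult_distrib)

lemma sq_integrable_diff:
  assumes "sq_integrable M f" "sq_integrable M g"
  shows "sq_integrable M (\<lambda>x. f x - g x)"
  using sq_integrable_add[OF assms(1) sq_integrable_cmult[OF assms(2), of "-1"]] by simp

lemma sq_integrable_sum:
  "(\<And>i. i \<in> I \<Longrightarrow> sq_integrable M (f i)) \<Longrightarrow> sq_integrable M (\<lambda>x. \<Sum>i\<in>I. f i x)"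
proof (induction I rule: infinite_finite_induct)
  case (insert i I) then show ?case using sq_integrable_add[of M "f i" "\<lambda>x. \<Sum>i\<in>I. f i x"] by simp
qed (auto simp: sq_integrable_def)

lemma (in finite_measure) sq_integrable_bounded:
  assumes "f \<in> borel_measurable M" "\<And>x. x \<in> space M \<Longrightarrow> \<bar>f x\<bar> \<le> B"
  shows "sq_integrable M f"
  unfolding sq_integrable_def
proof
  show "integrable M (\<lambda>x. (f x)\<^sup>2)"
  proof (rule integrable_const_bound[where B = "B\<^sup>2"])
    show "AE x in M. norm ((f x)\<^sup>2) \<le> B\<^sup>2"
      using assms(2) by (intro AE_I2) (simp add: power2_le_iff_abs_le abs_le_square_iff, metis abs_ge_zero abs_le_square_iff abs_of_nonneg order_trans)
  qed (use assms in measurable)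
qed fact

text \<open>Serves three systems: the modes on the torus, the modes on the circle, and an arbitrary
  eigenbasis given by hypothesis.\<close>

locale orthonormal =
  fixes M :: "'a measure" and \<phi> :: "'i \<Rightarrow> 'a \<Rightarrow> real" and J :: "'i set"
  assumes sq: "i \<in> J \<Longrightarrow> sq_integrable M (\<phi> i)"
    and ortho: "i \<in> J \<Longrightarrow> j \<in> J \<Longrightarrow> (\<integral>x. \<phi> i x * \<phi> j x \<partial>M) = (if i = j then 1 else 0)"
begin

abbreviation fcoeff :: "('a \<Rightarrow> real) \<Rightarrow> 'i \<Rightarrow> real" where
  "fcoeff f i \<equiv> (\<integral>x. f x * \<phi> i x \<partial>M)"

lemma integral_mult_sum:
  assumes "finite I" "I \<subseteq> J" "sq_integrable M f"
  shows "(\<integral>x. f x * (\<Sum>i\<in>I. b i * \<phi> i x) \<partial>M) = (\<Sum>i\<in>I. b i * fcoeff f i)"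
proof -
  have "(\<integral>x. f x * (\<Sum>i\<in>I. b i * \<phi> i x) \<partial>M) = (\<integral>x. (\<Sum>i\<in>I. b i * (f x * \<phi> i x)) \<partial>M)"
    by (simp add: sum_distrib_left mult.left_commute)
  also have "\<dots> = (\<Sum>i\<in>I. \<integral>x. b i * (f x * \<phi> i x) \<partial>M)"
    using assms by (intro Bochner_Integration.integral_sum integrable_mult_right sq_integrable_mult sq) auto
  finally show ?thesis by simp
qed

lemma sq_integrable_span:
  assumes "I \<subseteq> J" shows "sq_integrable M (\<lambda>x. \<Sum>i\<in>I. b i * \<phi> i x)"
  using assms by (intro sq_integrable_sum sq_integrable_cmult sq) auto

lemma integral_span_mult:
  assumes I: "finite I" "I \<subseteq> J" and i: "i \<in> I"
  shows "(\<integral>x. (\<Sum>i\<in>I. b i * \<phi> i x) * \<phi> i x \<partial>M) = b i"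
proof -
  have "(\<integral>x. (\<Sum>i\<in>I. b i * \<phi> i x) * \<phi> i x \<partial>M) = (\<Sum>j\<in>I. b j * (\<integral>x. \<phi> i x * \<phi> j x \<partial>M))"
    using integral_mult_sum[OF I sq[of i], of b] i I by (auto simp: mult.commute)
  also have "\<dots> = (\<Sum>j\<in>I. if i = j then b j else 0)"
    using i I by (intro sum.cong) (auto simp: ortho subset_iff)
  finally show ?thesis using I i by simp
qed

lemma integral_span_sq:
  assumes I: "finite I" "I \<subseteq> J"
  shows "(\<integral>x. (\<Sum>i\<in>I. b i * \<phi> i x) * (\<Sum>i\<in>I. b i * \<phi> i x) \<partial>M) = (\<Sum>i\<in>I. (b i)\<^sup>2)"
  unfolding integral_mult_sum[OF I sq_integrable_span[OF I(2)]]
  by (simp add: integral_span_mult[OF I] power2_eq_square)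

text \<open>Completing the square in the coefficients. With b equal to the Fourier coefficients it
  gives Bessel's inequality, and for general b the extremal property of the Fourier sum.\<close>

lemma integral_sq_diff:
  assumes I: "finite I" "I \<subseteq> J" and f: "sq_integrable M f"
  shows "(\<integral>x. (f x - (\<Sum>i\<in>I. b i * \<phi> i x))\<^sup>2 \<partial>M) =
     (\<integral>x. (f x)\<^sup>2 \<partial>M) - (\<Sum>i\<in>I. (fcoeff f i)\<^sup>2) + (\<Sum>i\<in>I. (fcoeff f i - b i)\<^sup>2)"
proof -
  let ?g = "\<lambda>x. \<Sum>i\<in>I. b i * \<phi> i x"
  have g: "sq_integrable M ?g" using I by (intro sq_integrable_span)
  note gg = integral_span_sq[OF I, of b]
  have "(\<integral>x. (f x - ?g x)\<^sup>2 \<partial>M) = (\<integral>x. (f x)\<^sup>2 - 2 * (f x * ?g x) + ?g x * ?g x \<partial>M)"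
    by (intro Bochner_Integration.integral_cong) (auto simp: power2_eq_square algebra_simps)
  also have "\<dots> = (\<integral>x. (f x)\<^sup>2 \<partial>M) - 2 * (\<integral>x. f x * ?g x \<partial>M) + (\<integral>x. ?g x * ?g x \<partial>M)"
    using f sq_integrable_mult[OF f g] sq_integrable_mult[OF g g] by (simp add: sq_integrable_def)
  also have "\<dots> = (\<integral>x. (f x)\<^sup>2 \<partial>M) - 2 * (\<Sum>i\<in>I. b i * fcoeff f i) + (\<Sum>i\<in>I. (b i)\<^sup>2)"
    unfolding gg integral_mult_sum[OF I f] ..
  also have "\<dots> = (\<integral>x. (f x)\<^sup>2 \<partial>M) - (\<Sum>i\<in>I. (fcoeff f i)\<^sup>2) + (\<Sum>i\<in>I. (fcoeff f i - b i)\<^sup>2)"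
    by (simp add: power2_diff sum.distrib sum_subtractf sum_distrib_left algebra_simps)
  finally show ?thesis .
qed

lemma bessel:
  assumes I: "finite I" "I \<subseteq> J" and f: "sq_integrable M f"
  shows "(\<Sum>i\<in>I. (fcoeff f i)\<^sup>2) \<le> (\<integral>x. (f x)\<^sup>2 \<partial>M)"
proof -
  have "0 \<le> (\<integral>x. (f x - (\<Sum>i\<in>I. fcoeff f i * \<phi> i x))\<^sup>2 \<partial>M)"
    by (rule Bochner_Integration.integral_nonneg) simp
  then show ?thesis
    unfolding integral_sq_diff[OF I f] by simp
qed

lemma best_approximation:
  assumes I: "finite I" "I \<subseteq> I'" "finite I'" "I' \<subseteq> J" and f: "sq_integrable M f"
  shows "(\<integral>x. (f x - (\<Sum>i\<in>I'. fcoeff f i * \<phi> i x))\<^sup>2 \<partial>M) \<le>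
    (\<integral>x. (f x - (\<Sum>i\<in>I. b i * \<phi> i x))\<^sup>2 \<partial>M)"
proof -
  have "(\<Sum>i\<in>I. (fcoeff f i)\<^sup>2) \<le> (\<Sum>i\<in>I'. (fcoeff f i)\<^sup>2)"
    using I by (intro sum_mono2) auto
  moreover have "0 \<le> (\<Sum>i\<in>I. (fcoeff f i - b i)\<^sup>2)" by (intro sum_nonneg) auto
  moreover have "I \<subseteq> J" using I by auto
  ultimately show ?thesis
    unfolding integral_sq_diff[OF I(1) \<open>I \<subseteq> J\<close> f] integral_sq_diff[OF I(3,4) f] by simp
qed

end

text \<open>The real orthonormal Fourier basis, with cosines for positive and sines for negative k.
  Taking a point of the unit circle instead of an angle makes it single-valued and polynomial in the
  ambient coordinates.\<close>

definition circle_mode :: "int \<Rightarrow> complex \<Rightarrow> real" where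
  "circle_mode k z = (if k = 0 then 1 / sqrt (2*pi)
     else if k > 0 then Re (z ^ nat k) / sqrt pi else Im (z ^ nat (- k)) / sqrt pi)"

definition amp :: "int \<Rightarrow> real" where
  "amp k = (if k = 0 then 1 / sqrt (2*pi) else 1 / sqrt pi)"

text \<open>Writing sines as shifted cosines lets one product-to-sum formula cover all cases.\<close>

definition phase :: "int \<Rightarrow> real" where
  "phase k = (if k < 0 then pi / 2 else 0)"

lemma circle_mode_cis: "circle_mode k (cis x) = amp k * cos (\<bar>k\<bar> * x - phase k)"
proof -
  have "cis x ^ nat k = cis (k * x)" if "k > 0"
    using that Complex.DeMoivre[of x "nat k"] by (metis of_nat_nat order.strict_implies_order)
  moreover have "cis x ^ nat (- k) = cis (- k * x)" if "k < 0"
    using that Complex.DeMoivre[of x "nat (- k)"] by (metis neg_0_le_iff_le of_int_minus of_nat_nat order.strict_implies_order)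
  ultimately show ?thesis
    by (auto simp: circle_mode_def amp_def phase_def cos_diff not_less)
qed

lemma continuous_circle_mode [continuous_intros]:
  "continuous_on S f \<Longrightarrow> continuous_on S (\<lambda>x. circle_mode k (f x))"
  by (cases "k = 0"; cases "k > 0") (auto simp: circle_mode_def intro!: continuous_intros)

lemma integral_period_FTC:
  assumes F: "\<And>x. (F has_real_derivative f x) (at x)" and f: "continuous_on UNIV f"
  shows "(\<integral>x. f x \<partial>period) = F (2*pi) - F 0"
proof -
  have "(\<integral>x. f x \<partial>period) = (\<integral>x. indicator {0..<2*pi} x *\<^sub>R f x \<partial>lborel)"
    unfolding period_def by (rule integral_restrict_space) simp
  also have "\<dots> = (\<integral>x. f x * indicator {0..2*pi} x \<partial>lborel)"
  proof (rule integral_cong_AE)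
    have [measurable]: "f \<in> borel_measurable borel" using f by (rule borel_measurable_continuous_onI)
    show "(\<lambda>x. indicator {0..<2*pi} x *\<^sub>R f x) \<in> borel_measurable lborel" by measurable
    show "(\<lambda>x. f x * indicator {0..2*pi} x) \<in> borel_measurable lborel" by measurable
    show "AE x in lborel. indicator {0..<2*pi} x *\<^sub>R f x = f x * indicator {0..2*pi} x"
      using AE_lborel_singleton[of "2*pi"] by eventually_elim (auto simp: indicator_def)
  qed
  also have "\<dots> = F (2*pi) - F 0"
    by (rule integral_FTC_Icc_real) (use F f in \<open>auto simp: continuous_on_eq_continuous_at\<close>)
  finally show ?thesis .
qed

lemma integral_period_cos:
  fixes n :: int
  shows "(\<integral>x. cos (n * x + c) \<partial>period) = (if n = 0 then 2*pi * cos c else 0)"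
proof (cases "n = 0")
  case True
  have "(\<integral>x. cos c \<partial>period) = cos c * (2*pi) - cos c * 0"
    by (rule integral_period_FTC[of "\<lambda>x. cos c * x"]) (auto intro!: derivative_eq_intros)
  with True show ?thesis by simp
next
  case False
  have "(\<integral>x. cos (n * x + c) \<partial>period) = sin (n * (2*pi) + c) / n - sin (of_int n * 0 + c) / n"
    by (rule integral_period_FTC[of "\<lambda>x. sin (n * x + c) / n"])
       (use False in \<open>auto intro!: derivative_eq_intros continuous_intros\<close>)
  then show ?thesis using False sin_shift[of c n] by (simp add: algebra_simps)
qed

lemma integrable_period_continuous:
  fixes f :: "real \<Rightarrow> real"
  assumes "continuous_on UNIV f" shows "integrable period f"
proof -
  have m: "f \<in> borel_measurable borel" using assms by (rule borel_measurable_continuous_onI)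
  have "compact (f ` {0..2*pi})"
    by (intro compact_continuous_image continuous_on_subset[OF assms]) auto
  then obtain B where "\<And>x. x \<in> {0..2*pi} \<Longrightarrow> \<bar>f x\<bar> \<le> B"
    by (metis compact_imp_bounded bounded_iff image_eqI real_norm_def)
  then show ?thesis
    by (intro period.integrable_const_bound[of _ B] AE_I2 measurable_period[OF m]) (auto simp: space_period)
qed

lemma circle_mode_ortho:
  "(\<integral>x. circle_mode j (cis x) * circle_mode k (cis x) \<partial>period) = (if j = k then 1 else 0)"
proof -
  have eq: "circle_mode j (cis x) * circle_mode k (cis x) = amp j * amp k / 2 *
    (cos ((\<bar>j\<bar> - \<bar>k\<bar>) * x + (phase k - phase j)) + cos ((\<bar>j\<bar> + \<bar>k\<bar>) * x + - (phase j + phase k)))" for x :: real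
    unfolding circle_mode_cis by (simp add: cos_times_cos algebra_simps)
  have i: "integrable period (\<lambda>x. cos (of_int n * x + c))" for n :: int and c
    by (intro integrable_period_continuous continuous_intros)
  have "(\<integral>x. circle_mode j (cis x) * circle_mode k (cis x) \<partial>period) = amp j * amp k / 2 *
    ((\<integral>x. cos ((\<bar>j\<bar> - \<bar>k\<bar>) * x + (phase k - phase j)) \<partial>period) + (\<integral>x. cos ((\<bar>j\<bar> + \<bar>k\<bar>) * x + - (phase j + phase k)) \<partial>period))"
  proof -
    have "(\<integral>x. circle_mode j (cis x) * circle_mode k (cis x) \<partial>period) = (\<integral>x. amp j * amp k / 2 *
      (cos ((\<bar>j\<bar> - \<bar>k\<bar>) * x + (phase k - phase j)) + cos ((\<bar>j\<bar> + \<bar>k\<bar>) * x + - (phase j + phase k))) \<partial>period)"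
      by (rule Bochner_Integration.integral_cong[OF refl eq])
    also have "\<dots> = amp j * amp k / 2 * (\<integral>x. (cos ((\<bar>j\<bar> - \<bar>k\<bar>) * x + (phase k - phase j)) +
      cos ((\<bar>j\<bar> + \<bar>k\<bar>) * x + - (phase j + phase k))) \<partial>period)"
      by (rule integral_mult_right_zero)
    also note Bochner_Integration.integral_add[OF i i]
    finally show ?thesis .
  qed
  also have "\<dots> = (if j = k then 1 else 0)"
    unfolding integral_period_cos
  proof -
    have amp0: "amp 0 * amp 0 = 1 / (2*pi)" and amp1: "amp k * amp k = 1 / pi" if "k \<noteq> 0" for k
      using that by (simp_all add: amp_def)
    \<comment> \<open>Only frequency zero survives integration: both terms when j = k = 0, the
      difference term when j = k is nonzero. For j = - k nonzero the difference frequency vanishes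
      too, but the phases differ by pi/2 and the remaining cosine is 0.\<close>
    consider "j = k" "k = 0" | "j = k" "k \<noteq> 0" | "j = - k" "k > 0" | "j = - k" "k < 0" | "\<bar>j\<bar> \<noteq> \<bar>k\<bar>"
      by linarith
    then show "amp j * amp k / 2 * ((if \<bar>j\<bar> - \<bar>k\<bar> = 0 then 2*pi * cos (phase k - phase j) else 0) +
        (if \<bar>j\<bar> + \<bar>k\<bar> = 0 then 2*pi * cos (- (phase j + phase k)) else 0)) = (if j = k then 1 else 0)"
      by cases (simp_all add: amp0[of 1] amp1 phase_def, auto)
  qed
  finally show ?thesis .
qed

section \<open>Modes and coordinate derivatives\<close>

definition mode :: "int \<times> int \<Rightarrow> (nat \<Rightarrow> real) \<Rightarrow> real" where
  "mode z p = circle_mode (fst z) (pt1 p) * circle_mode (snd z) (pt2 p)"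

lemma mode_emb [simp]: "mode z (emb x y) = circle_mode (fst z) (cis x) * circle_mode (snd z) (cis y)"
  by (simp add: mode_def)

lemma continuous_on_mode: "continuous_on S (mode z)"
  unfolding mode_def by (intro continuous_intros continuous_pt)

lemma space_torus_volume [simp]: "space torus_volume = torus"
  by (simp add: torus_volume_def)

lemma sets_torus_volume [measurable_cong]: "sets torus_volume = sets borel_torus"
  by (simp add: torus_volume_def)

lemma measurable_torus_volume: "borel_measurable torus_volume = borel_measurable borel_torus"
  by (rule measurable_cong_sets) (simp_all add: sets_torus_volume)

lemma finite_measure_torus_volume: "finite_measure torus_volume"
  unfolding torus_volume_def by (rule period2.finite_measure_distr) (rule measurable_emb_period)

interpretation vol: finite_measure torus_volume
  by (rule finite_measure_torus_volume)

lemma continuous_on_torus_measurable: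
  assumes "continuous_on torus g" shows "g \<in> borel_measurable borel_torus"
  unfolding borel_torus_def by (rule borel_measurable_continuous_on_restrict[OF assms])

lemma continuous_on_torus_integrable:
  fixes g :: "_ \<Rightarrow> real"
  assumes M: "finite_measure M" "sets M = sets borel_torus" and g: "continuous_on torus g"
  shows "integrable M g"
proof -
  obtain B where B: "\<And>p. p \<in> torus \<Longrightarrow> \<bar>g p\<bar> \<le> B"
    using compact_imp_bounded[OF compact_continuous_image[OF g compact_torus]] by (auto simp: bounded_iff)
  have "space M = torus" using sets_eq_imp_space_eq[OF M(2)] by simp
  moreover have "g \<in> borel_measurable M"
    using continuous_on_torus_measurable[OF g] measurable_cong_sets[OF M(2) refl] by blast
  ultimately show ?thesis
    using B by (intro finite_measure.integrable_const_bound[OF M(1), of _ B] AE_I2) auto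
qed

lemmas vol_integrable = continuous_on_torus_integrable[OF finite_measure_torus_volume sets_torus_volume]

lemma continuous_on_torus_sq_integrable:
  assumes "continuous_on torus g" shows "sq_integrable torus_volume g"
  unfolding sq_integrable_def using continuous_on_torus_measurable[OF assms]
  by (auto simp: measurable_torus_volume intro!: vol_integrable continuous_intros assms)

lemma integral_torus_volume:
  assumes g: "g \<in> borel_measurable borel_torus" and i: "integrable torus_volume g"
  shows "(\<integral>p. g p \<partial>torus_volume) = (\<integral>x. \<integral>y. (g (emb x y) :: real) \<partial>period \<partial>period)"
proof -
  have "integrable (period \<Otimes>\<^sub>M period) (\<lambda>z. g (case z of (x, y) \<Rightarrow> emb x y))"
    using i unfolding torus_volume_def by (subst (asm) integrable_distr_eq[OF measurable_emb_period g])
  from period2.integral_fst'[OF this]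
  have "(\<integral>z. g (case z of (x, y) \<Rightarrow> emb x y) \<partial>(period \<Otimes>\<^sub>M period)) = (\<integral>x. \<integral>y. g (emb x y) \<partial>period \<partial>period)"
    by simp
  then show ?thesis
    unfolding torus_volume_def by (subst integral_distr[OF measurable_emb_period g])
qed

lemmas integral_torus_continuous =
  integral_torus_volume[OF continuous_on_torus_measurable vol_integrable]

interpretation modes: orthonormal torus_volume mode UNIV
proof
  fix z w :: "int \<times> int"
  show "sq_integrable torus_volume (mode z)"
    by (intro continuous_on_torus_sq_integrable continuous_on_mode)
  have c: "continuous_on torus (\<lambda>p. mode z p * mode w p)"
    by (intro continuous_intros continuous_on_mode)
  have "(\<integral>p. mode z p * mode w p \<partial>torus_volume) =
    (\<integral>x. \<integral>y. (circle_mode (fst z) (cis x) * circle_mode (fst w) (cis x)) *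
      (circle_mode (snd z) (cis y) * circle_mode (snd w) (cis y)) \<partial>period \<partial>period)"
    unfolding integral_torus_continuous[OF c c] by (simp add: mult_ac)
  also have "\<dots> = (if z = w then 1 else 0)"
    by (simp add: circle_mode_ortho prod_eq_iff)
  finally show "(\<integral>p. mode z p * mode w p \<partial>torus_volume) = (if z = w then 1 else 0)" .
qed

section \<open>Lifting functions from charts to the plane\<close>

definition dx :: "(real \<Rightarrow> real \<Rightarrow> real) \<Rightarrow> real \<Rightarrow> real \<Rightarrow> real" where
  "dx H x y = deriv (\<lambda>s. H s y) x"

definition dy :: "(real \<Rightarrow> real \<Rightarrow> real) \<Rightarrow> real \<Rightarrow> real \<Rightarrow> real" where
  "dy H x y = deriv (\<lambda>s. H x s) y"

lemma eventually_box:
  assumes "vec2 x y \<in> box2 a b"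
  shows "\<forall>\<^sub>F s in nhds x. vec2 s y \<in> box2 a b" "\<forall>\<^sub>F s in nhds y. vec2 x s \<in> box2 a b"
proof -
  have *: "x \<in> {a<..<a+2*pi}" "y \<in> {b<..<b+2*pi}" using assms by (auto simp: box2_def)
  have "\<forall>\<^sub>F s in nhds x. s \<in> {a<..<a+2*pi}"
    by (rule eventually_nhds_in_open[OF open_greaterThanLessThan *(1)])
  then show "\<forall>\<^sub>F s in nhds x. vec2 s y \<in> box2 a b"
    by (rule eventually_mono) (use *(2) in \<open>auto simp: box2_def\<close>)
  have "\<forall>\<^sub>F s in nhds y. s \<in> {b<..<b+2*pi}"
    by (rule eventually_nhds_in_open[OF open_greaterThanLessThan *(2)])
  then show "\<forall>\<^sub>F s in nhds y. vec2 x s \<in> box2 a b"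
    by (rule eventually_mono) (use *(1) in \<open>auto simp: box2_def\<close>)
qed

lemma partial_box:
  assumes h: "\<And>s t. vec2 s t \<in> box2 a b \<Longrightarrow> h (vec2 s t) = H s t" and v: "vec2 x y \<in> box2 a b"
  shows "partial 0 h (vec2 x y) = dx H x y" "partial 1 h (vec2 x y) = dy H x y"
  unfolding partial_def dx_def dy_def
proof -
  show "deriv (\<lambda>t. h ((vec2 x y)(0 := t))) (vec2 x y 0) = deriv (\<lambda>s. H s y) x"
    by (rule deriv_cong_ev) (use eventually_mono[OF eventually_box(1)[OF v] h] in auto)
  show "deriv (\<lambda>t. h ((vec2 x y)(1 := t))) (vec2 x y 1) = deriv (\<lambda>s. H x s) y"
    by (rule deriv_cong_ev) (use eventually_mono[OF eventually_box(2)[OF v] h] in auto)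
qed

definition pd :: "nat \<Rightarrow> (real \<Rightarrow> real \<Rightarrow> real) \<Rightarrow> real \<Rightarrow> real \<Rightarrow> real" where
  "pd i = (if i = 0 then dx else dy)"

lemma pd_simps [simp]: "pd 0 = dx" "pd (Suc 0) = dy"
  by (simp_all add: pd_def)

lemma iterated_partial_box:
  assumes h: "\<And>s t. vec2 s t \<in> box2 a b \<Longrightarrow> h (vec2 s t) = H s t" and "is \<in> lists {..<2}"
  shows "vec2 x y \<in> box2 a b \<Longrightarrow> foldr partial is h (vec2 x y) = foldr pd is H x y"
  using assms(2)
proof (induction "is" arbitrary: x y)
  case Nil then show ?case using h by simp
next
  case (Cons i js)
  then have "i = 0 \<or> i = 1" by auto
  moreover have "partial 0 (foldr partial js h) (vec2 x y) = dx (foldr pd js H) x y"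
     "partial 1 (foldr partial js h) (vec2 x y) = dy (foldr pd js H) x y"
    by (rule partial_box[of a b]; use Cons in auto)+
  ultimately show ?case by auto
qed

text \<open>The lift to the universal cover. It replaces the family of chart expressions by a single
  doubly periodic function on the plane, whose derivatives \<open>dx\<close> and \<open>dy\<close>
  agree with the chart derivatives.\<close>

definition pullback :: "((nat \<Rightarrow> real) \<Rightarrow> real) \<Rightarrow> real \<Rightarrow> real \<Rightarrow> real" where
  "pullback e x y = e (emb x y)"

lemma chart_inv_pullback:
  "vec2 s t \<in> box2 a b \<Longrightarrow> e (chart_inv (torus_chart a b) (vec2 s t)) = pullback e s t"
  by (simp add: chart_inv_torus pullback_def)

text \<open>Each assertion is local, so it is read off in the chart centred at the point in
  question.\<close>

lemma smooth_pullback: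
  assumes e: "smooth_fun flat_torus e" and "is": "is \<in> lists {..<2}"
  shows "continuous_on UNIV (\<lambda>z. foldr pd is (pullback e) (fst z) (snd z))" (is ?A)
    and "(\<lambda>s. foldr pd is (pullback e) s y) differentiable at x" (is ?B)
    and "(\<lambda>s. foldr pd is (pullback e) x s) differentiable at y" (is ?C)
proof -
  let ?h = "\<lambda>a b x. e (chart_inv (torus_chart a b) x)"
  have sm: "smooth_on_coords 2 (box2 a b) (?h a b)" for a b
    using e unfolding smooth_fun_def flat_torus_simps chart_image_torus[symmetric] by blast
  have eq: "foldr partial is (?h a b) (vec2 x y) = foldr pd is (pullback e) x y"
    if "vec2 x y \<in> box2 a b" for a b x y
    by (rule iterated_partial_box[OF chart_inv_pullback "is" that])
  show ?A
    unfolding continuous_on_eq_continuous_at[OF open_UNIV]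
  proof
    fix z :: "real \<times> real"
    define a where "a = fst z - pi"
    define b where "b = snd z - pi"
    let ?R = "{a<..<a+2*pi} \<times> {b<..<b+2*pi}"
    have "continuous_on (box2 a b) (foldr partial is (?h a b))"
      using sm "is" unfolding smooth_on_coords_def by blast
    then have "continuous_on ?R (\<lambda>z. foldr partial is (?h a b) (vec2 (fst z) (snd z)))"
    proof (rule continuous_on_compose2)
      show "continuous_on ?R (\<lambda>z. vec2 (fst z) (snd z))" by (intro continuous_intros)
    qed (auto simp: box2_def)
    then have "continuous_on ?R (\<lambda>z. foldr pd is (pullback e) (fst z) (snd z))"
      by (rule continuous_on_eq) (auto intro!: eq simp: box2_def)
    moreover have "open ?R" by (intro open_Times open_greaterThanLessThan)
    moreover have "z \<in> ?R" by (cases z) (simp add: a_def b_def)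
    ultimately show "isCont (\<lambda>z. foldr pd is (pullback e) (fst z) (snd z)) z"
      by (metis continuous_on_eq_continuous_at)
  qed
  define a where "a = x - pi"
  define b where "b = y - pi"
  have v: "vec2 x y \<in> box2 a b" by (auto simp: box2_def a_def b_def)
  have df: "(\<lambda>t. foldr partial is (?h a b) ((vec2 x y)(i := t))) differentiable at (vec2 x y i)" if "i < 2" for i
    using sm "is" v that unfolding smooth_on_coords_def by blast
  from df[of 0] obtain D where "((\<lambda>t. foldr partial is (?h a b) (vec2 t y)) has_real_derivative D) (at x)"
    by (auto simp: real_differentiable_def)
  then have "((\<lambda>s. foldr pd is (pullback e) s y) has_real_derivative D) (at x)"
    by (subst (asm) DERIV_cong_ev[OF refl eventually_mono[OF eventually_box(1)[OF v] eq] refl])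
  then show ?B by (auto simp: real_differentiable_def)
  from df[of 1] obtain D where "((\<lambda>t. foldr partial is (?h a b) (vec2 x t)) has_real_derivative D) (at y)"
    by (auto simp: real_differentiable_def)
  then have "((\<lambda>s. foldr pd is (pullback e) x s) has_real_derivative D) (at y)"
    by (subst (asm) DERIV_cong_ev[OF refl eventually_mono[OF eventually_box(2)[OF v] eq] refl])
  then show ?C by (auto simp: real_differentiable_def)
qed

lemma adj_mat_one2: "i < 2 \<Longrightarrow> j < 2 \<Longrightarrow> adj_mat (1\<^sub>m 2 :: real mat) $$ (i, j) = (if i = j then 1 else 0)"
proof -
  assume "i < 2" "j < 2"
  have A: "adj_mat (1\<^sub>m 2 :: real mat) \<in> carrier_mat 2 2" "1\<^sub>m 2 * adj_mat (1\<^sub>m 2 :: real mat) = 1 \<cdot>\<^sub>m 1\<^sub>m 2"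
    using adj_mat[of "1\<^sub>m 2 :: real mat" 2] by auto
  then have "adj_mat (1\<^sub>m 2 :: real mat) = 1 \<cdot>\<^sub>m 1\<^sub>m 2" by simp
  then show ?thesis using \<open>i < 2\<close> \<open>j < 2\<close> by simp
qed

lemma laplace_flat:
  "laplace_coords 2 (\<lambda>_. 1\<^sub>m 2) h v = partial 0 (partial 0 h) v + partial 1 (partial 1 h) v"
proof -
  have "(\<lambda>y. sqrt (Determinant.det (1\<^sub>m 2 :: real mat)) * (\<Sum>j<2. adj_mat (1\<^sub>m 2) $$ (i, j) / Determinant.det (1\<^sub>m 2 :: real mat) * partial j h y)) = partial i h"
    if "i < 2" for i
    using that by (simp add: adj_mat_one2 mult_delta_left)
  then show ?thesis
    unfolding laplace_coords_def by (simp add: numeral_2_eq_2)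
qed

lemma laplace_pullback:
  assumes "vec2 x y \<in> box2 a b"
  shows "laplace_coords 2 (\<lambda>_. 1\<^sub>m 2) (\<lambda>v. e (chart_inv (torus_chart a b) v)) (vec2 x y) =
    dx (dx (pullback e)) x y + dy (dy (pullback e)) x y"
proof -
  have "is \<in> lists {..<2::nat}" if "set is \<subseteq> {0, 1}" for "is" using that by auto
  then have "foldr partial is (\<lambda>v. e (chart_inv (torus_chart a b) v)) (vec2 x y) = foldr pd is (pullback e) x y"
    if "set is \<subseteq> {0, 1}" for "is"
    using that by (intro iterated_partial_box[OF chart_inv_pullback _ assms]) auto
  from this[of "[0, 0]"] this[of "[1, 1]"] show ?thesis
    unfolding laplace_flat by simp
qed

lemma ball_chart_image_torus:
  "(\<forall>c\<in>torus_atlas. \<forall>v\<in>chart_image c. P c v) \<longleftrightarrow>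
    (\<forall>a b x y. vec2 x y \<in> box2 a b \<longrightarrow> P (torus_chart a b) (vec2 x y))"
proof -
  have "(\<forall>v\<in>box2 a b. Q v) \<longleftrightarrow> (\<forall>x y. vec2 x y \<in> box2 a b \<longrightarrow> Q (vec2 x y))" for Q and a b :: real
    by (auto simp: box2_def)
  moreover have "(\<forall>c\<in>torus_atlas. Q c) \<longleftrightarrow> (\<forall>a b. Q (torus_chart a b))" for Q by blast
  ultimately show ?thesis by (simp only: chart_image_torus)
qed

text \<open>Removes the charts: every point of the plane is the centre of its own chart box, so the
  chartwise equation becomes an equation for the lift.\<close>

lemma laplace_eigenfunction_torus_iff:
  "laplace_eigenfunction flat_torus l e \<longleftrightarrow> smooth_fun flat_torus e \<and>
    (\<forall>x y. - (dx (dx (pullback e)) x y + dy (dy (pullback e)) x y) = l\<^sup>2 * pullback e x y)"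
proof -
  have "vec2 x y \<in> box2 (x - pi) (y - pi)" for x y by (auto simp: box2_def)
  then show ?thesis
    unfolding laplace_eigenfunction_def flat_torus_simps ball_chart_image_torus
    using laplace_pullback[of _ _ _ _ e] chart_inv_pullback[of _ _ _ _ e] by metis
qed

section \<open>Eigenfunctions\<close>

definition circle_mode_deriv :: "int \<Rightarrow> real \<Rightarrow> real" where
  "circle_mode_deriv k x = - amp k * \<bar>k\<bar> * sin (\<bar>k\<bar> * x - phase k)"

lemma circle_mode_has_derivative:
  "((\<lambda>x. circle_mode k (cis x)) has_real_derivative circle_mode_deriv k x) (at x)"
  unfolding circle_mode_cis circle_mode_deriv_def by (auto intro!: derivative_eq_intros)

lemma circle_mode_deriv_has_derivative:
  "(circle_mode_deriv k has_real_derivative - (of_int k)\<^sup>2 * circle_mode k (cis x)) (at x)"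
  unfolding circle_mode_cis circle_mode_deriv_def[abs_def]
  by (auto intro!: derivative_eq_intros simp: power2_eq_square simp flip: of_int_mult of_int_abs)

lemma circle_mode_deriv_periodic: "circle_mode_deriv k (2*pi) = circle_mode_deriv k 0"
  using sin_shift[of "- phase k" "\<bar>k\<bar>"] by (simp add: circle_mode_deriv_def algebra_simps)

lemma pullback_mode: "pullback (mode z) = (\<lambda>x y. circle_mode (fst z) (cis x) * circle_mode (snd z) (cis y))"
  by (simp add: pullback_def fun_eq_iff)

text \<open>Differentiating a cosine only changes its amplitude and advances its phase by pi/2, so
  the class is closed under partial derivatives without listing sines separately.\<close>

definition trig_products :: "((nat \<Rightarrow> real) \<Rightarrow> real) set" where
  "trig_products = {g. \<exists>C a b c d. g = (\<lambda>v. C * cos (a * v 0 + c) * cos (b * v 1 + d))}"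

lemma smooth_mode: "smooth_fun flat_torus (mode z)"
  unfolding smooth_fun_def
proof
  fix c assume "c \<in> atlas_of flat_torus"
  then obtain a b where c: "c = torus_chart a b" by auto
  have "smooth_on_coords 2 (box2 a b) (\<lambda>v. mode z (chart_inv (torus_chart a b) v))"
  proof (rule smooth_on_coords_local[OF openin_box2, where F = trig_products])
    fix g assume "g \<in> trig_products"
    then obtain C a b c d where g: "g = (\<lambda>v. C * cos (a * v 0 + c) * cos (b * v 1 + d))"
      unfolding trig_products_def by blast
    show "continuous_on UNIV g" unfolding g by (intro continuous_intros continuous_coord)
    fix i :: nat assume i: "i < 2"
    have d0: "((\<lambda>t. C * cos (a * t + c) * cos (b * y + d)) has_real_derivative
        (C * a) * cos (a * x + (c + pi/2)) * cos (b * y + d)) (at x)"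
     and d1: "((\<lambda>t. C * cos (a * x + c) * cos (b * t + d)) has_real_derivative
        (C * b) * cos (a * x + c) * cos (b * y + (d + pi/2))) (at y)" for x y
      using minus_sin_cos_eq[of "a * x + c"] minus_sin_cos_eq[of "b * y + d"]
      by (auto intro!: derivative_eq_intros simp: algebra_simps)
    from i have "i = 0 \<or> i = 1" by auto
    then show "(\<lambda>t. g (v(i := t))) differentiable at (v i)" for v
      using d0[of "v 1" "v 0"] d1[of "v 0" "v 1"] by (auto simp: g real_differentiable_def)
    have "partial 0 g = (\<lambda>v. (C * a) * cos (a * v 0 + (c + pi/2)) * cos (b * v 1 + d))"
      "partial 1 g = (\<lambda>v. (C * b) * cos (a * v 0 + c) * cos (b * v 1 + (d + pi/2)))"
      unfolding partial_def g using d0 d1 by (auto intro!: ext DERIV_imp_deriv)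
    with \<open>i = 0 \<or> i = 1\<close> show "partial i g \<in> trig_products" unfolding trig_products_def by blast
  next
    fix v assume v: "v \<in> box2 a b"
    let ?g = "\<lambda>v. (amp (fst z) * amp (snd z)) * cos (real_of_int \<bar>fst z\<bar> * v 0 + - phase (fst z)) * cos (real_of_int \<bar>snd z\<bar> * v 1 + - phase (snd z))"
    have "?g \<in> trig_products" unfolding trig_products_def by blast
    moreover have "mode z (chart_inv (torus_chart a b) w) = ?g w" if "w \<in> box2 a b" for w
      by (simp add: chart_inv_torus[OF that] circle_mode_cis)
    ultimately show "\<exists>g\<in>trig_products. \<exists>W. open W \<and> v \<in> W \<and> (\<forall>y\<in>W \<inter> box2 a b. mode z (chart_inv (torus_chart a b) y) = g y)"
      by (intro bexI[of _ ?g] exI[of _ UNIV]) auto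
  qed
  then show "smooth_on_coords (dim_of flat_torus) (chart_image c) (\<lambda>x. mode z (chart_inv c x))"
    by (simp add: c chart_image_torus)
qed

text \<open>The Laplace eigenvalue of \<open>mode z\<close>. Natural number values let the modes be
  arranged by level in \<open>weight_enumeration\<close>.\<close>

definition weight :: "int \<times> int \<Rightarrow> nat" where
  "weight z = nat ((fst z)\<^sup>2 + (snd z)\<^sup>2)"

lemma real_weight: "real (weight z) = (of_int (fst z))\<^sup>2 + (of_int (snd z))\<^sup>2"
  unfolding weight_def by (subst of_nat_nat) auto

lemma mode_eigenfunction: "laplace_eigenfunction flat_torus (sqrt (weight z)) (mode z)"
  unfolding laplace_eigenfunction_torus_iff
proof (intro conjI smooth_mode allI)
  fix x y :: real
  let ?u = "\<lambda>x. circle_mode (fst z) (cis x)" and ?v = "\<lambda>y. circle_mode (snd z) (cis y)"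
  have "dx (pullback (mode z)) = (\<lambda>x y. circle_mode_deriv (fst z) x * ?v y)"
    unfolding dx_def[abs_def] pullback_mode
    by (intro ext DERIV_imp_deriv DERIV_cmult_right circle_mode_has_derivative)
  then have xx: "dx (dx (pullback (mode z))) x y = (- (of_int (fst z))\<^sup>2 * ?u x) * ?v y"
    unfolding dx_def[of "dx _"] by (intro DERIV_imp_deriv) (simp only: DERIV_cmult_right circle_mode_deriv_has_derivative)
  have "dy (pullback (mode z)) = (\<lambda>x y. ?u x * circle_mode_deriv (snd z) y)"
    unfolding dy_def[abs_def] pullback_mode
    by (intro ext DERIV_imp_deriv DERIV_cmult circle_mode_has_derivative)
  then have yy: "dy (dy (pullback (mode z))) x y = ?u x * (- (of_int (snd z))\<^sup>2 * ?v y)"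
    unfolding dy_def[of "dy _"] by (intro DERIV_imp_deriv) (simp only: DERIV_cmult circle_mode_deriv_has_derivative)
  show "- (dx (dx (pullback (mode z))) x y + dy (dy (pullback (mode z))) x y) = (sqrt (weight z))\<^sup>2 * pullback (mode z) x y"
    unfolding xx yy by (simp add: pullback_mode real_weight algebra_simps)
qed

text \<open>Near a point, the function is its continuous lift composed with the angle coordinates of
  the chart centred there.\<close>

lemma smooth_continuous_on_torus:
  assumes "smooth_fun flat_torus e" shows "continuous_on torus e"
  unfolding continuous_on_eq_continuous_within
proof
  fix p assume "p \<in> torus"
  then obtain x y where p: "p = emb x y" by (auto simp: torus_def)
  define a where "a = x - pi"
  define b where "b = y - pi"
  let ?O = "pt1 -` slit a \<inter> pt2 -` slit b"
  have O: "open ?O" by (intro open_Int open_vimage open_slit continuous_pt)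
  have "p \<in> ?O" by (simp add: p a_def b_def arc_coord_cis)
  have H: "continuous_on UNIV (\<lambda>z. pullback e (fst z) (snd z))"
    using smooth_pullback(1)[OF assms, of "[]"] by simp
  have "continuous_on (torus \<inter> ?O) (\<lambda>p. pullback e (fst (arc_coord a (pt1 p), arc_coord b (pt2 p))) (snd (arc_coord a (pt1 p), arc_coord b (pt2 p))))"
    by (rule continuous_on_compose2[OF H])
       (intro continuous_intros continuous_on_compose2[OF continuous_on_arc_coord] continuous_pt, auto)
  moreover have "pullback e (arc_coord a (pt1 q)) (arc_coord b (pt2 q)) = e q" if q: "q \<in> torus \<inter> ?O" for q
  proof -
    from q obtain s t where "q = emb s t" by (auto simp: torus_def)
    with q obtain m n :: int where
      mn: "a < s + 2*pi* of_int m" "s + 2*pi* of_int m < a + 2*pi" "b < t + 2*pi* of_int n" "t + 2*pi* of_int n < b + 2*pi"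
      by (auto simp: cis_slit_iff)
    have "q = emb (s + 2*pi* of_int m) (t + 2*pi* of_int n)" by (simp add: \<open>q = emb s t\<close>)
    with mn show ?thesis by (simp add: pullback_def arc_coord_cis del: emb_shift cis_shift)
  qed
  ultimately have "continuous_on (torus \<inter> ?O) e"
    by (subst continuous_on_cong[OF refl, of _ e]) auto
  then have "continuous (at p within torus \<inter> ?O) e"
    using \<open>p \<in> torus\<close> \<open>p \<in> ?O\<close> by (simp add: continuous_on_eq_continuous_within)
  moreover have "at p within torus \<inter> ?O = at p within torus"
    by (rule at_within_nhd[OF \<open>p \<in> ?O\<close> O]) auto
  ultimately show "continuous (at p within torus) e" by simp
qed

text \<open>\<open>deriv\<close> selects from the set of possible derivatives, and translation
  identifies the two sets.\<close>

lemma deriv_periodic: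
  fixes f :: "real \<Rightarrow> real"
  assumes "\<And>x. f (x + T) = f x" shows "deriv f (x + T) = deriv f x"
proof -
  have "(f has_real_derivative D) (at (x + T)) \<longleftrightarrow> (f has_real_derivative D) (at x)" for D
    using DERIV_shift[of f D x T] assms by (simp add: add.commute)
  then show ?thesis unfolding deriv_def by simp
qed

text \<open>Two integrations by parts in one application of the fundamental theorem: with u the
  mode, h' u - h u' is a primitive of h'' u + k^2 h u, and periodicity cancels its boundary
  values.\<close>

lemma green_1d:
  fixes h h' h'' :: "real \<Rightarrow> real"
  assumes h: "\<And>x. (h has_real_derivative h' x) (at x)" and h': "\<And>x. (h' has_real_derivative h'' x) (at x)"
    and h'': "continuous_on UNIV h''" and per: "h (2*pi) = h 0" "h' (2*pi) = h' 0"
  shows "(\<integral>x. h'' x * circle_mode k (cis x) \<partial>period) = - (of_int k)\<^sup>2 * (\<integral>x. h x * circle_mode k (cis x) \<partial>period)"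
proof -
  have ch: "continuous_on UNIV h" using h by (meson DERIV_isCont continuous_at_imp_continuous_on)
  have cu: "continuous_on UNIV (\<lambda>x. circle_mode k (cis x))" by (intro continuous_intros)
  let ?F = "\<lambda>x. h' x * circle_mode k (cis x) - h x * circle_mode_deriv k x"
  let ?f = "\<lambda>x. h'' x * circle_mode k (cis x) + (of_int k)\<^sup>2 * (h x * circle_mode k (cis x))"
  have "(\<integral>x. ?f x \<partial>period) = ?F (2*pi) - ?F 0"
  proof (rule integral_period_FTC)
    show "continuous_on UNIV ?f" by (intro continuous_intros h'' ch)
    fix x show "(?F has_real_derivative ?f x) (at x)"
      by (auto intro!: derivative_eq_intros h h' circle_mode_has_derivative circle_mode_deriv_has_derivative simp: algebra_simps)
  qed
  also have "\<dots> = 0" using per circle_mode_deriv_periodic[of k] by simp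
  finally have "0 = (\<integral>x. ?f x \<partial>period)" by simp
  also have "\<dots> = (\<integral>x. h'' x * circle_mode k (cis x) \<partial>period) + (of_int k)\<^sup>2 * (\<integral>x. h x * circle_mode k (cis x) \<partial>period)"
    using integrable_period_continuous[OF continuous_on_mult[OF h'' cu]] integrable_period_continuous[OF continuous_on_mult[OF ch cu]]
    by simp
  finally show ?thesis by simp
qed

lemma integrable_period2_continuous:
  fixes f :: "real \<times> real \<Rightarrow> real"
  assumes "continuous_on UNIV f" shows "integrable (period \<Otimes>\<^sub>M period) f"
proof -
  have m: "f \<in> borel_measurable (borel \<Otimes>\<^sub>M borel)" unfolding borel_prod using assms by (rule borel_measurable_continuous_onI)
  have "(\<lambda>z. f (fst z, snd z)) \<in> borel_measurable (period \<Otimes>\<^sub>M period)"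
    by (rule measurable_compose[OF measurable_Pair[OF measurable_fst_period] m])
  then have m': "f \<in> borel_measurable (period \<Otimes>\<^sub>M period)" by simp
  have "compact (f ` ({0..2*pi} \<times> {0..2*pi}))"
    by (intro compact_continuous_image continuous_on_subset[OF assms] compact_Times) auto
  then obtain B where "\<And>z. z \<in> {0..2*pi} \<times> {0..2*pi} \<Longrightarrow> \<bar>f z\<bar> \<le> B"
    by (metis compact_imp_bounded bounded_iff image_eqI real_norm_def)
  then show ?thesis
    by (intro period2.integrable_const_bound[of _ B] AE_I2 m') (auto simp: space_pair_measure space_period)
qed

lemma pullback_periodic: "pullback e (x + 2*pi) y = pullback e x y" "pullback e x (y + 2*pi) = pullback e x y"
  using emb_shift(1)[of x 1 y] emb_shift(2)[of x y 1] by (simp_all add: pullback_def)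

text \<open>Symmetry of the Laplacian: Green's identity in each variable moves it from e to the
  mode, so the inner product I satisfies l^2 I = \<open>weight z\<close> I.\<close>

lemma eigenfunction_mode_orthogonal:
  assumes e: "laplace_eigenfunction flat_torus l e" and ne: "real (weight z) \<noteq> l\<^sup>2"
  shows "(\<integral>p. e p * mode z p \<partial>torus_volume) = 0"
proof -
  define H where "H = pullback e"
  let ?u = "\<lambda>x. circle_mode (fst z) (cis x)" and ?v = "\<lambda>y. circle_mode (snd z) (cis y)"
  have sm: "smooth_fun flat_torus e" and eq: "- (dx (dx H) x y + dy (dy H) x y) = l\<^sup>2 * H x y" for x y
    using e by (auto simp: laplace_eigenfunction_torus_iff H_def)
  note S = smooth_pullback[OF sm, folded H_def]
  have cont: "continuous_on UNIV (\<lambda>z. H (fst z) (snd z))" "continuous_on UNIV (\<lambda>z. dx (dx H) (fst z) (snd z))"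
    "continuous_on UNIV (\<lambda>z. dy (dy H) (fst z) (snd z))"
    using S(1)[of "[]"] S(1)[of "[0,0]"] S(1)[of "[1,1]"] by simp_all
  have hx: "((\<lambda>s. H s y) has_real_derivative dx H x y) (at x)" "((\<lambda>s. dx H s y) has_real_derivative dx (dx H) x y) (at x)" for x y
    using S(2)[of "[]" y x] S(2)[of "[0]" y x] by (simp_all add: dx_def DERIV_deriv_iff_real_differentiable)
  have hy: "((\<lambda>s. H x s) has_real_derivative dy H x y) (at y)" "((\<lambda>s. dy H x s) has_real_derivative dy (dy H) x y) (at y)" for x y
    using S(3)[of "[]" x y] S(3)[of "[1]" x y] by (simp_all add: dy_def DERIV_deriv_iff_real_differentiable)
  have px: "H (x + 2*pi) y = H x y" "dx H (x + 2*pi) y = dx H x y" for x y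
    unfolding dx_def by (simp_all add: H_def pullback_periodic deriv_periodic)
  have py: "H x (y + 2*pi) = H x y" "dy H x (y + 2*pi) = dy H x y" for x y
    unfolding dy_def by (simp_all add: H_def pullback_periodic deriv_periodic)
  have sl: "continuous_on UNIV (\<lambda>x. g (x, y))" "continuous_on UNIV (\<lambda>y. g (x, y))"
    if "continuous_on UNIV g" for g :: "real \<times> real \<Rightarrow> real" and x y
    by (rule continuous_on_compose2[OF that]; auto intro!: continuous_intros)+
  have gx: "(\<integral>x. dx (dx H) x y * ?u x \<partial>period) = - (of_int (fst z))\<^sup>2 * (\<integral>x. H x y * ?u x \<partial>period)" for y
    by (rule green_1d[OF hx]) (use sl(1)[OF cont(2)] px[of 0] in auto)
  have gy: "(\<integral>y. dy (dy H) x y * ?v y \<partial>period) = - (of_int (snd z))\<^sup>2 * (\<integral>y. H x y * ?v y \<partial>period)" for x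
    by (rule green_1d[OF hy]) (use sl(2)[OF cont(3)] py[of _ 0] in auto)
  have uv: "continuous_on UNIV (\<lambda>z. ?u (fst z) * ?v (snd z))" by (intro continuous_intros)
  define I where "I = (\<integral>x. \<integral>y. H x y * (?u x * ?v y) \<partial>period \<partial>period)"
  have int: "integrable (period \<Otimes>\<^sub>M period) (\<lambda>(x, y). g x y * (?u x * ?v y))"
    if "continuous_on UNIV (\<lambda>z. g (fst z) (snd z))" for g
    using integrable_period2_continuous[OF continuous_on_mult[OF that uv]] by (simp add: case_prod_unfold)
  \<comment> \<open>Green's identity in x needs the x-integral innermost.\<close>
  have swap: "(\<integral>x. \<integral>y. g x y * (?u x * ?v y) \<partial>period \<partial>period) = (\<integral>y. (\<integral>x. g x y * ?u x \<partial>period) * ?v y \<partial>period)"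
    if "continuous_on UNIV (\<lambda>z. g (fst z) (snd z))" for g
    using period2.Fubini_integral[OF int[OF that]] by (simp add: mult.assoc[symmetric])
  have xx: "(\<integral>x. \<integral>y. dx (dx H) x y * (?u x * ?v y) \<partial>period \<partial>period) = - (of_int (fst z))\<^sup>2 * I"
    unfolding I_def swap[OF cont(1)] swap[OF cont(2)] gx by (simp add: mult.assoc)
  have sv: "(\<integral>x. \<integral>y. g x y * (?u x * ?v y) \<partial>period \<partial>period) = (\<integral>x. (\<integral>y. g x y * ?v y \<partial>period) * ?u x \<partial>period)" for g
    by (simp add: mult.assoc[symmetric] mult.commute[of "?u _"])
  have yy: "(\<integral>x. \<integral>y. dy (dy H) x y * (?u x * ?v y) \<partial>period \<partial>period) = - (of_int (snd z))\<^sup>2 * I"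
    unfolding I_def sv gy by (simp add: mult.assoc)
  have "l\<^sup>2 * I = (\<integral>x. \<integral>y. l\<^sup>2 * H x y * (?u x * ?v y) \<partial>period \<partial>period)"
    unfolding I_def by (simp add: mult.assoc)
  also have "\<dots> = (\<integral>z. - (dx (dx H) (fst z) (snd z) * (?u (fst z) * ?v (snd z)) + dy (dy H) (fst z) (snd z) * (?u (fst z) * ?v (snd z))) \<partial>(period \<Otimes>\<^sub>M period))"
    unfolding eq[symmetric] using int[OF cont(2)] int[OF cont(3)]
    by (subst period2.integral_fst'[symmetric]) (simp_all add: case_prod_unfold algebra_simps)
  also have "\<dots> = - ((\<integral>x. \<integral>y. dx (dx H) x y * (?u x * ?v y) \<partial>period \<partial>period) + (\<integral>x. \<integral>y. dy (dy H) x y * (?u x * ?v y) \<partial>period \<partial>period))"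
    using int[OF cont(2)] int[OF cont(3)] period2.integral_fst'[OF int[OF cont(2)]] period2.integral_fst'[OF int[OF cont(3)]]
    by (simp add: case_prod_unfold)
  also have "\<dots> = real (weight z) * I" unfolding xx yy real_weight by (simp add: algebra_simps)
  finally have "I = 0" using ne by auto
  moreover have c: "continuous_on torus (\<lambda>p. e p * mode z p)"
    by (intro continuous_intros smooth_continuous_on_torus[OF sm] continuous_on_mode)
  ultimately show ?thesis
    unfolding integral_torus_continuous[OF c c] I_def H_def by (simp add: pullback_def)
qed

section \<open>Completeness of the modes\<close>

text \<open>Agreement is required only on \<open>S\<close>. For the torus this makes the span of the
  modes an algebra, since products reduce to sums through cos^2 + sin^2 = 1, which fails at general
  ambient points. With \<open>UNIV\<close> the members are finite sums of modes everywhere.\<close>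

definition lin_span :: "'a set \<Rightarrow> ('i \<Rightarrow> 'a \<Rightarrow> real) \<Rightarrow> ('a \<Rightarrow> real) set" where
  "lin_span S \<phi> = {g. \<exists>I b. finite I \<and> (\<forall>x\<in>S. g x = (\<Sum>i\<in>I. b i * \<phi> i x))}"

lemma lin_span_base: "\<phi> i \<in> lin_span S \<phi>"
  unfolding lin_span_def by (intro CollectI exI[of _ "{i}"] exI[of _ "\<lambda>_. 1"]) simp

lemma lin_span_cmult:
  assumes "g \<in> lin_span S \<phi>" shows "(\<lambda>x. c * g x) \<in> lin_span S \<phi>"
proof -
  obtain I b where "finite I" "\<forall>x\<in>S. g x = (\<Sum>i\<in>I. b i * \<phi> i x)"
    using assms by (auto simp: lin_span_def)
  then show ?thesis
    unfolding lin_span_def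
    by (intro CollectI exI[of _ I] exI[of _ "\<lambda>i. c * b i"]) (simp add: sum_distrib_left mult.assoc)
qed

lemma lin_span_add:
  assumes "g \<in> lin_span S \<phi>" "h \<in> lin_span S \<phi>" shows "(\<lambda>x. g x + h x) \<in> lin_span S \<phi>"
proof -
  obtain I b where I: "finite I" "\<forall>x\<in>S. g x = (\<Sum>i\<in>I. b i * \<phi> i x)"
    using assms(1) by (auto simp: lin_span_def)
  obtain J c where J: "finite J" "\<forall>x\<in>S. h x = (\<Sum>i\<in>J. c i * \<phi> i x)"
    using assms(2) by (auto simp: lin_span_def)
  have ext: "(\<Sum>i\<in>K. d i * \<phi> i x) = (\<Sum>i\<in>I \<union> J. (if i \<in> K then d i else 0) * \<phi> i x)"
    if "K \<subseteq> I \<union> J" for K d x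
    using that I(1) J(1) by (intro sum.mono_neutral_cong_left) auto
  have "\<forall>x\<in>S. g x + h x = (\<Sum>i\<in>I \<union> J. ((if i \<in> I then b i else 0) + (if i \<in> J then c i else 0)) * \<phi> i x)"
    using I(2) J(2) by (simp add: ext[of I] ext[of J] sum.distrib distrib_right)
  then show ?thesis
    unfolding lin_span_def using I(1) J(1)
    by (intro CollectI exI[of _ "I \<union> J"] exI[of _ "\<lambda>i. (if i \<in> I then b i else 0) + (if i \<in> J then c i else 0)"]) auto
qed

lemma lin_span_sum:
  assumes "\<And>k. k \<in> K \<Longrightarrow> g k \<in> lin_span S \<phi>"
  shows "(\<lambda>x. \<Sum>k\<in>K. g k x) \<in> lin_span S \<phi>"
  using assms
proof (induction K rule: infinite_finite_induct)
  case (insert k K)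
  then show ?case using lin_span_add[of "g k" S \<phi> "\<lambda>x. \<Sum>k\<in>K. g k x"] by simp
qed (auto simp: lin_span_def intro!: exI[of _ "{}"])

lemma lin_span_cong:
  assumes "\<And>x. x \<in> S \<Longrightarrow> g x = h x" "g \<in> lin_span S \<phi>" shows "h \<in> lin_span S \<phi>"
proof -
  obtain I b where I: "finite I" "\<forall>x\<in>S. g x = (\<Sum>i\<in>I. b i * \<phi> i x)"
    using assms(2) by (auto simp: lin_span_def)
  have "\<forall>x\<in>S. h x = (\<Sum>i\<in>I. b i * \<phi> i x)"
    unfolding assms(1)[symmetric] using I(2) assms(1) by metis
  with I(1) show ?thesis unfolding lin_span_def by blast
qed

lemma lin_span_mult:
  assumes base: "\<And>i j. (\<lambda>x. \<phi> i x * \<phi> j x) \<in> lin_span S \<phi>"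
    and "g \<in> lin_span S \<phi>" "h \<in> lin_span S \<phi>" shows "(\<lambda>x. g x * h x) \<in> lin_span S \<phi>"
proof -
  obtain I b where I: "finite I" "\<forall>x\<in>S. g x = (\<Sum>i\<in>I. b i * \<phi> i x)"
    using assms(2) by (auto simp: lin_span_def)
  obtain J c where J: "finite J" "\<forall>x\<in>S. h x = (\<Sum>i\<in>J. c i * \<phi> i x)"
    using assms(3) by (auto simp: lin_span_def)
  have "(\<lambda>x. \<Sum>i\<in>I. \<Sum>j\<in>J. (b i * c j) * (\<phi> i x * \<phi> j x)) \<in> lin_span S \<phi>"
    by (intro lin_span_sum lin_span_cmult base)
  then show ?thesis
    by (rule lin_span_cong[rotated]) (use I J in \<open>simp add: sum_product mult_ac\<close>)
qed

abbreviation circle_span :: "(real \<Rightarrow> real) set" where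
  "circle_span \<equiv> lin_span UNIV (\<lambda>k x. circle_mode k (cis x))"

lemma cos_in_circle_span:
  fixes n :: int
  shows "(\<lambda>x. cos (n * x + c)) \<in> circle_span"
proof (cases "n = 0")
  case True
  have "(\<lambda>x. (sqrt (2*pi) * cos c) * circle_mode 0 (cis x)) \<in> circle_span"
    by (intro lin_span_cmult lin_span_base[where \<phi> = "\<lambda>k x. circle_mode k (cis x)"])
  then show ?thesis by (rule lin_span_cong[rotated]) (simp add: True circle_mode_def)
next
  case False
  define m where "m = \<bar>n\<bar>"
  define s where "s = (if n > 0 then 1 else - 1 :: real)"
  have m: "m > 0" "of_int n = s * of_int m" "s * s = 1" using False by (auto simp: m_def s_def)
  have "(\<lambda>x. (sqrt pi * cos c) * circle_mode m (cis x) + (- s * sqrt pi * sin c) * circle_mode (- m) (cis x)) \<in> circle_span"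
    by (intro lin_span_add lin_span_cmult lin_span_base[where \<phi> = "\<lambda>k x. circle_mode k (cis x)"])
  moreover have "(sqrt pi * cos c) * circle_mode m (cis x) + (- s * sqrt pi * sin c) * circle_mode (- m) (cis x) = cos (n * x + c)" for x :: real
  proof -
    have "circle_mode m (cis x) = cos (m * x) / sqrt pi" "circle_mode (- m) (cis x) = sin (m * x) / sqrt pi"
      using m(1) by (simp_all add: circle_mode_cis amp_def phase_def cos_diff)
    moreover have "cos (n * x) = cos (m * x)" "sin (n * x) = s * sin (m * x)"
      unfolding m(2) by (auto simp: s_def)
    ultimately show ?thesis by (simp add: cos_add)
  qed
  ultimately show ?thesis by simp
qed

lemma circle_mode_mult_in_span: "(\<lambda>x. circle_mode j (cis x) * circle_mode k (cis x)) \<in> circle_span"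
proof -
  have "(\<lambda>x. amp j * amp k / 2 * (cos (of_int (\<bar>j\<bar> - \<bar>k\<bar>) * x + (phase k - phase j)) +
     cos (of_int (\<bar>j\<bar> + \<bar>k\<bar>) * x + - (phase j + phase k)))) \<in> circle_span"
    by (intro lin_span_add lin_span_cmult cos_in_circle_span)
  then show ?thesis
    by (rule lin_span_cong[rotated]) (simp add: circle_mode_cis cos_times_cos algebra_simps)
qed

abbreviation mode_span :: "((nat \<Rightarrow> real) \<Rightarrow> real) set" where
  "mode_span \<equiv> lin_span torus mode"

lemma mode_span_product:
  assumes f: "f \<in> circle_span" and g: "g \<in> circle_span"
    and h: "\<And>x y. h (emb x y) = f x * g y"
  shows "h \<in> mode_span"
proof -
  obtain I b where I: "\<And>x. f x = (\<Sum>i\<in>I. b i * circle_mode i (cis x))"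
    using f by (auto simp: lin_span_def)
  obtain J c where J: "\<And>x. g x = (\<Sum>i\<in>J. c i * circle_mode i (cis x))"
    using g by (auto simp: lin_span_def)
  have "(\<lambda>p. \<Sum>i\<in>I. \<Sum>j\<in>J. (b i * c j) * mode (i, j) p) \<in> mode_span"
    by (intro lin_span_sum lin_span_cmult lin_span_base)
  moreover have "(\<Sum>i\<in>I. \<Sum>j\<in>J. (b i * c j) * mode (i, j) p) = h p" if "p \<in> torus" for p
  proof -
    from that obtain x y where p: "p = emb x y" by (auto simp: torus_def)
    show ?thesis unfolding p h I J by (simp add: sum_product mult_ac)
  qed
  ultimately show ?thesis by (rule lin_span_cong[rotated])
qed

lemma mode_mult_in_span: "(\<lambda>p. mode z p * mode w p) \<in> mode_span"
  by (rule mode_span_product[OF circle_mode_mult_in_span[of "fst z" "fst w"] circle_mode_mult_in_span[of "snd z" "snd w"]])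
     (simp add: mult_ac)

text \<open>The hypotheses of Stone-Weierstrass. Points are separated because the four ambient
  coordinates are cos x, sin x, cos y and sin y, hence in the span.\<close>

interpretation mode_ring: function_ring_on mode_span torus
proof
  show "compact torus" by (rule compact_torus)
  show "continuous_on torus f" if "f \<in> mode_span" for f
  proof -
    from that obtain I b where I: "\<And>x. x \<in> torus \<Longrightarrow> f x = (\<Sum>i\<in>I. b i * mode i x)"
      by (auto simp: lin_span_def)
    have "continuous_on torus (\<lambda>x. \<Sum>i\<in>I. b i * mode i x)"
      by (intro continuous_intros continuous_on_mode)
    then show ?thesis by (rule continuous_on_eq) (simp add: I)
  qed
  have one: "(\<lambda>x. c) \<in> circle_span" for c :: real
    using lin_span_cmult[OF cos_in_circle_span[of 0 0], of c] by simp
  have cs: "cos \<in> circle_span" "sin \<in> circle_span"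
    using cos_in_circle_span[of 1 0] cos_in_circle_span[of 1 "- pi / 2"] by (simp_all add: cos_diff)
  show "(\<lambda>_. c) \<in> mode_span" for c
    by (rule mode_span_product[OF one[of c] one[of 1]]) simp
  show "\<exists>f\<in>mode_span. f p \<noteq> f q" if pq: "p \<in> torus" "q \<in> torus" "p \<noteq> q" for p q
  proof -
    obtain x y x' y' where e: "p = emb x y" "q = emb x' y'" using pq by (auto simp: torus_def)
    with pq obtain i where i: "emb x y i \<noteq> emb x' y' i" by force
    then have "i = 0 \<or> i = 1 \<or> i = 2 \<or> i = 3" by (auto simp: emb_def split: if_splits)
    moreover have "(\<lambda>p. p 0) \<in> mode_span" by (rule mode_span_product[OF cs(1) one[of 1]]) simp
    moreover have "(\<lambda>p. p 1) \<in> mode_span" by (rule mode_span_product[OF cs(2) one[of 1]]) simp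
    moreover have "(\<lambda>p. p 2) \<in> mode_span" by (rule mode_span_product[OF one[of 1] cs(1)]) simp
    moreover have "(\<lambda>p. p 3) \<in> mode_span" by (rule mode_span_product[OF one[of 1] cs(2)]) simp
    ultimately have "(\<lambda>p. p i) \<in> mode_span" by auto
    then show ?thesis using i by (intro bexI[of _ "\<lambda>p. p i"]) (simp_all add: e)
  qed
qed (auto intro: lin_span_add lin_span_mult mode_mult_in_span)

section \<open>Density of trigonometric polynomials in the square-integrable functions\<close>

abbreviation trig_polys :: "((nat \<Rightarrow> real) \<Rightarrow> real) set" where
  "trig_polys \<equiv> lin_span UNIV mode"

abbreviation sq_dist :: "((nat \<Rightarrow> real) \<Rightarrow> real) \<Rightarrow> ((nat \<Rightarrow> real) \<Rightarrow> real) \<Rightarrow> real" where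
  "sq_dist f g \<equiv> (\<integral>p. (f p - g p)\<^sup>2 \<partial>torus_volume)"

definition approximable :: "((nat \<Rightarrow> real) \<Rightarrow> real) \<Rightarrow> bool" where
  "approximable f \<longleftrightarrow> sq_integrable torus_volume f \<and>
     (\<forall>\<epsilon>>0. \<exists>g\<in>trig_polys. sq_dist f g < \<epsilon>)"

lemma sq_integrable_mode_span:
  assumes "g \<in> trig_polys" shows "sq_integrable torus_volume g"
proof -
  obtain I b where "g = (\<lambda>x. \<Sum>i\<in>I. b i * mode i x)"
    using assms by (auto simp: lin_span_def fun_eq_iff)
  then show ?thesis using modes.sq_integrable_span[of I b] by simp
qed

text \<open>Pointwise, the right side minus the left is (a - 2 b + c)^2. The factor 2 is the price
  of working with squared distances and explains the quarters of \<epsilon> in its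
  applications.\<close>

lemma integral_sq_diff_triangle:
  assumes "sq_integrable M f" "sq_integrable M g" "sq_integrable M h"
  shows "(\<integral>x. (f x - h x)\<^sup>2 \<partial>M) \<le> 2 * (\<integral>x. (f x - g x)\<^sup>2 \<partial>M) + 2 * (\<integral>x. (g x - h x)\<^sup>2 \<partial>M)"
proof -
  have i: "integrable M (\<lambda>x. (f x - h x)\<^sup>2)" "integrable M (\<lambda>x. (f x - g x)\<^sup>2)" "integrable M (\<lambda>x. (g x - h x)\<^sup>2)"
    using sq_integrable_diff assms unfolding sq_integrable_def by blast+
  have "(a - c)\<^sup>2 \<le> 2 * (a - b)\<^sup>2 + 2 * (b - c)\<^sup>2" for a b c :: real
    using zero_le_power2[of "a - 2*b + c"] by (simp add: power2_eq_square algebra_simps)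
  then have "(\<integral>x. (f x - h x)\<^sup>2 \<partial>M) \<le> (\<integral>x. 2 * (f x - g x)\<^sup>2 + 2 * (g x - h x)\<^sup>2 \<partial>M)"
    using i by (intro integral_mono) auto
  also have "\<dots> = 2 * (\<integral>x. (f x - g x)\<^sup>2 \<partial>M) + 2 * (\<integral>x. (g x - h x)\<^sup>2 \<partial>M)"
    using i by simp
  finally show ?thesis .
qed

lemma approximable_close:
  assumes f: "sq_integrable torus_volume f"
    and "\<And>\<epsilon>. \<epsilon> > 0 \<Longrightarrow> \<exists>g. approximable g \<and> sq_dist f g < \<epsilon>"
  shows "approximable f"
  unfolding approximable_def
proof (intro conjI allI impI f)
  fix \<epsilon> :: real assume "\<epsilon> > 0"
  then obtain g where g: "approximable g" "sq_dist f g < \<epsilon> / 4"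
    using assms(2)[of "\<epsilon> / 4"] by auto
  moreover obtain h where h: "h \<in> trig_polys" "sq_dist g h < \<epsilon> / 4"
    using g(1) \<open>\<epsilon> > 0\<close> unfolding approximable_def by (meson divide_pos_pos zero_less_numeral)
  moreover have "sq_dist f h \<le> 2 * sq_dist f g + 2 * sq_dist g h"
    using f g(1) sq_integrable_mode_span[OF h(1)] by (intro integral_sq_diff_triangle) (auto simp: approximable_def)
  ultimately show "\<exists>g\<in>trig_polys. sq_dist f g < \<epsilon>"
    by (intro bexI[of _ h]) auto
qed

lemma approximable_add:
  assumes "approximable f" "approximable g" shows "approximable (\<lambda>p. f p + g p)"
  unfolding approximable_def
proof (intro conjI allI impI)
  have sf: "sq_integrable torus_volume f" "sq_integrable torus_volume g" using assms by (auto simp: approximable_def)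
  then show s: "sq_integrable torus_volume (\<lambda>p. f p + g p)" by (rule sq_integrable_add)
  fix \<epsilon> :: real assume "\<epsilon> > 0"
  then have "\<epsilon> / 4 > 0" by simp
  obtain f' where f': "f' \<in> trig_polys" "sq_dist f f' < \<epsilon> / 4"
    using assms(1) \<open>\<epsilon> / 4 > 0\<close> unfolding approximable_def by blast
  obtain g' where g': "g' \<in> trig_polys" "sq_dist g g' < \<epsilon> / 4"
    using assms(2) \<open>\<epsilon> / 4 > 0\<close> unfolding approximable_def by blast
  note sf' = sq_integrable_mode_span[OF f'(1)] sq_integrable_mode_span[OF g'(1)]
  have "(\<integral>p. ((f p + g p) - (f' p + g' p))\<^sup>2 \<partial>torus_volume) \<le>
    2 * (\<integral>p. ((f p + g p) - (f' p + g p))\<^sup>2 \<partial>torus_volume) + 2 * (\<integral>p. ((f' p + g p) - (f' p + g' p))\<^sup>2 \<partial>torus_volume)"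
    using sf sf' by (intro integral_sq_diff_triangle sq_integrable_add)
  also have "\<dots> < \<epsilon>" using f'(2) g'(2) by simp
  finally show "\<exists>h\<in>trig_polys. (\<integral>p. (f p + g p - h p)\<^sup>2 \<partial>torus_volume) < \<epsilon>"
    using lin_span_add[OF f'(1) g'(1)] by (intro bexI[of _ "\<lambda>p. f' p + g' p"])
qed

lemma approximable_cmult:
  assumes "approximable f" shows "approximable (\<lambda>p. c * f p)"
  unfolding approximable_def
proof (intro conjI allI impI)
  show "sq_integrable torus_volume (\<lambda>p. c * f p)"
    using assms by (intro sq_integrable_cmult) (auto simp: approximable_def)
  fix \<epsilon> :: real assume "\<epsilon> > 0"
  \<comment> \<open>The summand 1 keeps the denominator positive when c = 0.\<close>
  then have "\<epsilon> / (c\<^sup>2 + 1) > 0" by (simp add: add_nonneg_pos)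
  then obtain g where g: "g \<in> trig_polys" "sq_dist f g < \<epsilon> / (c\<^sup>2 + 1)"
    using assms unfolding approximable_def by blast
  have "(\<integral>p. (c * f p - c * g p)\<^sup>2 \<partial>torus_volume) = c\<^sup>2 * sq_dist f g"
    by (simp add: right_diff_distrib[symmetric] power_mult_distrib)
  also have "\<dots> \<le> (c\<^sup>2 + 1) * sq_dist f g"
    by (intro mult_right_mono) auto
  also have "\<dots> < \<epsilon>" using g(2) by (simp add: pos_less_divide_eq add_nonneg_pos mult.commute)
  finally show "\<exists>g\<in>trig_polys. (\<integral>p. (c * f p - g p)\<^sup>2 \<partial>torus_volume) < \<epsilon>"
    using lin_span_cmult[OF g(1)] by (intro bexI[of _ "\<lambda>p. c * g p"])
qed

lemma approximable_continuous:
  assumes "continuous_on torus f" shows "approximable f"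
  unfolding approximable_def
proof (intro conjI allI impI)
  show sf: "sq_integrable torus_volume f" by (rule continuous_on_torus_sq_integrable[OF assms])
  fix \<epsilon> :: real assume "\<epsilon> > 0"
  define V where "V = measure torus_volume torus"
  \<comment> \<open>A uniform error d gives squared distance at most d^2 V, which is then below
    \<epsilon>; V + 1 keeps the denominator positive.\<close>
  define d where "d = sqrt (\<epsilon> / (2 * (V + 1)))"
  have "V \<ge> 0" by (simp add: V_def)
  then have d: "d > 0" "d\<^sup>2 * V < \<epsilon>"
    using \<open>\<epsilon> > 0\<close> by (auto simp: d_def field_simps intro!: add_nonneg_pos)
  obtain g where g: "g \<in> mode_span" "\<And>p. p \<in> torus \<Longrightarrow> \<bar>f p - g p\<bar> < d"
    using mode_ring.Stone_Weierstrass_basic[OF assms d(1)] by blast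
  from g(1) obtain I b where I: "finite I" "\<And>p. p \<in> torus \<Longrightarrow> g p = (\<Sum>i\<in>I. b i * mode i p)"
    by (auto simp: lin_span_def)
  let ?h = "\<lambda>p. \<Sum>i\<in>I. b i * mode i p"
  have h: "?h \<in> trig_polys" unfolding lin_span_def using I(1) by blast
  have "sq_dist f ?h \<le> (\<integral>p. d\<^sup>2 \<partial>torus_volume)"
  proof (rule integral_mono)
    show "integrable torus_volume (\<lambda>p. (f p - ?h p)\<^sup>2)"
      using sq_integrable_diff[OF sf sq_integrable_mode_span[OF h]] by (simp add: sq_integrable_def)
    fix p assume "p \<in> space torus_volume"
    then have "\<bar>f p - ?h p\<bar> \<le> \<bar>d\<bar>" using g(2)[of p] I(2)[of p] by simp
    then show "(f p - ?h p)\<^sup>2 \<le> d\<^sup>2" by (simp only: abs_le_square_iff)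
  qed simp
  also have "\<dots> < \<epsilon>" using d(2) by (simp add: V_def mult.commute)
  finally show "\<exists>g\<in>trig_polys. sq_dist f g < \<epsilon>"
    using h by (intro bexI[of _ ?h])
qed

text \<open>Dominated convergence, with majorant 2 f^2 + 2 w^2 for the squared difference.\<close>

lemma approximable_limit:
  fixes s :: "nat \<Rightarrow> (nat \<Rightarrow> real) \<Rightarrow> real"
  assumes s: "\<And>n. approximable (s n)" and f: "sq_integrable torus_volume f" and w: "sq_integrable torus_volume w"
    and bound: "\<And>n p. p \<in> torus \<Longrightarrow> \<bar>s n p\<bar> \<le> w p"
    and lim: "\<And>p. p \<in> torus \<Longrightarrow> (\<lambda>n. s n p) \<longlonglongrightarrow> f p"
  shows "approximable f"
proof (rule approximable_close[OF f])
  have "(\<lambda>n. \<integral>p. (f p - s n p)\<^sup>2 \<partial>torus_volume) \<longlonglongrightarrow> (\<integral>p. 0 \<partial>torus_volume)"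
  proof (rule integral_dominated_convergence)
    show "integrable torus_volume (\<lambda>p. 2 * (f p)\<^sup>2 + 2 * (w p)\<^sup>2)" using f w by (auto simp: sq_integrable_def)
    show "(\<lambda>p. (f p - s n p)\<^sup>2) \<in> borel_measurable torus_volume" for n
      using f s[of n] by (auto simp: sq_integrable_def approximable_def)
    show "AE p in torus_volume. (\<lambda>n. (f p - s n p)\<^sup>2) \<longlonglongrightarrow> 0"
    proof (rule AE_I2)
      fix p assume "p \<in> space torus_volume"
      then have "(\<lambda>n. (f p - s n p)\<^sup>2) \<longlonglongrightarrow> (f p - f p)\<^sup>2" by (intro tendsto_intros lim) simp
      then show "(\<lambda>n. (f p - s n p)\<^sup>2) \<longlonglongrightarrow> 0" by simp
    qed
    show "AE p in torus_volume. norm ((f p - s n p)\<^sup>2) \<le> 2 * (f p)\<^sup>2 + 2 * (w p)\<^sup>2" for n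
    proof (rule AE_I2)
      fix p assume "p \<in> space torus_volume"
      then have "\<bar>s n p\<bar> \<le> w p" by (intro bound) simp
      then have "(s n p)\<^sup>2 \<le> (w p)\<^sup>2" by (intro power2_le_iff_abs_le[THEN iffD2]) auto
      moreover have "(f p - s n p)\<^sup>2 \<le> 2 * (f p)\<^sup>2 + 2 * (s n p)\<^sup>2"
        using zero_le_power2[of "f p + s n p"] by (simp add: power2_eq_square algebra_simps)
      ultimately show "norm ((f p - s n p)\<^sup>2) \<le> 2 * (f p)\<^sup>2 + 2 * (w p)\<^sup>2" by simp
    qed
  qed simp
  then have "\<forall>\<^sub>F n in sequentially. (\<integral>p. (f p - s n p)\<^sup>2 \<partial>torus_volume) < \<epsilon>" if "\<epsilon> > 0" for \<epsilon>
    using that by (intro order_tendstoD(2)) auto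
  then show "\<exists>g. approximable g \<and> sq_dist f g < \<epsilon>" if "\<epsilon> > 0" for \<epsilon>
    using that s by (meson eventually_sequentially order_refl)
qed

lemma sq_integrable_indicator: "A \<in> sets borel_torus \<Longrightarrow> sq_integrable torus_volume (indicator A)"
  by (rule vol.sq_integrable_bounded[of _ 1]) (auto simp: measurable_torus_volume indicator_def)

lemma approximable_indicator_open:
  assumes "openin (top_of_set torus) A" shows "approximable (indicator A)"
proof -
  obtain U where U: "open U" "A = torus \<inter> U" using assms by (auto simp: openin_open)
  have mA: "A \<in> sets borel_torus" using U by (auto simp: sets_borel_torus_iff)
  show ?thesis
  proof (cases "- U = {}")
    \<comment> \<open>\<open>infdist\<close> to the empty set is 0 by convention, so the cut-offs of
      the other case would vanish identically here.\<close>
    case True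
    then have "A = torus" using U by auto
    moreover have "continuous_on torus (indicator torus :: _ \<Rightarrow> real)"
      by (rule continuous_on_eq[of _ "\<lambda>_. 1"]) auto
    ultimately show ?thesis by (simp add: approximable_continuous)
  next
    case False
    \<comment> \<open>Continuous cut-offs for the indicator: 0 off \<open>U\<close>, and eventually
      1 at each point of \<open>U\<close>, which has positive distance to the closed
      complement.\<close>
    let ?s = "\<lambda>n p. min 1 (real n * infdist p (- U))"
    show ?thesis
    proof (rule approximable_limit[of ?s _ "\<lambda>_. 1"])
      show "approximable (?s n)" for n
        by (intro approximable_continuous continuous_intros)
      show "sq_integrable torus_volume (indicator A)" using mA by (rule sq_integrable_indicator)
      show "sq_integrable torus_volume (\<lambda>_. 1)" by (rule vol.sq_integrable_bounded[of _ 1]) auto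
      show "\<bar>?s n p\<bar> \<le> 1" for n p
      proof -
        have "0 \<le> ?s n p" by (simp add: infdist_nonneg)
        moreover have "?s n p \<le> 1" by simp
        ultimately show ?thesis by simp
      qed
      fix p assume p: "p \<in> torus"
      show "(\<lambda>n. ?s n p) \<longlonglongrightarrow> indicator A p"
      proof (cases "p \<in> U")
        case pU: True
        have pos: "infdist p (- U) > 0"
          by (rule infdist_pos_not_in_closed) (use U False pU in auto)
        obtain N where N: "1 < real N * infdist p (- U)" using reals_Archimedean3[OF pos] by blast
        have "?s n p = 1" if "n \<ge> N" for n
        proof -
          have "real N * infdist p (- U) \<le> real n * infdist p (- U)" using that pos by (intro mult_right_mono) auto
          then show ?thesis using N by simp
        qed
        then have "\<forall>\<^sub>F n in sequentially. ?s n p = 1" by (auto simp: eventually_sequentially)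
        then show ?thesis using p pU U by (simp add: tendsto_eventually)
      next
        case False
        then have "infdist p (- U) = 0" by simp
        then show ?thesis using False U by simp
      qed
    qed
  qed
qed

text \<open>Dynkin's pi-lambda argument: the open sets are an intersection-stable generator, and
  approximable indicators are stable under complements in the torus and countable disjoint
  unions.\<close>

lemma approximable_indicator:
  assumes "A \<in> sets borel_torus" shows "approximable (indicator A)"
proof -
  let ?G = "{U. openin (top_of_set torus) U}"
  have S: "sets borel_torus = sigma_sets torus ?G" by (simp add: sets_borel_torus)
  have "Int_stable ?G" by (auto simp: Int_stable_def)
  moreover have "?G \<subseteq> Pow torus" using openin_subset by fastforce
  ultimately show ?thesis using assms unfolding S
  proof (induction rule: sigma_sets_induct_disjoint)
    case (basic A)
    then show ?case by (simp add: approximable_indicator_open)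
  next
    case empty
    show ?case using approximable_continuous[of "\<lambda>_. 0"] by (simp add: indicator_def[abs_def])
  next
    case (compl A)
    then have A: "A \<in> sets borel_torus" by (simp add: S)
    have "approximable (\<lambda>p. indicator torus p + (- 1) * indicator A p)"
      by (intro approximable_add approximable_cmult compl approximable_indicator_open) simp
    moreover have "(\<lambda>p. indicator torus p + (- 1) * indicator A p :: real) = indicator (torus - A)"
      using A by (auto simp: fun_eq_iff indicator_def sets_borel_torus_iff)
    ultimately show ?case by simp
  next
    case (union A)
    have m: "A i \<in> sets borel_torus" for i using union by (auto simp: S)
    have eq: "(\<Sum>i<n. indicator (A i) p) = (indicator (\<Union>i<n. A i) p :: real)" for n and p :: "nat \<Rightarrow> real"
      by (rule indicator_UN_disjoint[symmetric]) (use union in \<open>auto simp: disjoint_family_on_def\<close>)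
    show ?case
    proof (rule approximable_limit[of "\<lambda>n p. \<Sum>i<n. indicator (A i) p" _ "\<lambda>_. 1"])
      show "approximable (\<lambda>p. \<Sum>i<n. indicator (A i) p)" for n
      proof (induction n)
        case 0 then show ?case using approximable_continuous[of "\<lambda>_. 0"] by simp
      next
        case (Suc n) then show ?case using approximable_add[OF Suc union(3)] by simp
      qed
      show "sq_integrable torus_volume (indicator (\<Union>i. A i))" using m by (intro sq_integrable_indicator) auto
      show "sq_integrable torus_volume (\<lambda>_. 1)" by (rule vol.sq_integrable_bounded[of _ 1]) auto
      show "\<bar>\<Sum>i<n. indicator (A i) p :: real\<bar> \<le> 1" for n and p :: "nat \<Rightarrow> real" unfolding eq by (simp add: indicator_def)
      show "(\<lambda>n. \<Sum>i<n. indicator (A i) p :: real) \<longlonglongrightarrow> indicator (\<Union>i. A i) p" for p :: "nat \<Rightarrow> real"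
        unfolding eq by (rule LIMSEQ_indicator_UN)
    qed
  qed
qed

text \<open>Simple functions dominated by 2 |f| converge to f pointwise, and each is on the torus a
  finite combination of Borel indicators.\<close>

lemma sq_integrable_approximable:
  assumes f: "sq_integrable torus_volume f" shows "approximable f"
proof -
  have "f \<in> borel_measurable torus_volume" using f by (simp add: sq_integrable_def)
  from borel_measurable_implies_sequence_metric[OF this, of 0]
  obtain F where "(\<forall>i. simple_function torus_volume (F i)) \<and> (\<forall>p\<in>space torus_volume. (\<lambda>i. F i p) \<longlonglongrightarrow> f p) \<and>
    (\<forall>i. \<forall>p\<in>space torus_volume. dist (F i p) 0 \<le> 2 * dist (f p) 0)"
    by blast
  then have F: "\<And>i. simple_function torus_volume (F i)" "\<And>p. p \<in> torus \<Longrightarrow> (\<lambda>i. F i p) \<longlonglongrightarrow> f p"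
    "\<And>i p. p \<in> torus \<Longrightarrow> \<bar>F i p\<bar> \<le> 2 * \<bar>f p\<bar>"
    by auto
  show ?thesis
  proof (rule approximable_limit[OF _ f _ F(3) F(2)])
    show "sq_integrable torus_volume (\<lambda>p. 2 * \<bar>f p\<bar>)"
      using f by (intro sq_integrable_cmult) (auto simp: sq_integrable_def)
    fix i
    let ?A = "\<lambda>y. F i -` {y} \<inter> torus"
    have A: "?A y \<in> sets borel_torus" for y
      using simple_functionD(2)[OF F(1)[of i], of "{y}"] by (simp add: sets_torus_volume)
    have fin: "finite (F i ` torus)" using simple_functionD(1)[OF F(1)[of i]] by simp
    have "approximable (\<lambda>p. \<Sum>y\<in>Y. y * indicator (?A y) p)" if "finite Y" for Y
      using that
    proof induction
      case empty then show ?case using approximable_continuous[of "\<lambda>_. 0"] by simp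
    next
      case (insert y Y)
      then show ?case using approximable_add[OF approximable_cmult[OF approximable_indicator[OF A[of y]]] insert(3)]
        by (simp only: sum.insert[OF insert(1,2)])
    qed
    note ap = this[OF fin]
    have eq: "(\<Sum>y\<in>F i ` torus. y * indicator (?A y) p) = F i p" if "p \<in> torus" for p
    proof -
      have "(\<Sum>y\<in>F i ` torus. y * indicator (?A y) p) = (\<Sum>y\<in>F i ` torus. if y = F i p then y else 0)"
        using that by (intro sum.cong) (auto simp: indicator_def)
      then show ?thesis using fin that by simp
    qed
    have sq: "sq_integrable torus_volume (F i)"
    proof -
      have "sq_integrable torus_volume (\<lambda>p. \<Sum>y\<in>F i ` torus. y * indicator (?A y) p)"
        using ap by (simp add: approximable_def)
      moreover have "integrable torus_volume (\<lambda>p. (\<Sum>y\<in>F i ` torus. y * indicator (?A y) p)\<^sup>2) \<longleftrightarrow>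
          integrable torus_volume (\<lambda>p. (F i p)\<^sup>2)"
        by (rule Bochner_Integration.integrable_cong[OF refl]) (simp only: space_torus_volume eq)
      ultimately have "integrable torus_volume (\<lambda>p. (F i p)\<^sup>2)"
        by (simp only: sq_integrable_def)
      then show ?thesis using borel_measurable_simple_function[OF F(1)] by (simp add: sq_integrable_def)
    qed
    show "approximable (F i)"
    \<comment> \<open>\<open>F i\<close> is known to equal the combination of indicators only on the
      torus, so approximability is transferred at squared distance zero.\<close>
    proof (rule approximable_close[OF sq])
      fix \<epsilon> :: real assume "\<epsilon> > 0"
      have "(\<integral>p. (F i p - (\<Sum>y\<in>F i ` torus. y * indicator (?A y) p))\<^sup>2 \<partial>torus_volume) = (\<integral>p. 0 \<partial>torus_volume)"
        using eq by (intro Bochner_Integration.integral_cong) auto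
      with ap \<open>\<epsilon> > 0\<close> show "\<exists>g. approximable g \<and> (\<integral>p. (F i p - g p)\<^sup>2 \<partial>torus_volume) < \<epsilon>"
        by (intro exI[of _ "\<lambda>p. \<Sum>y\<in>F i ` torus. y * indicator (?A y) p"]) simp
    qed
  qed
qed

section \<open>Eigenbases and Kuznecov sums\<close>

text \<open>Elements of weight v are placed by \<open>h\<close> in the block of length
  \<open>M v + 1\<close> starting at \<open>base v\<close>, and blocks of larger weight lie further
  right. Listing the range of \<open>h\<close> in increasing order is therefore monotone in the
  weight.\<close>

lemma weight_enumeration:
  fixes w :: "'a::countable \<Rightarrow> nat"
  assumes inf: "infinite (UNIV :: 'a set)" and fin: "\<And>n. finite {z. w z = n}"
  shows "\<exists>\<sigma> :: nat \<Rightarrow> 'a. bij \<sigma> \<and> (\<forall>m n. m \<le> n \<longrightarrow> w (\<sigma> m) \<le> w (\<sigma> n))"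
proof -
  define M where "M v = Max (insert 0 (to_nat ` {z. w z = v}))" for v
  define base where "base v = (\<Sum>u<v. M u + 1)" for v
  define h where "h z = base (w z) + to_nat z" for z
  have M: "to_nat z \<le> M (w z)" for z
    unfolding M_def using fin by (intro Max_ge) auto
  have base_mono: "base u \<le> base v" if "u \<le> v" for u v
    unfolding base_def using that by (intro sum_mono2) auto
  have less: "h z < h z'" if "w z < w z'" for z z'
  proof -
    have "h z < base (Suc (w z))" using M[of z] by (simp add: h_def base_def)
    also have "\<dots> \<le> base (w z')" using that by (intro base_mono) simp
    also have "\<dots> \<le> h z'" by (simp add: h_def)
    finally show ?thesis .
  qed
  have inj: "inj h"
  proof (rule injI)
    fix z z' assume "h z = h z'"
    then have "w z = w z'" using less[of z z'] less[of z' z] by (metis less_irrefl linorder_neqE_nat)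
    with \<open>h z = h z'\<close> show "z = z'" by (simp add: h_def)
  qed
  have S: "infinite (range h)" using inj inf finite_imageD by blast
  define \<sigma> where "\<sigma> n = inv_into UNIV h (enumerate (range h) n)" for n
  have h\<sigma>: "h (\<sigma> n) = enumerate (range h) n" for n
    unfolding \<sigma>_def using enumerate_in_set[OF S] by (rule f_inv_into_f)
  have "bij_betw (inv_into UNIV h) (range h) UNIV"
    by (rule bij_betw_inv_into) (use inj in \<open>simp add: bij_betw_def\<close>)
  from bij_betw_trans[OF bij_enumerate[OF S] this] have "bij \<sigma>"
    by (simp add: \<sigma>_def[abs_def] comp_def)
  moreover have "w (\<sigma> m) \<le> w (\<sigma> n)" if "m \<le> n" for m n
  proof (rule ccontr)
    assume "\<not> ?thesis"
    then have "h (\<sigma> n) < h (\<sigma> m)" by (intro less) simp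
    moreover have "h (\<sigma> m) \<le> h (\<sigma> n)"
      unfolding h\<sigma> using strict_mono_enumerate[OF S] that by (simp add: strict_mono_less_eq)
    ultimately show False by simp
  qed
  ultimately show ?thesis by blast
qed

lemma finite_weight_le: "finite {z. real (weight z) \<le> r}"
proof -
  define n where "n = \<lfloor>r\<rfloor>"
  have "{z. real (weight z) \<le> r} \<subseteq> {- n..n} \<times> {- n..n}"
  proof
    fix z :: "int \<times> int" assume "z \<in> {z. real (weight z) \<le> r}"
    then have "int (weight z) \<le> n" unfolding n_def by (simp add: le_floor_iff)
    then have n: "(fst z)\<^sup>2 + (snd z)\<^sup>2 \<le> n" by (simp add: weight_def)
    have "\<bar>k\<bar> \<le> k\<^sup>2" for k :: int
      using self_le_power[of "\<bar>k\<bar>" 2] by (cases "k = 0") auto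
    then have "\<bar>fst z\<bar> \<le> n" "\<bar>snd z\<bar> \<le> n"
      using n by (smt (verit) zero_le_power2)+
    then show "z \<in> {- n..n} \<times> {- n..n}" by (cases z) auto
  qed
  then show ?thesis by (rule finite_subset) simp
qed

lemma weight_eq_0_iff: "weight z = 0 \<longleftrightarrow> z = (0, 0)"
  by (cases z) (auto simp: weight_def sum_power2_le_zero_iff)

text \<open>An approximating polynomial uses finitely many modes; once the partial sums include them
  all, the extremal property of the Fourier sum bounds the error.\<close>

lemma modes_complete:
  assumes \<sigma>: "bij \<sigma>" and f: "sq_integrable torus_volume f"
  shows "(\<lambda>N. \<integral>p. (f p - (\<Sum>j<N::nat. modes.fcoeff f (\<sigma> j) * mode (\<sigma> j) p))\<^sup>2 \<partial>torus_volume) \<longlonglongrightarrow> 0"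
proof (rule tendstoI)
  fix \<epsilon> :: real assume "\<epsilon> > 0"
  then obtain g where g: "g \<in> trig_polys" "sq_dist f g < \<epsilon>"
    using sq_integrable_approximable[OF f] by (auto simp: approximable_def)
  then obtain I b where I: "finite I" "g = (\<lambda>x. \<Sum>i\<in>I. b i * mode i x)"
    by (auto simp: lin_span_def fun_eq_iff)
  have inj: "inj \<sigma>" and surj: "surj \<sigma>" using \<sigma> by (auto simp: bij_def)
  obtain N0 where N0: "inv_into UNIV \<sigma> ` I \<subseteq> {..<N0}"
    using finite_nat_iff_bounded I(1) by blast
  have "(\<integral>p. (f p - (\<Sum>j<N. modes.fcoeff f (\<sigma> j) * mode (\<sigma> j) p))\<^sup>2 \<partial>torus_volume) < \<epsilon>"
    if "N \<ge> N0" for N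
  proof -
    have "I \<subseteq> \<sigma> ` {..<N}"
    proof
      fix z assume "z \<in> I"
      then have "inv_into UNIV \<sigma> z < N" using N0 that by force
      moreover have "z = \<sigma> (inv_into UNIV \<sigma> z)" using surj by (simp add: surj_f_inv_f)
      ultimately show "z \<in> \<sigma> ` {..<N}" by (intro image_eqI[of _ _ "inv_into UNIV \<sigma> z"]) auto
    qed
    then have "(\<integral>p. (f p - (\<Sum>z\<in>\<sigma> ` {..<N}. modes.fcoeff f z * mode z p))\<^sup>2 \<partial>torus_volume) \<le> sq_dist f g"
      unfolding I(2) using I(1) by (intro modes.best_approximation f) auto
    moreover have "(\<Sum>z\<in>\<sigma> ` {..<N}. modes.fcoeff f z * mode z p) =
      (\<Sum>j<N. modes.fcoeff f (\<sigma> j) * mode (\<sigma> j) p)" for p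
      by (subst sum.reindex) (auto intro: inj_on_subset[OF inj])
    ultimately show ?thesis using g(2) by simp
  qed
  then show "\<forall>\<^sub>F N in sequentially. dist (\<integral>p. (f p - (\<Sum>j<N. modes.fcoeff f (\<sigma> j) * mode (\<sigma> j) p))\<^sup>2 \<partial>torus_volume) 0 < \<epsilon>"
    unfolding eventually_sequentially dist_real_def by (intro exI[of _ N0]) (simp add: Bochner_Integration.integral_nonneg)
qed

text \<open>The modes are listed by weight. Only (0, 0) has weight 0, so the second eigenvalue is
  positive, as the definition of an eigenbasis demands.\<close>

lemma eigenbasis_exists: "\<exists>e lam. laplace_eigenbasis flat_torus e lam"
proof -
  have "infinite (UNIV :: (int \<times> int) set)"
    by (simp add: infinite_UNIV_int finite_prod)
  moreover have "finite {z. weight z = n}" for n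
    by (rule finite_subset[OF _ finite_weight_le[of "real n"]]) auto
  ultimately obtain \<sigma> :: "nat \<Rightarrow> int \<times> int" where \<sigma>: "bij \<sigma>" "\<And>m n. m \<le> n \<Longrightarrow> weight (\<sigma> m) \<le> weight (\<sigma> n)"
    using weight_enumeration[of weight] by blast
  obtain j0 where "\<sigma> j0 = (0, 0)" using \<sigma>(1) by (metis bij_pointE)
  then have w0: "weight (\<sigma> 0) = 0" using \<sigma>(2)[of 0 j0] weight_eq_0_iff[of "\<sigma> j0"] by simp
  have w1: "weight (\<sigma> 1) \<noteq> 0"
  proof
    assume "weight (\<sigma> 1) = 0"
    then have "\<sigma> 1 = \<sigma> 0" using w0 by (simp add: weight_eq_0_iff)
    then show False using \<sigma>(1) by (auto simp: bij_def inj_eq)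
  qed
  have "laplace_eigenbasis flat_torus (\<lambda>j. mode (\<sigma> j)) (\<lambda>j. sqrt (weight (\<sigma> j)))"
    unfolding laplace_eigenbasis_def riem_volume_torus
  proof (intro conjI allI ballI impI)
    show "sqrt (weight (\<sigma> 0)) = 0" using w0 by simp
    show "0 < sqrt (weight (\<sigma> 1))" using w1 by simp
    show "sqrt (weight (\<sigma> j)) \<le> sqrt (weight (\<sigma> (Suc j)))" for j using \<sigma>(2)[of j "Suc j"] by simp
    show "(\<integral>x. mode (\<sigma> j) x * mode (\<sigma> k) x \<partial>torus_volume) = (if j = k then 1 else 0)" for j k
      using modes.ortho[of "\<sigma> j" "\<sigma> k"] \<sigma>(1) by (auto simp: bij_def inj_eq)
  qed (auto intro: mode_eigenfunction modes_complete[OF \<sigma>(1)] simp: sq_integrable_def)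
  then show ?thesis by blast
qed

section \<open>Eigenfunctions as finite combinations of modes\<close>

lemma emeasure_period_interval:
  assumes "0 \<le> a" "a \<le> b" "b \<le> 2*pi" shows "emeasure period {a<..<b} = ennreal (b - a)"
  unfolding period_def using assms by (subst emeasure_restrict_space) auto

text \<open>The volume charges every nonempty open set, so a continuous function vanishing almost
  everywhere vanishes everywhere.\<close>

lemma continuous_on_torus_integral_0:
  fixes g :: "(nat \<Rightarrow> real) \<Rightarrow> real"
  assumes g: "continuous_on torus g" and z: "(\<integral>p. (g p)\<^sup>2 \<partial>torus_volume) = 0" and p: "p \<in> torus"
  shows "g p = 0"
proof (rule ccontr)
  assume "g p \<noteq> 0"
  obtain x0 y0 where "p = emb x0 y0" using p by (auto simp: torus_def)
  obtain m :: int where m: "0 \<le> x0 + 2*pi* of_int m" "x0 + 2*pi* of_int m < 0 + 2*pi" by (rule obtain_shift)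
  obtain n :: int where n: "0 \<le> y0 + 2*pi* of_int n" "y0 + 2*pi* of_int n < 0 + 2*pi" by (rule obtain_shift)
  define x where "x = x0 + 2*pi* of_int m"
  define y where "y = y0 + 2*pi* of_int n"
  have pxy: "p = emb x y" by (simp add: x_def y_def \<open>p = emb x0 y0\<close>)
  have "continuous_on UNIV (\<lambda>z::real \<times> real. emb (fst z) (snd z))"
    by (intro continuous_intros)
  from continuous_on_compose2[OF g this] have "continuous_on UNIV (\<lambda>z::real \<times> real. g (emb (fst z) (snd z)))"
    by (simp add: image_subset_iff)
  then have "open ((\<lambda>z. g (emb (fst z) (snd z))) -` (- {0}))"
    by (intro open_vimage) auto
  moreover have "(x, y) \<in> (\<lambda>z. g (emb (fst z) (snd z))) -` (- {0})"
    using \<open>g p \<noteq> 0\<close> pxy by simp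
  ultimately obtain A B where "open A" "open B" "(x, y) \<in> A \<times> B" "A \<times> B \<subseteq> (\<lambda>z. g (emb (fst z) (snd z))) -` (- {0})"
    by (rule open_prod_elim)
  then have AB: "open A" "open B" "x \<in> A" "y \<in> B" "A \<times> B \<subseteq> (\<lambda>z. g (emb (fst z) (snd z))) -` (- {0})"
    by auto
  obtain a where a: "a > 0" "{x - a<..<x + a} \<subseteq> A"
    using AB(1,3) by (metis open_contains_ball ball_eq_greaterThanLessThan)
  obtain b where b: "b > 0" "{y - b<..<y + b} \<subseteq> B"
    using AB(2,4) by (metis open_contains_ball ball_eq_greaterThanLessThan)
  \<comment> \<open>The rectangle is taken to the upper right of (x, y) and cut at 2 pi, so that it
    stays inside the fundamental square, where \<open>period\<close> is Lebesgue measure.\<close>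
  define d where "d = min (min a b) (min (2*pi - x) (2*pi - y))"
  have d: "d > 0" "x + d \<le> 2*pi" "y + d \<le> 2*pi" "d \<le> a" "d \<le> b"
    using a(1) b(1) m n by (auto simp: d_def x_def y_def)
  have nz: "g (emb s t) \<noteq> 0" if "s \<in> {x<..<x + d}" "t \<in> {y<..<y + d}" for s t
  proof -
    have "s \<in> A" "t \<in> B" using that a(2) b(2) d(4,5) by auto
    then show ?thesis using AB(5) by auto
  qed
  let ?Z = "{p \<in> torus. g p \<noteq> 0}"
  have mg: "g \<in> borel_measurable torus_volume"
    using continuous_on_torus_measurable[OF g] by (simp add: measurable_torus_volume)
  have gr: "continuous_on torus (\<lambda>p. (g p)\<^sup>2)" by (intro continuous_intros g)
  have "AE p in torus_volume. (g p)\<^sup>2 = 0"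
    using z by (subst (asm) integral_nonneg_eq_0_iff_AE[OF vol_integrable[OF gr]]) auto
  then have "AE p in torus_volume. p \<notin> ?Z" by eventually_elim simp
  moreover have Z: "?Z \<in> sets torus_volume"
  proof -
    have "?Z = g -` (- {0}) \<inter> space torus_volume" by auto
    then show ?thesis using measurable_sets[OF mg, of "- {0}"] by simp
  qed
  ultimately have "emeasure torus_volume ?Z = 0"
    using AE_iff_null_sets null_setsD1 by blast
  moreover have "ennreal d * ennreal d \<le> emeasure torus_volume ?Z"
  proof -
    have "ennreal d * ennreal d = emeasure period {x<..<x+d} * emeasure period {y<..<y+d}"
      using d m n by (simp add: emeasure_period_interval x_def y_def)
    also have "\<dots> = (\<integral>\<^sup>+s. \<integral>\<^sup>+t. indicator {x<..<x+d} s * indicator {y<..<y+d} t \<partial>period \<partial>period)"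
    proof -
      have "{u<..<v} \<in> sets period" if "0 \<le> u" "v \<le> 2*pi" for u v
        using that unfolding period_def by (subst sets_restrict_space_iff) auto
      then have "{x<..<x+d} \<in> sets period" "{y<..<y+d} \<in> sets period"
        using d m n by (auto simp: x_def y_def)
      then show ?thesis by (simp add: nn_integral_cmult nn_integral_multc)
    qed
    also have "\<dots> \<le> (\<integral>\<^sup>+s. \<integral>\<^sup>+t. indicator ?Z (emb s t) \<partial>period \<partial>period)"
      by (intro nn_integral_mono) (use nz in \<open>auto simp: indicator_def\<close>)
    also have "\<dots> = emeasure torus_volume ?Z"
      by (rule emeasure_torus_volume[symmetric]) (use Z in \<open>simp add: sets_torus_volume\<close>)
    finally show ?thesis .
  qed
  ultimately show False using d(1) by simp
qed

text \<open>Modes of other weight have coefficient 0, so enlarging \<open>W\<close> by the modes of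
  an approximating polynomial leaves the Fourier sum unchanged; its squared distance to e is thus
  below every \<epsilon>. Continuity upgrades this to a pointwise identity, which may be integrated
  against a measure carried by a null set.\<close>

lemma eigenfunction_expansion:
  assumes e: "laplace_eigenfunction flat_torus l e" and W: "finite W" "\<And>z. real (weight z) = l\<^sup>2 \<Longrightarrow> z \<in> W"
    and p: "p \<in> torus"
  shows "e p = (\<Sum>z\<in>W. modes.fcoeff e z * mode z p)"
proof -
  let ?c = "modes.fcoeff e"
  let ?g = "\<lambda>p. e p - (\<Sum>z\<in>W. ?c z * mode z p)"
  have ce: "continuous_on torus e"
    using e by (intro smooth_continuous_on_torus) (auto simp: laplace_eigenfunction_def)
  then have se: "sq_integrable torus_volume e" by (rule continuous_on_torus_sq_integrable)
  have cg: "continuous_on torus ?g" by (intro continuous_intros ce continuous_on_mode)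
  have "(\<integral>p. (?g p)\<^sup>2 \<partial>torus_volume) \<le> \<epsilon>" if "\<epsilon> > 0" for \<epsilon>
  proof -
    from that obtain h where h: "h \<in> trig_polys" "sq_dist e h < \<epsilon>"
      using sq_integrable_approximable[OF se] by (auto simp: approximable_def)
    then obtain I b where I: "finite I" "h = (\<lambda>x. \<Sum>i\<in>I. b i * mode i x)"
      by (auto simp: lin_span_def fun_eq_iff)
    have "(\<Sum>z\<in>I \<union> W. ?c z * mode z p) = (\<Sum>z\<in>W. ?c z * mode z p)" for p
      using I(1) W eigenfunction_mode_orthogonal[OF e] by (intro sum.mono_neutral_right) auto
    then have "(\<integral>p. (?g p)\<^sup>2 \<partial>torus_volume) = (\<integral>p. (e p - (\<Sum>z\<in>I \<union> W. ?c z * mode z p))\<^sup>2 \<partial>torus_volume)"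
      by simp
    also have "\<dots> \<le> sq_dist e h"
      unfolding I(2) using I(1) W(1) by (intro modes.best_approximation se) auto
    finally show ?thesis using h(2) by simp
  qed
  then have "(\<integral>p. (?g p)\<^sup>2 \<partial>torus_volume) \<le> 0" by (rule field_le_epsilon[of _ 0, simplified])
  moreover have "(\<integral>p. (?g p)\<^sup>2 \<partial>torus_volume) \<ge> 0" by (rule Bochner_Integration.integral_nonneg) simp
  ultimately have "?g p = 0" by (intro continuous_on_torus_integral_0[OF cg _ p]) simp
  then show ?thesis by simp
qed

lemma kuznecov_sum_le:
  assumes b: "laplace_eigenbasis flat_torus e lam" and \<mu>: "finite_borel_measure flat_torus \<mu>"
  shows "kuznecov_sum e lam \<mu> L \<le> (\<Sum>z | real (weight z) \<le> L\<^sup>2. (\<integral>p. mode z p \<partial>\<mu>)\<^sup>2)"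
proof (cases "finite {j. lam j \<le> L}")
  \<comment> \<open>A sum over an infinite index set is 0 by convention, and the right side is
    nonnegative.\<close>
  case False
  then show ?thesis by (simp add: kuznecov_sum_def sum_nonneg)
next
  case True
  let ?J = "{j. lam j \<le> L}" and ?W = "{z. real (weight z) \<le> L\<^sup>2}"
  have W: "finite ?W" by (rule finite_weight_le)
  have \<mu>': "finite_measure \<mu>" "sets \<mu> = sets borel_torus"
    using \<mu> by (auto simp: finite_borel_measure_def sets_borel_torus)
  have eig: "laplace_eigenfunction flat_torus (lam j) (e j)" for j
    using b by (auto simp: laplace_eigenbasis_def)
  have ce: "continuous_on torus (e j)" for j
    using eig[of j] by (intro smooth_continuous_on_torus) (auto simp: laplace_eigenfunction_def)
  \<comment> \<open>Nonnegativity turns \<open>lam j \<le> L\<close> into the inequality of squares.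
    Monotonicity of \<open>lam\<close> is given only from index 1 on, hence the case split.\<close>
  have lam0: "0 \<le> lam j" for j
  proof (induction j)
    case 0 then show ?case using b by (simp add: laplace_eigenbasis_def)
  next
    case (Suc j)
    show ?case
    proof (cases "j = 0")
      case True then show ?thesis using b by (simp add: laplace_eigenbasis_def)
    next
      case False
      then have "lam j \<le> lam (Suc j)" using b by (simp add: laplace_eigenbasis_def)
      then show ?thesis using Suc by simp
    qed
  qed
  interpret e: orthonormal torus_volume e UNIV
    by standard (use b continuous_on_torus_sq_integrable[OF ce] in \<open>auto simp: laplace_eigenbasis_def riem_volume_torus\<close>)
  define a where "a z = (\<integral>p. mode z p \<partial>\<mu>)" for z
  define \<Phi> where "\<Phi> p = (\<Sum>z\<in>?W. a z * mode z p)" for p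
  have s\<Phi>: "sq_integrable torus_volume \<Phi>"
    unfolding \<Phi>_def by (rule modes.sq_integrable_span) simp
  \<comment> \<open>Eigenfunctions below the cut-off are combinations of modes in \<open>?W\<close>,
    and on those integrating against \<open>\<mu>\<close> and pairing with \<open>\<Phi>\<close>
    coincide.\<close>
  have int: "(\<integral>p. e j p \<partial>\<mu>) = (\<integral>p. \<Phi> p * e j p \<partial>torus_volume)" if "j \<in> ?J" for j
  proof -
    let ?c = "modes.fcoeff (e j)"
    have "(lam j)\<^sup>2 \<le> L\<^sup>2" using that lam0[of j] by (intro power_mono) auto
    then have "e j p = (\<Sum>z\<in>?W. ?c z * mode z p)" if "p \<in> torus" for p
      using that by (intro eigenfunction_expansion[OF eig W]) auto
    then have "(\<integral>p. e j p \<partial>\<mu>) = (\<integral>p. (\<Sum>z\<in>?W. ?c z * mode z p) \<partial>\<mu>)"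
      using \<mu> by (intro Bochner_Integration.integral_cong) (auto simp: finite_borel_measure_def)
    also have "\<dots> = (\<Sum>z\<in>?W. ?c z * a z)"
      unfolding a_def
      by (subst Bochner_Integration.integral_sum)
         (auto intro!: integrable_mult_right continuous_on_torus_integrable \<mu>' continuous_on_mode)
    also have "\<dots> = (\<integral>p. e j p * \<Phi> p \<partial>torus_volume)"
      unfolding \<Phi>_def using modes.integral_mult_sum[OF W _ e.sq[of j], of a] by (simp add: mult.commute)
    finally show ?thesis by (simp add: mult.commute)
  qed
  have "kuznecov_sum e lam \<mu> L = (\<Sum>j\<in>?J. (\<integral>p. \<Phi> p * e j p \<partial>torus_volume)\<^sup>2)"
    unfolding kuznecov_sum_def by (intro sum.cong) (simp_all add: int)
  also have "\<dots> \<le> (\<integral>p. (\<Phi> p)\<^sup>2 \<partial>torus_volume)"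
    by (rule e.bessel[OF True _ s\<Phi>]) simp
  also have "\<dots> = (\<Sum>z\<in>?W. (a z)\<^sup>2)"
    using modes.integral_span_sq[OF W, of a] by (simp add: \<Phi>_def power2_eq_square)
  finally show ?thesis by (simp add: a_def)
qed

section \<open>A lacunary density\<close>

definition freq :: "nat \<Rightarrow> nat" where
  "freq j = 2 ^ (j\<^sup>2)"

definition wave :: "nat \<Rightarrow> real \<Rightarrow> real" where
  "wave j x = (1/2) ^ Suc j * cos (real (freq j) * x)"

text \<open>The amplitudes add up to 1, so the constant 2 keeps the density at least 1 away from
  zero.\<close>

definition ripple :: "real \<Rightarrow> real" where
  "ripple x = 2 + (\<Sum>j. wave j x)"

lemma wave_bound: "\<bar>wave j x\<bar> \<le> (1/2) ^ Suc j"
  using mult_left_mono[OF abs_cos_le_one[of "real (freq j) * x"], of "(1/2) ^ Suc j"] by (simp add: wave_def abs_mult)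

lemma summable_half: "summable (\<lambda>j. (1/2 :: real) ^ Suc j)"
  using power_half_series sums_summable by blast

lemma summable_wave: "summable (\<lambda>j. norm (wave j x))"
  by (rule summable_comparison_test[OF _ summable_half]) (use wave_bound in auto)

lemma ripple_bounds: "1 \<le> ripple x" "ripple x \<le> 3"
proof -
  have "norm (\<Sum>j. wave j x) \<le> (\<Sum>j. norm (wave j x))"
    by (rule summable_norm[OF summable_wave])
  also have "\<dots> \<le> (\<Sum>j. (1/2) ^ Suc j)"
    by (rule suminf_le[OF _ summable_wave summable_half]) (use wave_bound in auto)
  also have "\<dots> = 1" using power_half_series sums_unique by metis
  finally show "1 \<le> ripple x" "ripple x \<le> 3" unfolding ripple_def by auto
qed

lemma continuous_ripple: "continuous_on UNIV ripple"
proof -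
  have "uniform_limit UNIV (\<lambda>n x. \<Sum>j<n. wave j x) (\<lambda>x. \<Sum>j. wave j x) sequentially"
    by (rule Weierstrass_m_test[OF _ summable_half]) (use wave_bound in simp)
  then have "continuous_on UNIV (\<lambda>x. \<Sum>j. wave j x)"
    by (rule uniform_limit_theorem[rotated])
       (auto intro!: always_eventually continuous_intros simp: wave_def)
  then show ?thesis unfolding ripple_def[abs_def] by (intro continuous_intros)
qed

lemma ripple_periodic: "ripple (x + 2*pi* of_int m) = ripple x"
proof -
  have "cos (real (freq j) * (x + 2*pi* of_int m)) = cos (real (freq j) * x)" for j
    using cos_shift[of "real (freq j) * x" "int (freq j) * m"] by (simp add: algebra_simps)
  then show ?thesis by (simp add: ripple_def wave_def)
qed

lemma measurable_ripple [measurable]: "ripple \<in> borel_measurable borel"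
  by (rule borel_measurable_continuous_onI[OF continuous_ripple])

definition ripple_coeff :: "int \<Rightarrow> real" where
  "ripple_coeff k = (\<integral>x. ripple x * circle_mode k (cis x) \<partial>period)"

lemma freq_pos: "0 < freq j" by (simp add: freq_def)

lemma inj_freq: "freq i = freq j \<longleftrightarrow> i = j"
  by (simp add: freq_def power2_eq_iff_nonneg)

lemma wave_eq: "wave j x = (1/2) ^ Suc j * sqrt pi * circle_mode (int (freq j)) (cis x)"
  using freq_pos[of j] by (simp add: wave_def circle_mode_cis amp_def phase_def)

text \<open>The series is integrated term by term, the L^1 norms of the terms being dominated by a
  geometric series.\<close>

lemma ripple_coeff_freq: "ripple_coeff (int (freq j)) = sqrt pi * (1/2) ^ Suc j"
proof -
  let ?u = "\<lambda>x. circle_mode (int (freq j)) (cis x)"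
  have cu: "continuous_on UNIV ?u" by (intro continuous_intros)
  have cw: "continuous_on UNIV (wave i)" for i unfolding wave_def[abs_def] by (intro continuous_intros)
  have u1: "\<bar>?u x\<bar> \<le> 1" for x
  proof -
    have "1 \<le> sqrt pi" using pi_ge_two by simp
    then have "\<bar>amp (int (freq j))\<bar> \<le> 1" using freq_pos[of j] by (simp add: amp_def)
    then show ?thesis unfolding circle_mode_cis abs_mult by (intro mult_le_one) auto
  qed
  have int: "integrable period (\<lambda>x. wave i x * ?u x)" for i
    by (intro integrable_period_continuous continuous_on_mult cw cu)
  have bound: "norm (wave i x * ?u x) \<le> (1/2) ^ Suc i" for i x
    using mult_mono[OF wave_bound[of i x] u1[of x]] by (simp add: abs_mult)
  have val: "(\<integral>x. wave i x * ?u x \<partial>period) = (if i = j then sqrt pi * (1/2) ^ Suc j else 0)" for i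
  proof -
    have "(\<integral>x. wave i x * ?u x \<partial>period) = (1/2) ^ Suc i * sqrt pi * (\<integral>x. circle_mode (int (freq i)) (cis x) * ?u x \<partial>period)"
      unfolding wave_eq by (simp add: mult.assoc)
    then show ?thesis by (cases "i = j") (simp_all add: circle_mode_ortho inj_freq)
  qed
  have norm_int: "(\<integral>x. norm (wave i x * ?u x) \<partial>period) \<le> (2*pi) * (1/2) ^ Suc i" for i
  proof -
    have "(\<integral>x. norm (wave i x * ?u x) \<partial>period) \<le> (\<integral>x. (1/2) ^ Suc i \<partial>period)"
      using int by (intro integral_mono bound) auto
    also have "\<dots> = (2*pi) * (1/2) ^ Suc i"
      by (simp add: measure_def emeasure_period space_period)
    finally show ?thesis .
  qed
  have "(\<lambda>i. \<integral>x. wave i x * ?u x \<partial>period) sums (\<integral>x. (\<Sum>i. wave i x * ?u x) \<partial>period)"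
  proof (rule sums_integral[OF int])
    show "AE x in period. summable (\<lambda>i. norm (wave i x * ?u x))"
      by (intro AE_I2 summable_comparison_test[OF _ summable_half]) (use bound in auto)
    show "summable (\<lambda>i. \<integral>x. norm (wave i x * ?u x) \<partial>period)"
      by (rule summable_comparison_test[OF _ summable_mult[OF summable_half, of "2*pi"]])
         (use norm_int in \<open>auto simp: Bochner_Integration.integral_nonneg\<close>)
  qed
  moreover have "(\<lambda>i. \<integral>x. wave i x * ?u x \<partial>period) sums (sqrt pi * (1/2) ^ Suc j)"
    unfolding val using sums_single[of j "\<lambda>_. sqrt pi * (1/2) ^ Suc j"] by simp
  ultimately have S: "(\<integral>x. (\<Sum>i. wave i x * ?u x) \<partial>period) = sqrt pi * (1/2) ^ Suc j"
    by (rule sums_unique2)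
  \<comment> \<open>Writes the constant 2 as \<open>?c\<close> times mode 0, so that it drops out by
    orthogonality to a positive frequency.\<close>
  let ?c = "2 * sqrt (2*pi)"
  have "(\<Sum>i. wave i x * ?u x) = ripple x * ?u x - ?c * (circle_mode 0 (cis x) * ?u x)" for x
    unfolding ripple_def using suminf_mult2[OF summable_norm_cancel[OF summable_wave[of x]], of "?u x"]
    by (simp add: distrib_right circle_mode_def)
  moreover have "integrable period (\<lambda>x. ripple x * ?u x)" "integrable period (\<lambda>x. circle_mode 0 (cis x) * ?u x)"
    by (intro integrable_period_continuous continuous_on_mult continuous_ripple cu continuous_intros)+
  ultimately have "(\<integral>x. (\<Sum>i. wave i x * ?u x) \<partial>period) =
      ripple_coeff (int (freq j)) - ?c * (\<integral>x. circle_mode 0 (cis x) * ?u x \<partial>period)"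
    unfolding ripple_coeff_def by simp
  then show ?thesis using freq_pos[of j] by (simp add: circle_mode_ortho S)
qed

definition ripple_energy :: real where
  "ripple_energy = (\<integral>x. (ripple x)\<^sup>2 \<partial>period)"

interpretation circle_modes: orthonormal period "\<lambda>k x. circle_mode k (cis x)" UNIV
proof
  fix j k
  have c: "continuous_on UNIV (\<lambda>x. circle_mode j (cis x))" by (intro continuous_intros)
  then show "sq_integrable period (\<lambda>x. circle_mode j (cis x))"
    unfolding sq_integrable_def
    by (auto intro!: integrable_period_continuous continuous_intros measurable_period borel_measurable_continuous_onI)
qed (rule circle_mode_ortho)

lemma sq_integrable_ripple: "sq_integrable period ripple"
  unfolding sq_integrable_def
  by (auto intro!: integrable_period_continuous continuous_intros continuous_ripple measurable_period)

text \<open>Bessel's inequality for S with the absent frequency adjoined. This single coefficient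
  serves as the lower bound for the whole tail.\<close>

lemma ripple_bessel_deficit:
  assumes "finite S" "int (freq j) \<notin> S"
  shows "(\<Sum>k\<in>S. (ripple_coeff k)\<^sup>2) \<le> ripple_energy - pi * (1/4) ^ Suc j"
proof -
  have "(ripple_coeff (int (freq j)))\<^sup>2 = pi * (1/4) ^ Suc j"
    unfolding ripple_coeff_freq power_mult_distrib by (simp add: power_mult[symmetric] mult.commute power_even_eq[of _ "Suc j", simplified] power2_eq_square flip: power_mult_distrib)
  moreover have "(\<Sum>k\<in>insert (int (freq j)) S. (ripple_coeff k)\<^sup>2) \<le> ripple_energy"
    unfolding ripple_coeff_def ripple_energy_def
    by (rule circle_modes.bessel) (use assms sq_integrable_ripple in auto)
  ultimately show ?thesis using assms by simp
qed

section \<open>The measure on the geodesic and its Fourier coefficients\<close>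

definition ripple_measure :: "(nat \<Rightarrow> real) measure" where
  "ripple_measure = distr (density period (\<lambda>x. ennreal (ripple x))) borel_torus (\<lambda>x. emb x 0)"

lemma measurable_emb_circle: "(\<lambda>x. emb x 0) \<in> period \<rightarrow>\<^sub>M borel_torus"
  by (intro measurable_emb_torus measurable_period_id) simp

lemma nn_integral_ripple_measure:
  assumes [measurable]: "g \<in> borel_measurable borel_torus"
  shows "(\<integral>\<^sup>+p. g p \<partial>ripple_measure) = (\<integral>\<^sup>+x. ennreal (ripple x) * g (emb x 0) \<partial>period)"
proof -
  note [measurable] = measurable_emb_circle measurable_period[OF measurable_ripple]
  have "(\<integral>\<^sup>+p. g p \<partial>ripple_measure) = (\<integral>\<^sup>+x. g (emb x 0) \<partial>density period (\<lambda>x. ennreal (ripple x)))"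
    unfolding ripple_measure_def by (rule nn_integral_distr) measurable
  also have "\<dots> = (\<integral>\<^sup>+x. ennreal (ripple x) * g (emb x 0) \<partial>period)"
    by (rule nn_integral_density) measurable
  finally show ?thesis .
qed

lemma sets_ripple_measure [simp]: "sets ripple_measure = sets borel_torus"
  by (simp add: ripple_measure_def)

lemma space_ripple_measure [simp]: "space ripple_measure = torus"
  by (simp add: ripple_measure_def)

lemma emeasure_ripple_measure:
  assumes B: "B \<in> sets borel_torus"
  shows "emeasure ripple_measure B = (\<integral>\<^sup>+x. ennreal (ripple x) * indicator B (emb x 0) \<partial>period)"
  using nn_integral_ripple_measure[of "indicator B"] B by simp

lemma finite_measure_ripple: "finite_measure ripple_measure"
proof (rule finite_measureI)
  have "torus \<in> sets borel_torus" by (simp add: sets_borel_torus_iff)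
  then have "emeasure ripple_measure torus = (\<integral>\<^sup>+x. ennreal (ripple x) \<partial>period)"
    by (simp add: emeasure_ripple_measure)
  also have "\<dots> \<le> (\<integral>\<^sup>+x. ennreal 3 \<partial>period)"
    by (intro nn_integral_mono ennreal_leI ripple_bounds)
  also have "\<dots> < \<infinity>"
    by (simp add: space_period emeasure_period ennreal_mult_less_top)
  finally show "emeasure ripple_measure (space ripple_measure) \<noteq> \<infinity>" by simp
qed

lemma finite_borel_ripple: "finite_borel_measure flat_torus ripple_measure"
  using finite_measure_ripple by (simp add: finite_borel_measure_def sets_borel_torus)

text \<open>The second factor is the y-mode at y = 0, where the cosines take their full height and
  the sines vanish.\<close>

lemma integral_mode_ripple: "(\<integral>p. mode z p \<partial>ripple_measure) = ripple_coeff (fst z) * circle_mode (snd z) 1"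
proof -
  have m: "mode z \<in> borel_measurable borel_torus"
    by (intro continuous_on_torus_measurable continuous_on_mode)
  have "(\<integral>p. mode z p \<partial>ripple_measure) = (\<integral>x. mode z (emb x 0) \<partial>density period (\<lambda>x. ennreal (ripple x)))"
    unfolding ripple_measure_def
    by (rule integral_distr[OF _ m]) (use measurable_emb_circle in simp)
  also have "\<dots> = (\<integral>x. ripple x * mode z (emb x 0) \<partial>period)"
    using measurable_compose[OF measurable_emb_circle m] measurable_period[OF measurable_ripple]
    by (subst integral_density) (auto intro!: AE_I2 order_trans[OF _ ripple_bounds(1)])
  also have "\<dots> = ripple_coeff (fst z) * circle_mode (snd z) 1"
    by (simp add: ripple_coeff_def mult.assoc[symmetric])
  finally show ?thesis .
qed

section \<open>Failure of the power-saving remainder\<close>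

lemma torus_dist_circle: "torus_dist (emb x 0) (emb t 0) = arccos (cos (t - x))"
  by (simp add: torus_dist_emb cmod_def arccos_cos_nonneg)

text \<open>One estimate for open and for closed balls, which is why \<open>I\<close> is merely
  squeezed between the open and the closed interval. The bounds \<open>lo\<close> and
  \<open>hi\<close> will be 1 and 3 for regularity, and \<open>ripple x\<close> minus or plus an
  oscillation for the pair distribution.\<close>

lemma emeasure_ripple_near:
  assumes r: "0 < r" "r \<le> 1" and B: "B \<in> sets borel_torus" and I: "I \<in> sets borel"
    "{x - r<..<x + r} \<subseteq> I" "I \<subseteq> {x - r..x + r}"
    and BI: "\<And>t. \<bar>t - x\<bar> \<le> pi \<Longrightarrow> emb t 0 \<in> B \<longleftrightarrow> t \<in> I"
    and lo: "0 \<le> lo" and bd: "\<And>t. \<bar>t - x\<bar> \<le> r \<Longrightarrow> lo \<le> ripple t \<and> ripple t \<le> hi"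
  shows "ennreal (lo * (2 * r)) \<le> emeasure ripple_measure B \<and> emeasure ripple_measure B \<le> ennreal (hi * (2 * r))"
proof
  have hi: "0 \<le> hi" using bd[of x] lo r by simp
  have Bm: "B \<in> sets borel" using B by (simp add: sets_borel_torus_iff)
  have "(\<lambda>t. emb t 0) \<in> borel_measurable borel" by (intro measurable_emb) auto
  from measurable_sets[OF this Bm] have [measurable]: "(\<lambda>t. emb t 0) -` B \<in> sets borel" by simp
  have "(\<lambda>t. indicator B (emb t 0) :: ennreal) = indicator ((\<lambda>t. emb t 0) -` B)"
    by (auto simp: indicator_def)
  then have [measurable]: "(\<lambda>t. indicator B (emb t 0) :: ennreal) \<in> borel_measurable borel" by simp
  have "emeasure ripple_measure B = (\<integral>\<^sup>+t. ennreal (ripple t) * indicator B (emb t 0) \<partial>period)"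
    by (rule emeasure_ripple_measure[OF B])
  \<comment> \<open>The window is recentred at x, where the ball becomes an interval; r \<le> 1 < pi
    keeps that interval inside the window.\<close>
  also have "\<dots> = (\<integral>\<^sup>+t. ennreal (ripple t) * indicator B (emb t 0) * indicator {x - pi..<x - pi + 2*pi} t \<partial>lborel)"
    by (rule nn_integral_period_shift[symmetric]) (simp_all add: ripple_periodic)
  also have "\<dots> = (\<integral>\<^sup>+t. ennreal (ripple t) * indicator I t \<partial>lborel)"
  proof (rule nn_integral_cong)
    fix t
    have "t \<notin> I" if "t < x - pi \<or> x + pi \<le> t"
      using that I(3) r pi_gt3 by fastforce
    then show "ennreal (ripple t) * indicator B (emb t 0) * indicator {x - pi..<x - pi + 2*pi} t = ennreal (ripple t) * indicator I t"
      using BI[of t] by (cases "t < x - pi \<or> x + pi \<le> t") (auto simp: indicator_def abs_le_iff)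
  qed
  finally have eq: "emeasure ripple_measure B = (\<integral>\<^sup>+t. ennreal (ripple t) * indicator I t \<partial>lborel)" .
  have "ennreal (lo * (2 * r)) = (\<integral>\<^sup>+t. ennreal lo * indicator {x - r<..<x + r} t \<partial>lborel)"
    using r lo by (simp add: nn_integral_cmult ennreal_mult)
  also have "\<dots> \<le> (\<integral>\<^sup>+t. ennreal (ripple t) * indicator I t \<partial>lborel)"
    using I bd by (intro nn_integral_mono) (auto simp: indicator_def abs_le_iff intro!: ennreal_leI)
  finally show "ennreal (lo * (2 * r)) \<le> emeasure ripple_measure B" by (simp add: eq)
  have "(\<integral>\<^sup>+t. ennreal (ripple t) * indicator I t \<partial>lborel) \<le> (\<integral>\<^sup>+t. ennreal hi * indicator {x - r..x + r} t \<partial>lborel)"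
    using I bd by (intro nn_integral_mono) (auto simp: indicator_def abs_le_iff intro!: ennreal_leI)
  also have "\<dots> = ennreal (hi * (2 * r))"
    using r hi by (simp add: nn_integral_cmult ennreal_mult)
  finally show "emeasure ripple_measure B \<le> ennreal (hi * (2 * r))" by (simp add: eq)
qed

lemma ball_sets:
  assumes "p \<in> torus"
  shows "{q \<in> torus. torus_dist p q < r} \<in> sets borel_torus" "{q \<in> torus. torus_dist p q \<le> r} \<in> sets borel_torus"
proof -
  have "continuous_on torus (\<lambda>q. torus_dist p q)"
    by (intro continuous_on_torus_dist continuous_intros)
  from continuous_on_torus_measurable[OF this]
  have "(\<lambda>q. torus_dist p q) \<in> borel_measurable borel_torus" .
  from measurable_sets[OF this, of "{..<r}"] measurable_sets[OF this, of "{..r}"]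
  show "{q \<in> torus. torus_dist p q < r} \<in> sets borel_torus" "{q \<in> torus. torus_dist p q \<le> r} \<in> sets borel_torus"
    by (simp_all add: vimage_def Int_def conj_commute)
qed

text \<open>The coordinate of index 2 is cos y. The set where it differs from 1 is open and has
  measure 0, and on the torus cos y = 1 forces the circle y = 0.\<close>

lemma supp_ripple_measure:
  assumes "p \<in> measure_supp flat_torus ripple_measure" shows "\<exists>x. p = emb x 0"
proof -
  have p: "p \<in> torus" and pos: "\<And>U. openin (top_of_set torus) U \<Longrightarrow> p \<in> U \<Longrightarrow> emeasure ripple_measure U > 0"
    using assms by (auto simp: measure_supp_def)
  let ?U = "torus \<inter> (\<lambda>p. p 2) -` (- {1})"
  have "open ((\<lambda>p::nat \<Rightarrow> real. p 2) -` (- {1}))" by (intro open_vimage continuous_coord) auto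
  then have "openin (top_of_set torus) ?U" by (auto simp: openin_open)
  moreover have "emeasure ripple_measure ?U = 0"
  proof -
    have "?U \<in> sets borel_torus"
      using \<open>openin (top_of_set torus) ?U\<close> unfolding sets_borel_torus by (intro sigma_sets.Basic) simp
    from emeasure_ripple_measure[OF this] show ?thesis by simp
  qed
  ultimately have "p \<notin> ?U" using pos by fastforce
  then have "p 2 = 1" using p by simp
  obtain x y where xy: "p = emb x y" using p by (auto simp: torus_def)
  with \<open>p 2 = 1\<close> have "cos y = 1" by simp
  then have "cis y = cis 0" using sin_cos_squared_add[of y] by (auto simp: complex_eq_iff)
  then have "p = emb x 0" using xy by (simp add: emb_eq_iff)
  then show ?thesis ..
qed

text \<open>The constants 2 and 6 are the density bounds 1 and 3 times 2, the interval cut out by a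
  ball centred on the circle having length 2 r.\<close>

lemma ripple_ahlfors_david: "ahlfors_david_regular flat_torus 1 ripple_measure"
  unfolding ahlfors_david_regular_def
proof (rule exI[of _ 2], rule conjI, simp, rule exI[of _ 6], rule conjI, simp, rule exI[of _ 1], rule conjI, simp,
    intro ballI allI impI)
  fix p and r :: real assume p: "p \<in> measure_supp flat_torus ripple_measure" and r: "0 < r \<and> r \<le> 1"
  obtain x where x: "p = emb x 0" using supp_ripple_measure[OF p] by blast
  have ball: "geodesic_ball flat_torus p r = {q \<in> torus. torus_dist p q < r}"
    using x by (auto simp: geodesic_ball_def riem_dist_torus)
  have "ennreal (1 * (2 * r)) \<le> emeasure ripple_measure {q \<in> torus. torus_dist p q < r} \<and>
     emeasure ripple_measure {q \<in> torus. torus_dist p q < r} \<le> ennreal (3 * (2 * r))"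
  proof (rule emeasure_ripple_near[where x = x and I = "{x - r<..<x + r}"])
    fix t assume "\<bar>t - x\<bar> \<le> pi"
    then have "torus_dist p (emb t 0) < r \<longleftrightarrow> \<bar>t - x\<bar> < r"
      by (simp add: x torus_dist_circle arccos_cos_abs)
    then show "emb t 0 \<in> {q \<in> torus. torus_dist p q < r} \<longleftrightarrow> t \<in> {x - r<..<x + r}"
      by (auto simp: abs_less_iff)
  qed (use r ripple_bounds ball_sets[of p r] x in auto)
  moreover have "emeasure ripple_measure B = ennreal (measure ripple_measure B)" for B
    by (rule finite_measure.emeasure_eq_measure[OF finite_measure_ripple])
  ultimately show "2 * r powr 1 \<le> measure ripple_measure (geodesic_ball flat_torus p r) \<and>
     measure ripple_measure (geodesic_ball flat_torus p r) \<le> 6 * r powr 1"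
    unfolding ball using r by simp
qed

section \<open>Pair distribution and averaged density\<close>

lemma measurable_torus_dist: "(\<lambda>z. torus_dist (fst z) (snd z)) \<in> borel_measurable (borel_torus \<Otimes>\<^sub>M borel_torus)"
proof -
  have d: "(\<lambda>z. torus_dist (fst z) (snd z)) \<in> borel_measurable (borel \<Otimes>\<^sub>M borel)"
    unfolding borel_prod by (intro borel_measurable_continuous_onI continuous_on_torus_dist continuous_intros)
  have "(\<lambda>p. p) \<in> borel_torus \<rightarrow>\<^sub>M borel"
    unfolding borel_torus_def by (rule measurable_restrict_space1) simp
  then have "(\<lambda>z. (fst z, snd z)) \<in> borel_torus \<Otimes>\<^sub>M borel_torus \<rightarrow>\<^sub>M borel \<Otimes>\<^sub>M borel"
    by (intro measurable_Pair measurable_compose[OF measurable_fst] measurable_compose[OF measurable_snd])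
  from measurable_compose[OF this d] show ?thesis by simp
qed

definition close_pairs :: "real \<Rightarrow> ((nat \<Rightarrow> real) \<times> (nat \<Rightarrow> real)) set" where
  "close_pairs r = {(p, q). p \<in> torus \<and> q \<in> torus \<and> torus_dist p q \<le> r}"

lemma pair_distribution_torus:
  "pair_distribution flat_torus \<mu> r = measure (\<mu> \<Otimes>\<^sub>M \<mu>) (close_pairs r)"
  unfolding pair_distribution_def close_pairs_def
  by (intro arg_cong[of _ _ "measure _"]) (auto simp: riem_dist_torus)

lemma close_pairs_sets: "close_pairs r \<in> sets (borel_torus \<Otimes>\<^sub>M borel_torus)"
proof -
  have "close_pairs r = (\<lambda>z. torus_dist (fst z) (snd z)) -` {..r} \<inter> space (borel_torus \<Otimes>\<^sub>M borel_torus)"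
    by (auto simp: close_pairs_def space_pair_measure)
  then show ?thesis using measurable_sets[OF measurable_torus_dist, of "{..r}"] by simp
qed

lemma emeasure_close_pairs:
  "emeasure (ripple_measure \<Otimes>\<^sub>M ripple_measure) (close_pairs r) =
    (\<integral>\<^sup>+x. ennreal (ripple x) * emeasure ripple_measure {q \<in> torus. torus_dist (emb x 0) q \<le> r} \<partial>period)"
proof -
  interpret rm: finite_measure ripple_measure by (rule finite_measure_ripple)
  have S: "close_pairs r \<in> sets (ripple_measure \<Otimes>\<^sub>M ripple_measure)"
    using close_pairs_sets by (simp cong: sets_pair_measure_cong)
  have slice: "Pair p -` close_pairs r = {q \<in> torus. torus_dist p q \<le> r}" if "p \<in> torus" for p
    using that by (auto simp: close_pairs_def)
  have "(\<lambda>p. emeasure ripple_measure (Pair p -` close_pairs r)) \<in> borel_measurable ripple_measure"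
    by (rule rm.measurable_emeasure_Pair[OF S])
  then have m: "(\<lambda>p. emeasure ripple_measure (Pair p -` close_pairs r)) \<in> borel_measurable borel_torus"
    by (simp cong: measurable_cong_sets)
  have "emeasure (ripple_measure \<Otimes>\<^sub>M ripple_measure) (close_pairs r) = (\<integral>\<^sup>+p. emeasure ripple_measure (Pair p -` close_pairs r) \<partial>ripple_measure)"
    by (rule rm.emeasure_pair_measure_alt[OF S])
  also have "\<dots> = (\<integral>\<^sup>+x. ennreal (ripple x) * emeasure ripple_measure (Pair (emb x 0) -` close_pairs r) \<partial>period)"
    by (rule nn_integral_ripple_measure[OF m])
  finally show ?thesis by (simp add: slice)
qed

lemma integrable_ripple: "integrable period ripple" "integrable period (\<lambda>x. (ripple x)\<^sup>2)"
  by (auto intro!: integrable_period_continuous continuous_intros continuous_ripple)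

lemma ripple_mass_nonneg: "0 \<le> (\<integral>x. ripple x \<partial>period)"
  by (rule Bochner_Integration.integral_nonneg) (use ripple_bounds(1) order_trans zero_le_one in blast)

text \<open>The pair distribution integrates f(x) times the mass of the r-ball at x, and that mass
  is 2 r f(x) up to the oscillation w of f. The leading term is therefore 2 r times the integral of
  f^2.\<close>

lemma pair_distribution_ripple_bounds:
  assumes r: "0 < r" "r \<le> 1" and w: "0 \<le> w" "w \<le> 1"
    and uc: "\<And>x t. x \<in> {0..<2*pi} \<Longrightarrow> \<bar>t - x\<bar> \<le> r \<Longrightarrow> \<bar>ripple t - ripple x\<bar> \<le> w"
  shows "\<bar>pair_distribution flat_torus ripple_measure r - 2 * r * ripple_energy\<bar> \<le> 2 * r * w * (\<integral>x. ripple x \<partial>period)"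
proof -
  let ?F = "pair_distribution flat_torus ripple_measure r"
  let ?M = "\<integral>x. ripple x \<partial>period"
  interpret pm: finite_measure "ripple_measure \<Otimes>\<^sub>M ripple_measure"
    by (rule finite_measure_pair_measure[OF finite_measure_ripple finite_measure_ripple])
  have F: "ennreal ?F = (\<integral>\<^sup>+x. ennreal (ripple x) * emeasure ripple_measure {q \<in> torus. torus_dist (emb x 0) q \<le> r} \<partial>period)"
    unfolding pair_distribution_torus emeasure_close_pairs[symmetric] by (simp add: pm.emeasure_eq_measure)
  have near: "ennreal ((ripple x - w) * (2 * r)) \<le> emeasure ripple_measure {q \<in> torus. torus_dist (emb x 0) q \<le> r} \<and>
     emeasure ripple_measure {q \<in> torus. torus_dist (emb x 0) q \<le> r} \<le> ennreal ((ripple x + w) * (2 * r))"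
    if x: "x \<in> {0..<2*pi}" for x
  proof (rule emeasure_ripple_near[where x = x and I = "{x - r..x + r}"])
    fix t
    show "ripple x - w \<le> ripple t \<and> ripple t \<le> ripple x + w" if "\<bar>t - x\<bar> \<le> r"
      using uc[OF x that] by (simp add: abs_le_iff)
    show "emb t 0 \<in> {q \<in> torus. torus_dist (emb x 0) q \<le> r} \<longleftrightarrow> t \<in> {x - r..x + r}" if "\<bar>t - x\<bar> \<le> pi"
    proof -
      have "torus_dist (emb x 0) (emb t 0) \<le> r \<longleftrightarrow> \<bar>t - x\<bar> \<le> r"
        using that by (simp add: torus_dist_circle arccos_cos_abs)
      then show ?thesis by (auto simp: abs_le_iff)
    qed
  qed (use r w ripple_bounds(1)[of x] ball_sets(2)[of "emb x 0" r] in auto)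
  \<comment> \<open>Used with u = w and u = - w. As \<open>ripple\<close> is at least 1 and u at
    least -1, all factors are nonnegative and the products may be moved into
    \<open>ennreal\<close>.\<close>
  have poly: "(\<integral>\<^sup>+x. ennreal (ripple x) * ennreal ((ripple x + u) * (2 * r)) \<partial>period) = ennreal (2 * r * (ripple_energy + u * ?M))"
    if "- 1 \<le> u" for u
  proof -
    have eq: "ennreal (ripple x) * ennreal ((ripple x + u) * (2 * r)) = ennreal (2 * r * ((ripple x)\<^sup>2 + u * ripple x))" for x
    proof -
      have "0 \<le> ripple x" "0 \<le> (ripple x + u) * (2 * r)"
        using ripple_bounds(1)[of x] r that by (auto intro!: mult_nonneg_nonneg)
      then have "ennreal (ripple x) * ennreal ((ripple x + u) * (2 * r)) = ennreal (ripple x * ((ripple x + u) * (2 * r)))"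
        by (rule ennreal_mult[symmetric])
      then show ?thesis by (simp add: power2_eq_square algebra_simps)
    qed
    have nn: "0 \<le> 2 * r * ((ripple x)\<^sup>2 + u * ripple x)" for x
    proof -
      have "0 \<le> (2 * r) * (ripple x * (ripple x + u))" using ripple_bounds(1)[of x] that r by (intro mult_nonneg_nonneg) auto
      then show ?thesis by (simp add: power2_eq_square algebra_simps)
    qed
    have "(\<integral>\<^sup>+x. ennreal (2 * r * ((ripple x)\<^sup>2 + u * ripple x)) \<partial>period) = ennreal (\<integral>x. 2 * r * ((ripple x)\<^sup>2 + u * ripple x) \<partial>period)"
      by (rule nn_integral_eq_integral) (use integrable_ripple nn in auto)
    also have "(\<integral>x. 2 * r * ((ripple x)\<^sup>2 + u * ripple x) \<partial>period) = 2 * r * (ripple_energy + u * ?M)"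
      unfolding ripple_energy_def using integrable_ripple by simp
    finally show ?thesis unfolding eq .
  qed
  have "(\<integral>\<^sup>+x. ennreal (ripple x) * ennreal ((ripple x + - w) * (2 * r)) \<partial>period) \<le> ennreal ?F"
    unfolding F using near by (intro nn_integral_mono mult_left_mono) (auto simp: space_period)
  then have 1: "2 * r * (ripple_energy + - w * ?M) \<le> ?F"
    using w poly[of "- w"] by (subst (asm) poly) (simp_all add: ennreal_le_iff pair_distribution_torus)
  have M0: "0 \<le> ?M" by (rule ripple_mass_nonneg)
  have E0: "0 \<le> ripple_energy" unfolding ripple_energy_def by (rule Bochner_Integration.integral_nonneg) simp
  have "ennreal ?F \<le> (\<integral>\<^sup>+x. ennreal (ripple x) * ennreal ((ripple x + w) * (2 * r)) \<partial>period)"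
    unfolding F using near by (intro nn_integral_mono mult_left_mono) (auto simp: space_period)
  also have "\<dots> = ennreal (2 * r * (ripple_energy + w * ?M))" using w by (intro poly) simp
  finally have 2: "?F \<le> 2 * r * (ripple_energy + w * ?M)"
    using r w M0 E0 by (subst (asm) ennreal_le_iff) auto
  show ?thesis using 1 2 by (simp add: abs_le_iff algebra_simps)
qed

lemma ripple_energy_pos: "0 < ripple_energy"
proof -
  have "(\<integral>x. 1 \<partial>period) \<le> ripple_energy"
    unfolding ripple_energy_def
  proof (rule integral_mono)
    show "1 \<le> (ripple x)\<^sup>2" for x using ripple_bounds(1)[of x] by simp
  qed (use integrable_ripple in auto)
  moreover have "(\<integral>x. 1 \<partial>period) = 2 * pi" by (simp add: measure_def emeasure_period space_period)
  ultimately show ?thesis using pi_gt_zero by linarith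
qed

text \<open>\<open>unit_ball_vol 1\<close> is 2, which matches the factor 2 r, and uniform
  continuity makes the oscillation over distance r arbitrarily small.\<close>

lemma ripple_averaged_density: "averaged_density_constant flat_torus 1 ripple_measure ripple_energy"
  unfolding averaged_density_constant_def
proof (intro conjI ripple_energy_pos landau_o.smallI)
  fix c :: real assume c: "c > 0"
  let ?M = "\<integral>x. ripple x \<partial>period"
  have M0: "0 \<le> ?M" by (rule ripple_mass_nonneg)
  \<comment> \<open>Makes 2 w M at most the tolerated relative error c; the cap 1 is what the
    pair-distribution bound asks for.\<close>
  define w where "w = min 1 (c / (2 * (?M + 1)))"
  have w: "0 < w" "w \<le> 1" using c M0 by (auto simp: w_def)
  have "w * (2 * (?M + 1)) \<le> c" using M0 by (simp add: w_def min_le_iff_disj pos_le_divide_eq[symmetric])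
  then have wM: "2 * w * ?M \<le> c" using w by (simp add: algebra_simps)
  \<comment> \<open>The interval [-1, 2 pi + 1] contains every t within distance r \<le> 1 of a
    point of the period.\<close>
  have "uniformly_continuous_on {- 1..2*pi + 1} ripple"
    by (intro compact_uniformly_continuous continuous_on_subset[OF continuous_ripple]) auto
  then obtain d where d: "d > 0" "\<And>x t. x \<in> {- 1..2*pi + 1} \<Longrightarrow> t \<in> {- 1..2*pi + 1} \<Longrightarrow> dist t x < d \<Longrightarrow> dist (ripple t) (ripple x) < w"
    using w(1) unfolding uniformly_continuous_on_def by metis
  have "\<forall>\<^sub>F r in at_right 0. r \<in> {0<..<min 1 d}"
    by (rule eventually_at_right_real) (use d in simp)
  then show "\<forall>\<^sub>F r in at_right 0. norm (pair_distribution flat_torus ripple_measure r - unit_ball_vol 1 * ripple_energy * r powr 1) \<le> c * norm (r powr 1)"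
  proof eventually_elim
    case (elim r)
    then have r: "0 < r" "r \<le> 1" "r < d" by auto
    have "\<bar>pair_distribution flat_torus ripple_measure r - 2 * r * ripple_energy\<bar> \<le> 2 * r * w * ?M"
    proof (rule pair_distribution_ripple_bounds[OF r(1,2)])
      fix x t assume "x \<in> {0..<2*pi}" "\<bar>t - x\<bar> \<le> r"
      then have "dist (ripple t) (ripple x) < w" using r by (intro d(2)) (auto simp: dist_real_def abs_le_iff)
      then show "\<bar>ripple t - ripple x\<bar> \<le> w" by (simp add: dist_real_def)
    qed (use w in auto)
    also have "\<dots> \<le> c * r" using mult_left_mono[OF wM, of r] r by (simp add: mult_ac)
    finally show ?case using r by (simp add: mult_ac)
  qed
qed

section \<open>Upper bound for the Kuznecov sum\<close>

lemma circle_mode_at_1: "(circle_mode l 1)\<^sup>2 = (if l = 0 then 1 / (2*pi) else if l > 0 then 1 / pi else 0)"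
  using circle_mode_cis[of l 0] by (auto simp: amp_def phase_def power_divide)

text \<open>Sines vanish at the point 1, l = 0 contributes 1 / (2 pi) and each l \<ge> 1 contributes
  1 / pi: together (2 m + 1) / (2 pi), with m the integer part of L.\<close>

lemma sum_circle_mode_at_1:
  assumes "0 \<le> L"
  shows "(\<Sum>l | \<bar>real_of_int l\<bar> \<le> L. (circle_mode l 1)\<^sup>2) \<le> (2 * L + 1) / (2 * pi)"
proof -
  define m where "m = \<lfloor>L\<rfloor>"
  have m: "0 \<le> m" "of_int m \<le> L" using assms by (auto simp: m_def)
  have set: "{l. \<bar>real_of_int l\<bar> \<le> L} = {- m..m}"
    unfolding m_def by (auto simp: abs_le_iff le_floor_iff) linarith+
  have "(\<Sum>l\<in>{- m..m}. (circle_mode l 1)\<^sup>2) = (\<Sum>l\<in>{0..m}. (circle_mode l 1)\<^sup>2)"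
    by (rule sum.mono_neutral_right) (use m in \<open>auto simp: circle_mode_at_1\<close>)
  also have "{0..m} = insert 0 {1..m}" using m by auto
  also have "(\<Sum>l\<in>insert 0 {1..m}. (circle_mode l 1)\<^sup>2) = 1 / (2*pi) + (\<Sum>l\<in>{1..m}. 1 / pi)"
    by (subst sum.insert) (auto simp: circle_mode_at_1 intro!: sum.cong)
  also have "\<dots> = (2 * of_int m + 1) / (2*pi)" using m by (simp add: field_simps)
  also have "\<dots> \<le> (2 * L + 1) / (2*pi)" using m by (intro divide_right_mono) auto
  finally show ?thesis by (simp add: set)
qed

lemma kuznecov_ripple_le:
  fixes L :: real
  assumes b: "laplace_eigenbasis flat_torus e lam" and L: "0 \<le> L" "L < freq j"
  shows "kuznecov_sum e lam ripple_measure L \<le> (ripple_energy - pi * (1/4) ^ Suc j) * ((2 * L + 1) / (2 * pi))"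
proof -
  let ?S = "{k. \<bar>real_of_int k\<bar> \<le> L}"
  have "?S \<subseteq> {- \<lfloor>L\<rfloor>..\<lfloor>L\<rfloor>}" by (auto simp: abs_le_iff le_floor_iff) linarith
  then have fin: "finite ?S" by (rule finite_subset) simp
  have deficit: "(\<Sum>k\<in>?S. (ripple_coeff k)\<^sup>2) \<le> ripple_energy - pi * (1/4) ^ Suc j"
    by (rule ripple_bessel_deficit[OF fin]) (use L in auto)
  have "kuznecov_sum e lam ripple_measure L \<le> (\<Sum>z | real (weight z) \<le> L\<^sup>2. (\<integral>p. mode z p \<partial>ripple_measure)\<^sup>2)"
    by (rule kuznecov_sum_le[OF b finite_borel_ripple])
  \<comment> \<open>The disc is replaced by its bounding square, which turns the sum into a product;
    each k then receives at most what the main term assigns to it, up to a bounded error.\<close>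
  also have "\<dots> \<le> (\<Sum>z\<in>?S \<times> ?S. (\<integral>p. mode z p \<partial>ripple_measure)\<^sup>2)"
  proof (rule sum_mono2)
    show "{z. real (weight z) \<le> L\<^sup>2} \<subseteq> ?S \<times> ?S"
    proof
      fix z assume "z \<in> {z. real (weight z) \<le> L\<^sup>2}"
      then have "(real_of_int (fst z))\<^sup>2 + (real_of_int (snd z))\<^sup>2 \<le> L\<^sup>2" by (simp add: real_weight)
      then have "(real_of_int (fst z))\<^sup>2 \<le> L\<^sup>2" "(real_of_int (snd z))\<^sup>2 \<le> L\<^sup>2"
        using zero_le_power2[of "real_of_int (fst z)"] zero_le_power2[of "real_of_int (snd z)"] by linarith+
      then show "z \<in> ?S \<times> ?S" using L(1) by (cases z) (simp add: power2_le_iff_abs_le)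
    qed
  qed (use fin in auto)
  also have "\<dots> = (\<Sum>k\<in>?S. (ripple_coeff k)\<^sup>2) * (\<Sum>l\<in>?S. (circle_mode l 1)\<^sup>2)"
    by (simp add: integral_mode_ripple power_mult_distrib sum_product sum.cartesian_product case_prod_unfold)
  also have "\<dots> \<le> (ripple_energy - pi * (1/4) ^ Suc j) * ((2 * L + 1) / (2 * pi))"
    by (intro mult_mono deficit sum_circle_mode_at_1 L sum_nonneg order_trans[OF sum_nonneg deficit]) auto
  finally show ?thesis .
qed

lemma kuznecov_ripple_not_bigo:
  fixes \<delta> :: real
  assumes \<delta>: "0 < \<delta>" "\<delta> < 1" and b: "laplace_eigenbasis flat_torus e lam"
  shows "(\<lambda>L. kuznecov_sum e lam ripple_measure L - ripple_energy / pi * L) \<notin> O[at_top](\<lambda>L. L powr (1 - \<delta>))"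
proof
  assume "(\<lambda>L. kuznecov_sum e lam ripple_measure L - ripple_energy / pi * L) \<in> O[at_top](\<lambda>L. L powr (1 - \<delta>))"
  then obtain C where "C > 0" and "\<forall>\<^sub>F L in at_top. norm (kuznecov_sum e lam ripple_measure L - ripple_energy / pi * L) \<le> C * norm (L powr (1 - \<delta>))"
    by (elim landau_o.bigE)
  then obtain L0 where C: "\<And>L. L \<ge> L0 \<Longrightarrow> \<bar>kuznecov_sum e lam ripple_measure L - ripple_energy / pi * L\<bar> \<le> C * L powr (1 - \<delta>)"
    by (auto simp: eventually_at_top_linorder)
  \<comment> \<open>Just below the frequency, so that \<open>freq j\<close> is still missing; the
    shift 1/2 makes 2 L + 1 equal to twice \<open>freq j\<close>.\<close>
  define L where "L j = real (freq j) - 1/2" for j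
  \<comment> \<open>\<open>freq j\<close> is at least 1, so subtracting 1/2 at most halves
    it.\<close>
  have L_ge: "L j \<ge> 2 powr ((real j)\<^sup>2 - 1)" "L j \<ge> 1 / 2" for j
  proof -
    have f: "real (freq j) = 2 powr ((real j)\<^sup>2)" by (simp add: freq_def powr_realpow[symmetric])
    have "1 \<le> real (freq j)" using freq_pos[of j] by simp
    then show "L j \<ge> 2 powr ((real j)\<^sup>2 - 1)" "L j \<ge> 1 / 2"
      unfolding L_def by (simp_all add: f powr_diff)
  qed
  \<comment> \<open>The deficit 4^(-j-1) L has to fit under the assumed error. Dividing by
    L^(1-\<delta>) leaves a bound for 4^(-j-1) L^\<delta>, the bounded term being absorbed because L
    \<ge> 1.\<close>
  have key: "(1/4) ^ Suc j * L j powr \<delta> \<le> C + ripple_energy" if j: "L j \<ge> L0" "L j \<ge> 1" for j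
  proof -
    have "kuznecov_sum e lam ripple_measure (L j) \<le> (ripple_energy - pi * (1/4) ^ Suc j) * ((2 * L j + 1) / (2 * pi))"
      by (rule kuznecov_ripple_le[OF b]) (use j in \<open>auto simp: L_def\<close>)
    also have "\<dots> = ripple_energy / pi * L j + ripple_energy / (2 * pi) - (1/4) ^ Suc j * (L j + 1/2)"
      by (simp add: field_simps)
    finally have "(1/4) ^ Suc j * (L j + 1/2) \<le> C * L j powr (1 - \<delta>) + ripple_energy / (2 * pi)"
      using C[OF j(1)] by (simp add: abs_le_iff)
    moreover have "(1/4) ^ Suc j * L j \<le> (1/4) ^ Suc j * (L j + 1/2)" by simp
    moreover have "ripple_energy / (2 * pi) \<le> ripple_energy * L j powr (1 - \<delta>)"
    proof -
      have "ripple_energy / (2 * pi) \<le> ripple_energy * 1"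
        using ripple_energy_pos pi_gt3 by (simp add: divide_le_eq)
      also have "\<dots> \<le> ripple_energy * L j powr (1 - \<delta>)"
        using ripple_energy_pos j(2) \<delta> by (intro mult_left_mono ge_one_powr_ge_zero) auto
      finally show ?thesis .
    qed
    ultimately have "(1/4) ^ Suc j * L j \<le> (C + ripple_energy) * L j powr (1 - \<delta>)"
      unfolding distrib_right by linarith
    moreover have "L j = L j powr \<delta> * L j powr (1 - \<delta>)" using j(2) by (simp flip: powr_add)
    ultimately have "((1/4) ^ Suc j * L j powr \<delta>) * L j powr (1 - \<delta>) \<le> (C + ripple_energy) * L j powr (1 - \<delta>)"
      by (simp add: mult.assoc)
    then show ?thesis using j(2) by (simp add: mult_le_cancel_right)
  qed
  \<comment> \<open>In powers of 2 the bounded quantity has exponent at least \<delta> (j^2 - 1) - 2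
    (j + 1), which tends to infinity: the quadratic gain beats the linear loss for every positive
    \<delta>.\<close>
  have "filterlim (\<lambda>j. 2 powr ((real j)\<^sup>2 - 1)) at_top sequentially" by real_asymp
  then have "\<forall>\<^sub>F j in sequentially. 2 powr ((real j)\<^sup>2 - 1) \<ge> max L0 1"
    unfolding filterlim_at_top by blast
  moreover have "filterlim (\<lambda>j. (1/4) ^ Suc j * (2 powr ((real j)\<^sup>2 - 1)) powr \<delta>) at_top sequentially"
    using \<delta> by real_asymp
  then have "\<forall>\<^sub>F j in sequentially. (1/4) ^ Suc j * (2 powr ((real j)\<^sup>2 - 1)) powr \<delta> \<ge> C + ripple_energy + 1"
    unfolding filterlim_at_top by blast
  ultimately have "\<forall>\<^sub>F j in sequentially. False"
  proof eventually_elim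
    case (elim j)
    then have "L j \<ge> L0" "L j \<ge> 1" using L_ge(1)[of j] by auto
    from key[OF this] have "(1/4) ^ Suc j * L j powr \<delta> \<le> C + ripple_energy" .
    moreover have "(1/4) ^ Suc j * (2 powr ((real j)\<^sup>2 - 1)) powr \<delta> \<le> (1/4) ^ Suc j * L j powr \<delta>"
      using L_ge(1)[of j] \<delta> by (intro mult_left_mono powr_mono2) auto
    ultimately show False using elim(2) by linarith
  qed
  then show False by simp
qed

theorem proposition1p8:
  fixes \<delta> :: real
  assumes "0 < \<delta>" and "\<delta> < 1"
  shows "\<exists>(R :: (nat \<Rightarrow> real) riemannian) n s \<mu> A.
    compact_connected_riemannian_manifold R \<and> dim_of R = n \<and> n \<ge> 2 \<and>
    0 < s \<and> s < real n \<and>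
    finite_borel_measure R \<mu> \<and> ahlfors_david_regular R s \<mu> \<and>
    averaged_density_constant R s \<mu> A \<and>
    (\<exists>e lam. laplace_eigenbasis R e lam) \<and>
    (\<forall>e lam. laplace_eigenbasis R e lam \<longrightarrow>
       (\<lambda>L. kuznecov_sum e lam \<mu> L - kuznecov_constant n s * A * L powr (real n - s))
         \<notin> O[at_top](\<lambda>L. L powr (real n - s - \<delta>)))"
proof -
  have "(\<lambda>L. kuznecov_sum e lam ripple_measure L - kuznecov_constant 2 1 * ripple_energy * L powr (real 2 - 1))
         \<notin> O[at_top](\<lambda>L. L powr (real 2 - 1 - \<delta>))" if "laplace_eigenbasis flat_torus e lam" for e lam
  proof -
    \<comment> \<open>For n = 2 and s = 1 the constant is vol(B^1) / (2 pi) = 2 / (2 pi).\<close>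
    have k: "kuznecov_constant 2 1 = 1 / pi" by (simp add: kuznecov_constant_def powr_minus field_simps)
    \<comment> \<open>\<open>L powr 1\<close> is L for nonnegative L, hence the passage to large
      L.\<close>
    have "\<forall>\<^sub>F L in at_top. kuznecov_sum e lam ripple_measure L - kuznecov_constant 2 1 * ripple_energy * L powr (real 2 - 1)
       = kuznecov_sum e lam ripple_measure L - ripple_energy / pi * L"
      using eventually_gt_at_top[of "0::real"] by eventually_elim (simp add: k)
    from landau_o.big.in_cong[OF this] kuznecov_ripple_not_bigo[OF assms that] show ?thesis by simp
  qed
  then show ?thesis
    using compact_connected_torus finite_borel_ripple ripple_ahlfors_david ripple_averaged_density eigenbasis_exists
    by (intro exI[of _ flat_torus] exI[of _ "2::nat"])
       (rule exI[of _ 1], rule exI[of _ ripple_measure], rule exI[of _ ripple_energy], simp)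
qed

end
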